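(* Let $X,\nu,R,M_p,M_p^*$ be as in the context, with $R\nabla$ closable in $L^p(X,\nu)$ for every $p\in(1,\infty)$. Let $g_1,g_2:X\to\mathbb{R}$ be Borel functions such that, for $i=1,2$: for every $p>1$, $g_i\in W^{1,p}(X,\nu)$ and $Mg_i\,\|Mg_i\|^{-2}\in D(M_p^* )$; and $Mg_i\in W^{1,q}(X,\nu;X)$ for some $q>2$. Assume that for some $r\in\mathbb{R}$ $$\{x\in X:\ g_1(x)<r\}=\{x\in X:\ g_2(x)<r\}.$$ Then the weighted measures $T_1(\|Mg_1\|)\,d\sigma_r^{g_1}$ and $T_2(\|Mg_2\|)\,d\sigma_r^{g_2}$ coincide, where $T_i$ is the trace operator of Sobolev functions in $L^1(X,\sigma_r^{g_i})$.
   Context: $X$ is a separable infinite-dimensional real Hilbert space with inner product $\langle\cdot,\cdot\rangle$ and norm $\|\cdot\|$, and $\nu$ is a non-degenerate Borel probability measure on $X$ (non-degenerate: not concentrated on any proper closed linear subspace). $C_b(X)$ is the space of bounded continuous real functions; $C_b^1(X)$ is the space of bounded continuously Fréchet differentiable $\varphi:X\to\mathbb{R}$ with bounded gradient $\nabla\varphi$. $R\in\mathcal{L}(X)$ is a bounded linear operator such that for every $p\in(1,\infty)$ the operator $\varphi\mapsto R\nabla\varphi$, with domain $C^1_b(X)\subset L^p(X,\nu)$ and values in $L^p(X,\nu;X)$, is closable. $M_p$ denotes its closure, $W^{1,p}(X,\nu)$ the domain of $M_p$, with norm $\|f\|_{W^{1,p}}=\|f\|_{L^p(X,\nu)}+\|M_pf\|_{L^p(X,\nu;X)}$.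 With $p'=p/(p-1)$, $M_p^*:D(M_p^* )\subset L^{p'}(X,\nu;X)\to L^{p'}(X,\nu)$ is the adjoint of $M_p$. One writes $M$, $M^*$ on $\bigcap_{p>1}W^{1,p}(X,\nu)$, $\bigcap_{p>1}D(M_p^* )$, where the operators do not depend on $p$. The condition on $Mg_i\,\|Mg_i\|^{-2}$ includes that it is defined $\nu$-a.e. For $p>1$, $W^{1,p}(X,\nu;X)$ is the space of vector fields $F:X\to X$ such that, for a given orthonormal basis $\{e_i\}_{i\in\mathbb{N}}$ of $X$, $f_i:=\langle F,e_i\rangle\in W^{1,p}(X,\nu)$ for every $i$ and $(\sum_{i}\|M_pf_i\|^2)^{1/2}\in L^p(X,\nu)$ (independent of the basis). Under the assumption on $Mg_i$, $\|Mg_i\|\in W^{1,q}(X,\nu)$. For such a $g$ and $r\in\mathbb{R}$, $\sigma_r^g$ is the unique finite nonnegative Borel measure on $X$ such that $\int_X\varphi\,d\sigma_r^g=\frac{d}{dr}\int_{\{g\le r\}}\varphi\,d\nu$ for every $\varphi\in C_b(X)$ (the derivatives and the measure exist whenever $R\nabla$ is closable in $L^p(X,\nu)$ for every $p\in(1,\infty)$ and $g:X\to\mathbb{R}$ is a Borel function such that $g\in W^{1,p}(X,\nu)$ and $Mg\,\|Mg\|^{-2}\in D(M_p^* )$ for every $p>1$; in particular for $g=g_1$ and $g=g_2$). For $f\in W^{1,p}(X,\nu)$, $p>1$, the trace $Tf\in L^1(X,\sigma_r^g)$ is the common limit in $L^1(X,\sigma_r^g)$ of all sequences in $C_b^1(X)$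 converging to $f$ in $W^{1,p}(X,\nu)$ (it is well defined); $T_i$ is the operator $T$ associated with $g=g_i$. *)

theory Defs
  imports "HOL-Probability.Probability"
begin

text \<open>
  Elements of \<open>L\<^sup>p\<close> spaces are represented by measurable functions, not by equivalence classes;
  operators on equivalence classes (\<open>sobolev_grad\<close>, \<open>sobolev_grad_all\<close>, \<open>sobolev_trace\<close>) return a
  chosen representative, and uniqueness is up to null sets.
\<close>

definition nondegenerate :: "'a::real_normed_vector measure \<Rightarrow> bool" where
  "nondegenerate \<nu> \<longleftrightarrow>
    (\<forall>V. subspace V \<and> closed V \<and> V \<noteq> UNIV \<longrightarrow> \<not> (AE x in \<nu>. x \<in> V))"

definition orthonormal_basis :: "(nat \<Rightarrow> 'a::real_inner) \<Rightarrow> bool" where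
  "orthonormal_basis e \<longleftrightarrow>
    (\<forall>i j. e i \<bullet> e j = (if i = j then 1 else 0)) \<and> closure (span (range e)) = UNIV"

definition lp_space :: "'a measure \<Rightarrow> real \<Rightarrow> ('a \<Rightarrow> 'b::real_normed_vector) set" where
  "lp_space \<nu> p = {F \<in> borel_measurable \<nu>. integrable \<nu> (\<lambda>x. norm (F x) powr p)}"

text \<open>Only meaningful on \<open>lp_space \<nu> p\<close>: a non-integrable function has Bochner integral 0.\<close>

definition lp_norm :: "'a measure \<Rightarrow> real \<Rightarrow> ('a \<Rightarrow> 'b::real_normed_vector) \<Rightarrow> real" where
  "lp_norm \<nu> p F = (\<integral>x. norm (F x) powr p \<partial>\<nu>) powr (1 / p)"

definition gradient :: "('a::real_inner \<Rightarrow> real) \<Rightarrow> 'a \<Rightarrow> 'a" where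
  "gradient \<phi> x = (THE D. GDERIV \<phi> x :> D)"

text \<open>
  On a Hilbert space Frechet differentiability at a point is the same as existence of the gradient
  there, and the Riesz isometry carries continuity of the derivative to that of the gradient.
\<close>

definition Cb1 :: "('a::real_inner \<Rightarrow> real) set" where
  "Cb1 = {\<phi>. bounded (range \<phi>) \<and> (\<forall>x. GDERIV \<phi> x :> gradient \<phi> x) \<and>
             continuous_on UNIV (gradient \<phi>) \<and> bounded (range (gradient \<phi>))}"

definition closable_grad :: "'a::real_inner measure \<Rightarrow> ('a \<Rightarrow> 'a) \<Rightarrow> real \<Rightarrow> bool" where
  "closable_grad \<nu> R p \<longleftrightarrow>
    (\<forall>\<phi> G. (\<forall>n. \<phi> n \<in> Cb1) \<and> G \<in> lp_space \<nu> p \<and>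
       (\<lambda>n. lp_norm \<nu> p (\<phi> n)) \<longlonglongrightarrow> 0 \<and>
       (\<lambda>n. lp_norm \<nu> p (\<lambda>x. R (gradient (\<phi> n) x) - G x)) \<longlonglongrightarrow> 0 \<longrightarrow>
       (AE x in \<nu>. G x = 0))"

text \<open>\<open>grad_closure \<nu> R p f G\<close>: the pair \<open>(f, G)\<close> belongs to the graph of the closure \<open>M\<^sub>p\<close>.\<close>

definition grad_closure ::
    "'a::real_inner measure \<Rightarrow> ('a \<Rightarrow> 'a) \<Rightarrow> real \<Rightarrow> ('a \<Rightarrow> real) \<Rightarrow> ('a \<Rightarrow> 'a) \<Rightarrow> bool" where
  "grad_closure \<nu> R p f G \<longleftrightarrow>
    f \<in> lp_space \<nu> p \<and> G \<in> lp_space \<nu> p \<and>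
    (\<exists>\<phi>. (\<forall>n. \<phi> n \<in> Cb1) \<and>
       (\<lambda>n. lp_norm \<nu> p (\<lambda>x. \<phi> n x - f x)) \<longlonglongrightarrow> 0 \<and>
       (\<lambda>n. lp_norm \<nu> p (\<lambda>x. R (gradient (\<phi> n) x) - G x)) \<longlonglongrightarrow> 0)"

definition sobolev :: "'a::real_inner measure \<Rightarrow> ('a \<Rightarrow> 'a) \<Rightarrow> real \<Rightarrow> ('a \<Rightarrow> real) set" where
  "sobolev \<nu> R p = {f. \<exists>G. grad_closure \<nu> R p f G}"

text \<open>The operator \<open>M\<^sub>p\<close>.\<close>

definition sobolev_grad ::
    "'a::real_inner measure \<Rightarrow> ('a \<Rightarrow> 'a) \<Rightarrow> real \<Rightarrow> ('a \<Rightarrow> real) \<Rightarrow> 'a \<Rightarrow> 'a" where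
  "sobolev_grad \<nu> R p f = (SOME G. grad_closure \<nu> R p f G)"

text \<open>The operator \<open>M\<close> on the intersection of all \<open>sobolev \<nu> R p\<close>, \<open>p > 1\<close>.\<close>

definition sobolev_grad_all ::
    "'a::real_inner measure \<Rightarrow> ('a \<Rightarrow> 'a) \<Rightarrow> ('a \<Rightarrow> real) \<Rightarrow> 'a \<Rightarrow> 'a" where
  "sobolev_grad_all \<nu> R f = (SOME G. \<forall>p>1. grad_closure \<nu> R p f G)"

definition sobolev_norm ::
    "'a::real_inner measure \<Rightarrow> ('a \<Rightarrow> 'a) \<Rightarrow> real \<Rightarrow> ('a \<Rightarrow> real) \<Rightarrow> real" where
  "sobolev_norm \<nu> R p f = lp_norm \<nu> p f + lp_norm \<nu> p (sobolev_grad \<nu> R p f)"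

text \<open>The domain of the adjoint of \<open>M\<^sub>p\<close>, inside \<open>L\<^bsup>p'\<^esup>\<close> with \<open>p' = p / (p - 1)\<close>.\<close>

definition adjoint_domain ::
    "'a::real_inner measure \<Rightarrow> ('a \<Rightarrow> 'a) \<Rightarrow> real \<Rightarrow> ('a \<Rightarrow> 'a) set" where
  "adjoint_domain \<nu> R p =
    {F \<in> lp_space \<nu> (p / (p - 1)).
       \<exists>h \<in> lp_space \<nu> (p / (p - 1)). \<forall>f \<in> sobolev \<nu> R p.
         (\<integral>x. sobolev_grad \<nu> R p f x \<bullet> F x \<partial>\<nu>) = (\<integral>x. f x * h x \<partial>\<nu>)}"

text \<open>
  The almost everywhere summability has to be stated separately because \<open>suminf\<close> of a divergent
  series is an unspecified real number rather than infinity.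
\<close>

definition sobolev_field ::
    "(nat \<Rightarrow> 'a::real_inner) \<Rightarrow> 'a measure \<Rightarrow> ('a \<Rightarrow> 'a) \<Rightarrow> real \<Rightarrow> ('a \<Rightarrow> 'a) set" where
  "sobolev_field e \<nu> R p =
    {F. (\<forall>i. (\<lambda>x. F x \<bullet> e i) \<in> sobolev \<nu> R p) \<and>
        (AE x in \<nu>. summable (\<lambda>i. (norm (sobolev_grad \<nu> R p (\<lambda>y. F y \<bullet> e i) x))\<^sup>2)) \<and>
        (\<lambda>x. sqrt (\<Sum>i. (norm (sobolev_grad \<nu> R p (\<lambda>y. F y \<bullet> e i) x))\<^sup>2)) \<in> lp_space \<nu> p}"

definition is_surface_measure ::
    "'a::topological_space measure \<Rightarrow> ('a \<Rightarrow> real) \<Rightarrow> real \<Rightarrow> 'a measure \<Rightarrow> bool" where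
  "is_surface_measure \<nu> g r \<sigma> \<longleftrightarrow>
    sets \<sigma> = sets borel \<and> finite_measure \<sigma> \<and>
    (\<forall>\<phi>::'a \<Rightarrow> real. continuous_on UNIV \<phi> \<and> bounded (range \<phi>) \<longrightarrow>
       ((\<lambda>s. LINT x:{x. g x \<le> s}|\<nu>. \<phi> x) has_real_derivative (\<integral>x. \<phi> x \<partial>\<sigma>)) (at r))"

text \<open>
  The trace does not depend on the exponent, so it is required to be the limit for every \<open>p > 1\<close>
  with \<open>f \<in> W\<^bsup>1,p\<^esup>\<close>.
\<close>

definition is_trace ::
    "'a::real_inner measure \<Rightarrow> ('a \<Rightarrow> 'a) \<Rightarrow> 'a measure \<Rightarrow> ('a \<Rightarrow> real) \<Rightarrow> ('a \<Rightarrow> real) \<Rightarrow> bool" where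
  "is_trace \<nu> R \<sigma> f u \<longleftrightarrow>
    integrable \<sigma> u \<and>
    (\<forall>p>1. f \<in> sobolev \<nu> R p \<longrightarrow>
      (\<forall>\<phi>. (\<forall>n. \<phi> n \<in> Cb1) \<and> (\<lambda>n. sobolev_norm \<nu> R p (\<lambda>x. \<phi> n x - f x)) \<longlonglongrightarrow> 0 \<longrightarrow>
         (\<lambda>n. \<integral>x. \<bar>\<phi> n x - u x\<bar> \<partial>\<sigma>) \<longlonglongrightarrow> 0))"

definition sobolev_trace ::
    "'a::real_inner measure \<Rightarrow> ('a \<Rightarrow> 'a) \<Rightarrow> 'a measure \<Rightarrow> ('a \<Rightarrow> real) \<Rightarrow> 'a \<Rightarrow> real" where
  "sobolev_trace \<nu> R \<sigma> f = (SOME u. is_trace \<nu> R \<sigma> f u)"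

text \<open>
  The hypotheses on a defining function \<open>g\<close>. Division by zero makes the rescaled
  field \<open>0\<close> where \<open>M g = 0\<close>, so \<open>M g \<noteq> 0\<close> almost everywhere is stated explicitly.
\<close>

definition admissible :: "'a::real_inner measure \<Rightarrow> ('a \<Rightarrow> 'a) \<Rightarrow> ('a \<Rightarrow> real) \<Rightarrow> bool" where
  "admissible \<nu> R g \<longleftrightarrow>
    g \<in> borel_measurable borel \<and> (\<forall>p>1. g \<in> sobolev \<nu> R p) \<and>
    (AE x in \<nu>. sobolev_grad_all \<nu> R g x \<noteq> 0) \<and>
    (\<forall>p>1. (\<lambda>x. (1 / (norm (sobolev_grad_all \<nu> R g x))\<^sup>2) *\<^sub>R sobolev_grad_all \<nu> R g x)
             \<in> adjoint_domain \<nu> R p)"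

end

theory Submission
  imports Defs
begin

text \<open>The idea: both weighted measures are recovered from the common sublevel set \<open>{g1 < r} = {g2 < r}\<close>
  by integration by parts.

  If \<open>\<Psi>\<close> lies in the domain of \<open>M\<^sub>p\<^sup>*\<close> with \<open>M\<^sub>p\<^sup>* \<Psi> = h\<close>, testing the adjoint relation with
  \<open>u \<theta>(g)\<close>, where \<open>\<theta>\<close> decreases from \<open>1\<close> to \<open>0\<close> on \<open>[r - \<epsilon>, r]\<close>, and letting \<open>\<epsilon> \<longlongrightarrow> 0\<close> gives
  \<open>lim (1/\<epsilon>) \<integral>\<^bsub>{r - \<epsilon> < g \<le> r}\<^esub> u \<langle>Mg, \<Psi>\<rangle> d\<nu> = - \<integral>\<^bsub>{g < r}\<^esub> (u h - \<langle>Mu, \<Psi>\<rangle>) d\<nu>\<close> for every Sobolev function \<open>u\<close> (\<open>slab_limit\<close>). The right-hand side depends on \<open>g\<close> only through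
  the set \<open>{g < r}\<close>. For \<open>g = g\<^sub>i\<close> and \<open>\<Psi> = \<Psi>\<^sub>i = Mg\<^sub>i \<parallel>Mg\<^sub>i\<parallel>\<^sup>-\<^sup>2\<close> the inner product on the left is \<open>1\<close>;
  so the left-hand side is the surface integral of \<open>u\<close> when \<open>u\<close> is smooth, and by density the
  surface integral of the trace of \<open>u\<close> (\<open>trace_integral\<close>).

  Now let \<open>\<phi> \<ge> 0\<close> be smooth and take \<open>u = \<phi> \<parallel>Mg1\<parallel>\<close> and \<open>\<Psi> = \<Psi>1\<close>. With \<open>g = g1\<close> the formula gives
  the integral of \<open>\<phi>\<close> against the first weighted measure. As the sublevel sets agree, \<open>g = g2\<close> gives the
  same number, now as a limit of averages of \<open>\<phi> \<langle>Mg2, Mg1\<rangle> / \<parallel>Mg1\<parallel> \<le> \<phi> \<parallel>Mg2\<parallel>\<close> over slabs of \<open>g2\<close>,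
  which is at most the integral of \<open>\<phi>\<close> against the second weighted measure (\<open>weighted_trace_le\<close>).
  By symmetry the two integrals are equal, and smooth nonnegative functions separate finite Borel
  measures (\<open>measure_eqI_Cb1\<close>).

  For this, \<open>\<parallel>Mg\<^sub>i\<parallel>\<close> must be a Sobolev function of some exponent \<open>q > 2\<close>, which follows from the
  hypothesis on the field \<open>Mg\<^sub>i\<close> (\<open>norm_field_sobolev\<close>); its trace must exist as an \<open>L\<^sup>1\<close> limit
  that is independent of the exponent (\<open>trace_exists\<close>, based on the estimate \<open>surface_abs_le\<close>); and
  the trace of a nonnegative function must be nonnegative (\<open>trace_nonneg\<close>), because a density
  with values in \<open>[0, \<infinity>]\<close> truncates negative values.\<close>

section \<open>Convergence in \<open>L\<^sup>p\<close>\<close>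

lemma norm_add_powr_le:
  fixes a b :: "'b::real_normed_vector"
  assumes "p > 0"
  shows "norm (a + b) powr p \<le> 2 powr p * (norm a powr p + norm b powr p)"
proof -
  have "norm (a + b) powr p \<le> (2 * max (norm a) (norm b)) powr p"
    using assms norm_triangle_ineq[of a b] by (intro powr_mono2) auto
  also have "\<dots> = 2 powr p * max (norm a) (norm b) powr p"
    by (simp add: powr_mult)
  also have "\<dots> \<le> 2 powr p * (norm a powr p + norm b powr p)"
    by (intro mult_left_mono) (auto simp: max_def)
  finally show ?thesis .
qed

lemma lp_space_bound:
  fixes f :: "'x \<Rightarrow> 'b::real_normed_vector" and g :: "'x \<Rightarrow> 'c::real_normed_vector"
  assumes "g \<in> lp_space M p" "f \<in> borel_measurable M" "p > 0"
    and le: "AE x in M. norm (f x) \<le> norm (g x)"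
  shows "f \<in> lp_space M p"
proof -
  have "integrable M (\<lambda>x. norm (f x) powr p)"
  proof (rule Bochner_Integration.integrable_bound)
    show "integrable M (\<lambda>x. norm (g x) powr p)" using assms(1) by (simp add: lp_space_def)
    show "(\<lambda>x. norm (f x) powr p) \<in> borel_measurable M" using assms(2) by measurable
    show "AE x in M. norm (norm (f x) powr p) \<le> norm (norm (g x) powr p)"
      using le by eventually_elim (use \<open>p > 0\<close> in \<open>auto intro!: powr_mono2\<close>)
  qed
  thus ?thesis using assms(2) by (simp add: lp_space_def)
qed

lemma lp_space_measurable: "f \<in> lp_space M p \<Longrightarrow> f \<in> borel_measurable M"
  by (simp add: lp_space_def)

lemma lp_space_integrable: "f \<in> lp_space M p \<Longrightarrow> integrable M (\<lambda>x. norm (f x) powr p)"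
  by (simp add: lp_space_def)

lemma lp_space_add:
  fixes f g :: "'x \<Rightarrow> 'b::{real_normed_vector, second_countable_topology}"
  assumes "f \<in> lp_space M p" "g \<in> lp_space M p" "p > 0"
  shows "(\<lambda>x. f x + g x) \<in> lp_space M p"
proof -
  have [measurable]: "f \<in> borel_measurable M" "g \<in> borel_measurable M"
    using assms by (auto simp: lp_space_def)
  have "integrable M (\<lambda>x. norm (f x + g x) powr p)"
    by (rule Bochner_Integration.integrable_bound[where
          f = "\<lambda>x. 2 powr p * (norm (f x) powr p + norm (g x) powr p)"])
       (use assms norm_add_powr_le[OF assms(3), of "f _" "g _"] in
         \<open>auto simp: lp_space_def intro: order_trans[OF _ abs_ge_self]\<close>)
  thus ?thesis by (simp add: lp_space_def)
qed

lemma lp_space_scaleR: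
  fixes f :: "'x \<Rightarrow> 'b::{real_normed_vector, second_countable_topology}"
  assumes "f \<in> lp_space M p"
  shows "(\<lambda>x. c *\<^sub>R f x) \<in> lp_space M p"
proof -
  have [measurable]: "f \<in> borel_measurable M" using assms by (rule lp_space_measurable)
  have "(\<lambda>x. c *\<^sub>R f x) \<in> borel_measurable M" by measurable
  thus ?thesis using assms by (simp add: lp_space_def powr_mult)
qed

lemma lp_space_diff:
  fixes f g :: "'x \<Rightarrow> 'b::{real_normed_vector, second_countable_topology}"
  assumes "f \<in> lp_space M p" "g \<in> lp_space M p" "p > 0"
  shows "(\<lambda>x. f x - g x) \<in> lp_space M p"
  using lp_space_add[OF assms(1) lp_space_scaleR[OF assms(2), of "-1"] assms(3)] by simp

lemma lp_space_bounded:
  fixes f :: "'x \<Rightarrow> 'b::real_normed_vector"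
  assumes "finite_measure M" "f \<in> borel_measurable M" "\<And>x. norm (f x) \<le> B" "p > 0"
  shows "f \<in> lp_space M p"
  by (rule lp_space_bound[where g = "\<lambda>_. B"])
     (use assms order_trans[OF norm_ge_zero assms(3)]
       in \<open>auto simp: lp_space_def finite_measure.integrable_const intro: order_trans[OF _ abs_ge_self]\<close>)

text \<open>Convergence is expressed by \<open>p\<close>-th powers of norms; for them \<open>norm_add_powr_le\<close> takes the place
  of Minkowski's inequality.\<close>

definition lp_conv ::
    "'x measure \<Rightarrow> real \<Rightarrow> (nat \<Rightarrow> 'x \<Rightarrow> 'b::real_normed_vector) \<Rightarrow> ('x \<Rightarrow> 'b) \<Rightarrow> bool" where
  "lp_conv M p F G \<longleftrightarrow> (\<forall>n. F n \<in> lp_space M p) \<and> G \<in> lp_space M p \<and>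
     (\<lambda>n. \<integral>x. norm (F n x - G x) powr p \<partial>M) \<longlonglongrightarrow> 0"

lemma lp_norm_tendsto_iff:
  fixes F :: "nat \<Rightarrow> 'x \<Rightarrow> 'b::real_normed_vector"
  assumes "p > 0"
  shows "(\<lambda>n. lp_norm M p (F n)) \<longlonglongrightarrow> 0 \<longleftrightarrow> (\<lambda>n. \<integral>x. norm (F n x) powr p \<partial>M) \<longlonglongrightarrow> 0"
proof
  assume L: "(\<lambda>n. lp_norm M p (F n)) \<longlonglongrightarrow> 0"
  have "(\<lambda>n. lp_norm M p (F n) powr p) \<longlonglongrightarrow> 0 powr p"
    using assms by (intro tendsto_powr2[OF L tendsto_const]) (auto simp: lp_norm_def)
  moreover have "lp_norm M p (F n) powr p = (\<integral>x. norm (F n x) powr p \<partial>M)" for n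
    using assms by (simp add: lp_norm_def powr_powr)
  ultimately show "(\<lambda>n. \<integral>x. norm (F n x) powr p \<partial>M) \<longlonglongrightarrow> 0" using assms by simp
next
  assume L: "(\<lambda>n. \<integral>x. norm (F n x) powr p \<partial>M) \<longlonglongrightarrow> 0"
  have "(\<lambda>n. (\<integral>x. norm (F n x) powr p \<partial>M) powr (1/p)) \<longlonglongrightarrow> 0 powr (1/p)"
    using assms by (intro tendsto_powr2[OF L tendsto_const]) auto
  thus "(\<lambda>n. lp_norm M p (F n)) \<longlonglongrightarrow> 0" by (simp add: lp_norm_def)
qed

lemma lp_convD:
  fixes F :: "nat \<Rightarrow> 'x \<Rightarrow> 'b::{real_normed_vector, second_countable_topology}"
  assumes "lp_conv M p F G" "p > 0"
  shows "F n \<in> lp_space M p" "G \<in> lp_space M p" "F n \<in> borel_measurable M" "G \<in> borel_measurable M"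
    and "(\<lambda>x. F n x - G x) \<in> lp_space M p"
    and "integrable M (\<lambda>x. norm (F n x - G x) powr p)"
    and "(\<lambda>n. \<integral>x. norm (F n x - G x) powr p \<partial>M) \<longlonglongrightarrow> 0"
proof -
  show F: "F n \<in> lp_space M p" and G: "G \<in> lp_space M p"
    and "(\<lambda>n. \<integral>x. norm (F n x - G x) powr p \<partial>M) \<longlonglongrightarrow> 0"
    using assms by (auto simp: lp_conv_def)
  show "F n \<in> borel_measurable M" "G \<in> borel_measurable M"
    using F G by (auto simp: lp_space_def)
  show D: "(\<lambda>x. F n x - G x) \<in> lp_space M p"
    by (rule lp_space_diff[OF F G assms(2)])
  show "integrable M (\<lambda>x. norm (F n x - G x) powr p)"
    using D by (simp add: lp_space_def)
qed

lemma lp_conv_bound: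
  fixes F :: "nat \<Rightarrow> 'x \<Rightarrow> 'b::{real_normed_vector, second_countable_topology}"
    and G :: "'x \<Rightarrow> 'b"
  assumes F: "\<And>n. F n \<in> lp_space M p" and G: "G \<in> lp_space M p" and p: "p > 0"
    and le: "\<And>n. AE x in M. norm (F n x - G x) powr p \<le> B n x"
    and B: "\<And>n. integrable M (B n)" "(\<lambda>n. \<integral>x. B n x \<partial>M) \<longlonglongrightarrow> 0"
  shows "lp_conv M p F G"
  unfolding lp_conv_def
proof (intro conjI allI F G)
  show "(\<lambda>n. \<integral>x. norm (F n x - G x) powr p \<partial>M) \<longlonglongrightarrow> 0"
  proof (rule tendsto_sandwich[OF _ _ tendsto_const B(2)])
    show "\<forall>\<^sub>F n in sequentially. (\<integral>x. norm (F n x - G x) powr p \<partial>M) \<le> (\<integral>x. B n x \<partial>M)"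
      by (intro always_eventually allI integral_mono_AE lp_space_integrable[OF lp_space_diff[OF F G p]] B(1) le)
  qed auto
qed

lemma lp_conv_add:
  fixes F :: "nat \<Rightarrow> 'x \<Rightarrow> 'b::{real_normed_vector, second_countable_topology}"
  assumes "lp_conv M p F G" "lp_conv M p F' G'" "p > 0"
  shows "lp_conv M p (\<lambda>n x. F n x + F' n x) (\<lambda>x. G x + G' x)"
proof (rule lp_conv_bound[where B = "\<lambda>n x. 2 powr p * (norm (F n x - G x) powr p + norm (F' n x - G' x) powr p)"])
  have i: "integrable M (\<lambda>x. norm (F n x - G x) powr p)" "integrable M (\<lambda>x. norm (F' n x - G' x) powr p)" for n
    using lp_convD(6)[OF assms(1,3)] lp_convD(6)[OF assms(2,3)] by auto
  show "integrable M (\<lambda>x. 2 powr p * (norm (F n x - G x) powr p + norm (F' n x - G' x) powr p))" for n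
    using i by auto
  have "(\<lambda>n. 2 powr p * ((\<integral>x. norm (F n x - G x) powr p \<partial>M) + (\<integral>x. norm (F' n x - G' x) powr p \<partial>M)))
      \<longlonglongrightarrow> 2 powr p * (0 + 0)"
    using assms by (intro tendsto_intros) (auto simp: lp_conv_def)
  thus "(\<lambda>n. \<integral>x. 2 powr p * (norm (F n x - G x) powr p + norm (F' n x - G' x) powr p) \<partial>M) \<longlonglongrightarrow> 0"
    using i by simp
  show "AE x in M. norm (F n x + F' n x - (G x + G' x)) powr p
      \<le> 2 powr p * (norm (F n x - G x) powr p + norm (F' n x - G' x) powr p)" for n
  proof (rule AE_I2)
    fix x
    have "F n x + F' n x - (G x + G' x) = (F n x - G x) + (F' n x - G' x)" by simp
    thus "norm (F n x + F' n x - (G x + G' x)) powr p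
      \<le> 2 powr p * (norm (F n x - G x) powr p + norm (F' n x - G' x) powr p)"
      using norm_add_powr_le[OF assms(3)] by metis
  qed
  show "(\<lambda>x. F n x + F' n x) \<in> lp_space M p" "(\<lambda>x. G x + G' x) \<in> lp_space M p" for n
    using assms by (simp_all add: lp_conv_def lp_space_add)
qed (rule assms)

lemma lp_conv_const:
  assumes "G \<in> lp_space M p" "p > 0" shows "lp_conv M p (\<lambda>n. G) G"
  using assms by (simp add: lp_conv_def)

lemma lp_conv_scaleR:
  fixes F :: "nat \<Rightarrow> 'x \<Rightarrow> 'b::{real_normed_vector, second_countable_topology}"
  assumes "lp_conv M p F G" "p > 0"
  shows "lp_conv M p (\<lambda>n x. c *\<^sub>R F n x) (\<lambda>x. c *\<^sub>R G x)"
proof -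
  have "norm (c *\<^sub>R F n x - c *\<^sub>R G x) powr p = \<bar>c\<bar> powr p * norm (F n x - G x) powr p" for n x
    by (simp add: powr_mult flip: scaleR_diff_right)
  moreover have "(\<lambda>n. \<bar>c\<bar> powr p * (\<integral>x. norm (F n x - G x) powr p \<partial>M)) \<longlonglongrightarrow> \<bar>c\<bar> powr p * 0"
    using assms by (intro tendsto_intros) (auto simp: lp_conv_def)
  ultimately show ?thesis using assms by (simp add: lp_conv_def lp_space_scaleR)
qed

lemma lp_conv_diff:
  fixes F :: "nat \<Rightarrow> 'x \<Rightarrow> 'b::{real_normed_vector, second_countable_topology}"
  assumes "lp_conv M p F G" "lp_conv M p F' G'" "p > 0"
  shows "lp_conv M p (\<lambda>n x. F n x - F' n x) (\<lambda>x. G x - G' x)"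
  using lp_conv_add[OF assms(1) lp_conv_scaleR[OF assms(2,3), of "-1"] assms(3)] by simp

lemma lp_conv_zero:
  assumes "p > 0" shows "lp_conv M p (\<lambda>n x. 0) (\<lambda>x. 0)"
  using assms by (simp add: lp_conv_def lp_space_def)

lemma lp_conv_sum:
  fixes F :: "'i \<Rightarrow> nat \<Rightarrow> 'x \<Rightarrow> 'b::{real_normed_vector, second_countable_topology}"
  assumes "finite I" "\<And>i. i \<in> I \<Longrightarrow> lp_conv M p (F i) (G i)" "p > 0"
  shows "lp_conv M p (\<lambda>n x. \<Sum>i\<in>I. F i n x) (\<lambda>x. \<Sum>i\<in>I. G i x)"
  using assms(1,2)
proof (induction I rule: finite_induct)
  case empty thus ?case using lp_conv_zero[OF assms(3)] by simp
next
  case (insert i I)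
  have "lp_conv M p (\<lambda>n x. F i n x + (\<Sum>i\<in>I. F i n x)) (\<lambda>x. G i x + (\<Sum>i\<in>I. G i x))"
    using insert by (intro lp_conv_add assms(3)) auto
  thus ?case using insert(1,2) by simp
qed

lemma lp_conv_cong_AE:
  fixes F :: "nat \<Rightarrow> 'x \<Rightarrow> 'b::{real_normed_vector, second_countable_topology}"
  assumes "lp_conv M p F G" "H \<in> borel_measurable M" "AE x in M. H x = G x" "p > 0"
  shows "lp_conv M p F H"
proof -
  have H: "H \<in> lp_space M p"
    by (rule lp_space_bound[OF lp_convD(2)[OF assms(1,4)] assms(2,4)]) (use assms(3) in auto)
  have [measurable]: "F n \<in> borel_measurable M" "G \<in> borel_measurable M" "H \<in> borel_measurable M" for n
    using lp_convD(3,4)[OF assms(1,4)] assms(2) by auto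
  have "(\<integral>x. norm (F n x - H x) powr p \<partial>M) = (\<integral>x. norm (F n x - G x) powr p \<partial>M)" for n
    by (rule integral_cong_AE) (use assms(3) in auto)
  thus ?thesis using assms H by (simp add: lp_conv_def)
qed

lemma lp_conv_subseq:
  assumes "lp_conv M p F G" "strict_mono r"
  shows "lp_conv M p (\<lambda>n. F (r n)) G"
  using assms LIMSEQ_subseq_LIMSEQ[of "\<lambda>n. \<integral>x. norm (F n x - G x) powr p \<partial>M" 0 r]
  by (auto simp: lp_conv_def o_def)

lemma lp_conv_imp_AE_subseq:
  fixes F :: "'i \<Rightarrow> nat \<Rightarrow> 'x \<Rightarrow> 'b::{real_normed_vector, second_countable_topology}"
  assumes "finite I" "\<And>i. i \<in> I \<Longrightarrow> lp_conv M p (F i) (G i)" "p > 0"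
  shows "\<exists>r. strict_mono r \<and> (AE x in M. \<forall>i\<in>I. (\<lambda>n. F i (r n) x) \<longlonglongrightarrow> G i x)"
proof -
  let ?u = "\<lambda>n x. \<Sum>i\<in>I. norm (F i n x - G i x) powr p"
  have i: "integrable M (\<lambda>x. norm (F i n x - G i x) powr p)" if "i \<in> I" for i n
    using lp_convD(6)[OF assms(2)[OF that] assms(3)] .
  have "(\<lambda>n. \<Sum>i\<in>I. \<integral>x. norm (F i n x - G i x) powr p \<partial>M) \<longlonglongrightarrow> (\<Sum>i\<in>I. 0)"
    using assms(2) by (intro tendsto_sum) (auto simp: lp_conv_def)
  hence "(\<lambda>n. \<integral>x. norm (?u n x) \<partial>M) \<longlonglongrightarrow> 0"
    using i by (simp add: sum_nonneg abs_of_nonneg)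
  then obtain r where r: "strict_mono r" "AE x in M. (\<lambda>n. ?u (r n) x) \<longlonglongrightarrow> 0"
    using tendsto_L1_AE_subseq[of M ?u] i by auto
  have "AE x in M. \<forall>i\<in>I. (\<lambda>n. F i (r n) x) \<longlonglongrightarrow> G i x"
    using r(2)
  proof eventually_elim
    fix x assume u: "(\<lambda>n. ?u (r n) x) \<longlonglongrightarrow> 0"
    show "\<forall>i\<in>I. (\<lambda>n. F i (r n) x) \<longlonglongrightarrow> G i x"
    proof
      fix i assume i: "i \<in> I"
      have "(\<lambda>n. norm (F i (r n) x - G i x) powr p) \<longlonglongrightarrow> 0"
        by (rule tendsto_sandwich[OF _ _ tendsto_const u])
           (use assms(1) i in \<open>auto intro!: always_eventually
             member_le_sum[where f = "\<lambda>i. norm (F i _ x - G i x) powr p"]\<close>)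
      hence "(\<lambda>n. (norm (F i (r n) x - G i x) powr p) powr (1/p)) \<longlonglongrightarrow> 0 powr (1/p)"
        by (rule tendsto_powr2[OF _ tendsto_const]) (use assms(3) in auto)
      hence "(\<lambda>n. norm (F i (r n) x - G i x)) \<longlonglongrightarrow> 0" using assms(3) by (simp add: powr_powr)
      thus "(\<lambda>n. F i (r n) x) \<longlonglongrightarrow> G i x"
        by (metis LIM_zero_cancel tendsto_norm_zero_cancel)
    qed
  qed
  thus ?thesis using r(1) by blast
qed

lemma lp_conv_dominated:
  fixes F :: "nat \<Rightarrow> 'x \<Rightarrow> 'b::{real_normed_vector, second_countable_topology}"
    and B :: "'x \<Rightarrow> real"
  assumes B: "B \<in> lp_space M p" and p: "p > 0"
    and F[measurable]: "\<And>n. F n \<in> borel_measurable M" and G[measurable]: "G \<in> borel_measurable M"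
    and le: "\<And>n. AE x in M. norm (F n x) \<le> B x"
    and lim: "AE x in M. (\<lambda>n. F n x) \<longlonglongrightarrow> G x"
  shows "lp_conv M p F G"
proof -
  have leA: "AE x in M. \<forall>n. norm (F n x) \<le> B x" using le by (simp add: AE_all_countable)
  have leG: "AE x in M. norm (G x) \<le> B x"
    using leA lim by eventually_elim (auto intro: LIMSEQ_le_const2[OF tendsto_norm])
  have F': "F n \<in> lp_space M p" for n
    by (rule lp_space_bound[OF B F p]) (use leA in \<open>eventually_elim, auto intro: order_trans[OF _ abs_ge_self]\<close>)
  have G': "G \<in> lp_space M p"
    by (rule lp_space_bound[OF B G p]) (use leG in \<open>eventually_elim, auto\<close>)
  have "(\<lambda>n. \<integral>x. norm (F n x - G x) powr p \<partial>M) \<longlonglongrightarrow> (\<integral>x. 0 \<partial>M)"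
  proof (rule integral_dominated_convergence[where w = "\<lambda>x. 2 powr p * (norm (B x) powr p + norm (B x) powr p)"])
    show "integrable M (\<lambda>x. 2 powr p * (norm (B x) powr p + norm (B x) powr p))"
      using lp_space_integrable[OF B] by simp
    show "AE x in M. (\<lambda>n. norm (F n x - G x) powr p) \<longlonglongrightarrow> 0"
      using lim
    proof eventually_elim
      fix x assume "(\<lambda>n. F n x) \<longlonglongrightarrow> G x"
      hence "(\<lambda>n. norm (F n x - G x)) \<longlonglongrightarrow> 0" by (simp add: LIM_zero tendsto_norm_zero)
      hence "(\<lambda>n. norm (F n x - G x) powr p) \<longlonglongrightarrow> 0 powr p"
        by (rule tendsto_powr2[OF _ tendsto_const]) (use p in auto)
      thus "(\<lambda>n. norm (F n x - G x) powr p) \<longlonglongrightarrow> 0" using p by simp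
    qed
    show "AE x in M. norm (norm (F n x - G x) powr p) \<le> 2 powr p * (norm (B x) powr p + norm (B x) powr p)" for n
      using leA leG
    proof eventually_elim
      fix x assume a: "\<forall>n. norm (F n x) \<le> B x" "norm (G x) \<le> B x"
      have "norm (F n x + - G x) powr p \<le> 2 powr p * (norm (F n x) powr p + norm (- G x) powr p)"
        by (rule norm_add_powr_le[OF p])
      also have "\<dots> \<le> 2 powr p * (norm (B x) powr p + norm (B x) powr p)"
        using a p by (intro mult_left_mono add_mono powr_mono2) (auto intro: order_trans[OF _ abs_ge_self])
      finally show "norm (norm (F n x - G x) powr p) \<le> 2 powr p * (norm (B x) powr p + norm (B x) powr p)"
        by simp
    qed
  qed simp_all
  thus ?thesis using F' G' by (simp add: lp_conv_def)
qed

lemma mult_le_powr_sum: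
  fixes a b :: real
  assumes "a \<ge> 0" "b \<ge> 0" "p > 1"
  shows "a * b \<le> a powr p + b powr (p / (p - 1))"
proof -
  have "a * b \<le> a powr p / p + b powr (p/(p-1)) / (p/(p-1))"
    using assms by (intro Youngs_inequality) (auto simp: field_simps)
  also have "\<dots> \<le> a powr p / 1 + b powr (p/(p-1)) / 1"
    using assms by (intro add_mono divide_left_mono) (auto simp: field_simps)
  finally show ?thesis by simp
qed

lemma integrable_norm_mult:
  fixes f :: "'x \<Rightarrow> 'b::real_normed_vector" and g :: "'x \<Rightarrow> 'c::real_normed_vector"
  assumes "f \<in> lp_space M p" "g \<in> lp_space M (p / (p - 1))" "p > 1"
  shows "integrable M (\<lambda>x. norm (f x) * norm (g x))"
proof -
  have [measurable]: "f \<in> borel_measurable M" "g \<in> borel_measurable M"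
    using assms by (auto simp: lp_space_def)
  show ?thesis
    by (rule Bochner_Integration.integrable_bound[where
          f = "\<lambda>x. norm (f x) powr p + norm (g x) powr (p / (p - 1))"])
       (use assms mult_le_powr_sum[of "norm (f _)" "norm (g _)" p] in \<open>auto simp: lp_space_def\<close>)
qed

text \<open>A quantitative substitute for Hoelder's inequality: rescaling one factor in Young's inequality
  makes the other term small.\<close>

lemma lp_mult_small:
  fixes g :: "'x \<Rightarrow> 'c::real_normed_vector"
  assumes g: "g \<in> lp_space M (p / (p - 1))" and p: "p > 1" and e: "e > 0"
  shows "\<exists>d>0. \<forall>f::'x \<Rightarrow> 'b::real_normed_vector. f \<in> lp_space M p \<longrightarrow>
     (\<integral>x. norm (f x) powr p \<partial>M) < d \<longrightarrow> (\<integral>x. norm (f x) * norm (g x) \<partial>M) < e"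
proof -
  define q where "q = p / (p - 1)"
  have q: "q > 0" using p by (simp add: q_def)
  define C where "C = (\<integral>x. norm (g x) powr q \<partial>M)"
  have C: "C \<ge> 0" by (simp add: C_def)
  define t where "t = (2 * (C + 1) / e) powr (1 / q)"
  have t: "t > 0" using C e by (simp add: t_def)
  have tq: "C / t powr q < e / 2"
  proof -
    have "t powr q = 2 * (C + 1) / e" using q C e by (simp add: t_def powr_powr)
    hence "C / t powr q = (e / 2) * (C / (C + 1))" by simp
    also have "\<dots> < (e / 2) * 1" using C e by (intro mult_strict_left_mono) auto
    finally show ?thesis by simp
  qed
  define d where "d = e / (2 * t powr p)"
  have "(\<integral>x. norm (f x) * norm (g x) \<partial>M) < e"
    if f: "f \<in> lp_space M p" and fd: "(\<integral>x. norm (f x) powr p \<partial>M) < d" for f :: "'x \<Rightarrow> 'b"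
  proof -
    have i: "integrable M (\<lambda>x. norm (f x) powr p)" "integrable M (\<lambda>x. norm (g x) powr q)"
      using f g by (auto simp: lp_space_def q_def)
    have "(\<integral>x. norm (f x) * norm (g x) \<partial>M) \<le>
        (\<integral>x. t powr p * norm (f x) powr p + norm (g x) powr q / t powr q \<partial>M)"
    proof (rule integral_mono)
      show "norm (f x) * norm (g x) \<le> t powr p * norm (f x) powr p + norm (g x) powr q / t powr q" for x
        using mult_le_powr_sum[of "t * norm (f x)" "norm (g x) / t" p] t p
        by (simp add: powr_mult powr_divide q_def)
    qed (use i integrable_norm_mult[OF f g p] in auto)
    also have "\<dots> = t powr p * (\<integral>x. norm (f x) powr p \<partial>M) + C / t powr q"
      using i by (simp add: C_def)
    also have "\<dots> < t powr p * d + e / 2"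
      using fd t tq by (intro add_strict_mono mult_strict_left_mono) auto
    also have "\<dots> = e" using t by (simp add: d_def field_simps)
    finally show ?thesis .
  qed
  moreover have "d > 0" using e t by (simp add: d_def)
  ultimately show ?thesis by blast
qed

lemma lp_mult_tendsto_0:
  fixes F :: "nat \<Rightarrow> 'x \<Rightarrow> 'b::real_normed_vector" and g :: "'x \<Rightarrow> 'c::real_normed_vector"
  assumes F: "\<And>n. F n \<in> lp_space M p" "(\<lambda>n. \<integral>x. norm (F n x) powr p \<partial>M) \<longlonglongrightarrow> 0"
    and g: "g \<in> lp_space M (p / (p - 1))" and p: "p > 1"
  shows "(\<lambda>n. \<integral>x. norm (F n x) * norm (g x) \<partial>M) \<longlonglongrightarrow> 0"
proof (rule LIMSEQ_I)
  fix e :: real assume "e > 0"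
  from lp_mult_small[OF g p this, where 'b = 'b] obtain d where d: "d > 0"
    "\<And>f::'x \<Rightarrow> 'b. f \<in> lp_space M p \<Longrightarrow> (\<integral>x. norm (f x) powr p \<partial>M) < d \<Longrightarrow>
        (\<integral>x. norm (f x) * norm (g x) \<partial>M) < e" by blast
  have "\<forall>\<^sub>F n in sequentially. (\<integral>x. norm (F n x) powr p \<partial>M) < d"
    using F(2) d(1) by (rule order_tendstoD)
  hence "\<forall>\<^sub>F n in sequentially. norm ((\<integral>x. norm (F n x) * norm (g x) \<partial>M) - 0) < e"
    by eventually_elim (use d(2) F(1) in auto)
  thus "\<exists>no. \<forall>n\<ge>no. norm ((\<integral>x. norm (F n x) * norm (g x) \<partial>M) - 0) < e"
    by (simp add: eventually_sequentially)
qed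

lemma norm_powr_in_lp:
  fixes f :: "'x \<Rightarrow> 'b::real_normed_vector"
  assumes "f \<in> lp_space M (s * p)"
  shows "(\<lambda>x. norm (f x) powr p) \<in> lp_space M s"
  using assms by (auto simp: lp_space_def powr_powr mult.commute)

lemma lp_space_mono:
  fixes f :: "'x \<Rightarrow> 'b::real_normed_vector"
  assumes "f \<in> lp_space M q" "finite_measure M" "0 < p" "p \<le> q"
  shows "f \<in> lp_space M p"
proof -
  have [measurable]: "f \<in> borel_measurable M" using assms by (auto simp: lp_space_def)
  have "integrable M (\<lambda>x. norm (f x) powr p)"
  proof (rule Bochner_Integration.integrable_bound[where f = "\<lambda>x. 1 + norm (f x) powr q"])
    show "integrable M (\<lambda>x. 1 + norm (f x) powr q)"
      using assms by (auto simp: lp_space_def finite_measure.integrable_const)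
    have "norm (f x) powr p \<le> 1 + norm (f x) powr q" for x
    proof (cases "norm (f x) \<le> 1")
      case True thus ?thesis using assms powr_mono2[of p "norm (f x)" 1] by (auto intro: add_increasing2)
    next
      case False
      hence "norm (f x) powr p \<le> norm (f x) powr q" using assms by (intro powr_mono) auto
      thus ?thesis by simp
    qed
    thus "AE x in M. norm (norm (f x) powr p) \<le> norm (1 + norm (f x) powr q)" by simp
  qed measurable
  thus ?thesis by (simp add: lp_space_def)
qed

lemma lp_conv_mono:
  fixes F :: "nat \<Rightarrow> 'x \<Rightarrow> 'b::{real_normed_vector, second_countable_topology}"
  assumes "lp_conv M q F G" "finite_measure M" "0 < p" "p \<le> q"
  shows "lp_conv M p F G"
proof (cases "p = q")
  case False
  have pq: "p < q" using False assms by simp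
  have "(\<lambda>n. \<integral>x. norm (norm (F n x - G x) powr p) * norm (1::real) \<partial>M) \<longlonglongrightarrow> 0"
  proof (rule lp_mult_tendsto_0[where p = "q/p"])
    show "(\<lambda>x. norm (F n x - G x) powr p) \<in> lp_space M (q / p)" for n
      using lp_convD(5)[OF assms(1)] assms by (intro norm_powr_in_lp) auto
    show "(\<lambda>n. \<integral>x. norm (norm (F n x - G x) powr p) powr (q / p) \<partial>M) \<longlonglongrightarrow> 0"
      using assms by (simp add: lp_conv_def powr_powr)
  qed (use assms pq in \<open>auto simp: lp_space_def finite_measure.integrable_const\<close>)
  thus ?thesis using assms by (auto simp: lp_conv_def intro!: lp_space_mono[OF _ assms(2-4)])
qed (use assms in simp)

lemma lp_space_mult:
  fixes f :: "'x \<Rightarrow> real" and g :: "'x \<Rightarrow> 'b::{real_normed_vector, second_countable_topology}"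
  assumes "f \<in> lp_space M (2 * p)" "g \<in> lp_space M (2 * p)" "p > 0"
  shows "(\<lambda>x. f x *\<^sub>R g x) \<in> lp_space M p"
proof -
  have [measurable]: "f \<in> borel_measurable M" "g \<in> borel_measurable M"
    using assms by (auto simp: lp_space_def)
  have "integrable M (\<lambda>x. norm (norm (f x) powr p) * norm (norm (g x) powr p))"
    by (rule integrable_norm_mult[where p = 2])
       (use norm_powr_in_lp[OF assms(1)] norm_powr_in_lp[OF assms(2)] in auto)
  thus ?thesis by (simp add: lp_space_def powr_mult)
qed

text \<open>Cauchy--Schwarz for products of convergent sequences, from the expansion
  \<open>ab - uv = (a - u) v + u (b - v) + (a - u) (b - v)\<close>.\<close>

lemma lp_conv_mult:
  fixes F :: "nat \<Rightarrow> 'x \<Rightarrow> real" and G :: "nat \<Rightarrow> 'x \<Rightarrow> 'b::{real_normed_vector, second_countable_topology}"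
  assumes F: "lp_conv M (2 * p) F f" and G: "lp_conv M (2 * p) G g" and p: "p > 0"
  shows "lp_conv M p (\<lambda>n x. F n x *\<^sub>R G n x) (\<lambda>x. f x *\<^sub>R g x)"
proof -
  have lp: "F n \<in> lp_space M (2*p)" "f \<in> lp_space M (2*p)" "G n \<in> lp_space M (2*p)" "g \<in> lp_space M (2*p)"
    "(\<lambda>x. F n x - f x) \<in> lp_space M (2*p)" "(\<lambda>x. G n x - g x) \<in> lp_space M (2*p)" for n
    using lp_convD[OF F] lp_convD[OF G] p by auto
  have *: "lp_conv M p (\<lambda>n x. a n x *\<^sub>R b n x) (\<lambda>x. 0)"
    if ab: "\<And>n. a n \<in> lp_space M (2*p)" "\<And>n. b n \<in> lp_space M (2*p)"
      and lim: "(\<lambda>n. \<integral>x. norm (norm (a n x) powr p) * norm (norm (b n x) powr p) \<partial>M) \<longlonglongrightarrow> 0"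
    for a :: "nat \<Rightarrow> 'x \<Rightarrow> real" and b :: "nat \<Rightarrow> 'x \<Rightarrow> 'b"
    using lim lp_space_mult[OF ab p] lp_conv_zero[OF p, of M]
    by (simp add: lp_conv_def powr_mult)
  have FF: "(\<lambda>n. \<integral>x. norm (F n x - f x) powr (2*p) \<partial>M) \<longlonglongrightarrow> 0"
    and GG: "(\<lambda>n. \<integral>x. norm (G n x - g x) powr (2*p) \<partial>M) \<longlonglongrightarrow> 0"
    using F G by (auto simp: lp_conv_def)
  have 1: "lp_conv M p (\<lambda>n x. (F n x - f x) *\<^sub>R g x) (\<lambda>x. 0)"
  proof (rule *[OF lp(5,4)], rule lp_mult_tendsto_0[where p = 2])
    show "(\<lambda>n. \<integral>x. norm (norm (F n x - f x) powr p) powr 2 \<partial>M) \<longlonglongrightarrow> 0"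
      using FF by (simp add: powr_powr mult.commute)
  qed (use norm_powr_in_lp[OF lp(5)] norm_powr_in_lp[OF lp(4)] in auto)
  have "(\<lambda>n. \<integral>x. norm (norm (G n x - g x) powr p) * norm (norm (f x) powr p) \<partial>M) \<longlonglongrightarrow> 0"
  proof (rule lp_mult_tendsto_0[where p = 2])
    show "(\<lambda>n. \<integral>x. norm (norm (G n x - g x) powr p) powr 2 \<partial>M) \<longlonglongrightarrow> 0"
      using GG by (simp add: powr_powr mult.commute)
  qed (use norm_powr_in_lp[OF lp(6)] norm_powr_in_lp[OF lp(2)] in auto)
  hence 2: "lp_conv M p (\<lambda>n x. f x *\<^sub>R (G n x - g x)) (\<lambda>x. 0)"
    by (intro * lp) (simp add: mult.commute)
  have 3: "lp_conv M p (\<lambda>n x. (F n x - f x) *\<^sub>R (G n x - g x)) (\<lambda>x. 0)"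
  proof (rule lp_conv_bound[where B = "\<lambda>n x. norm (F n x - f x) powr (2*p) + norm (G n x - g x) powr (2*p)"])
    have i: "integrable M (\<lambda>x. norm (F n x - f x) powr (2*p))"
      "integrable M (\<lambda>x. norm (G n x - g x) powr (2*p))" for n
      using lp_space_integrable[OF lp(5)] lp_space_integrable[OF lp(6)] by auto
    show "integrable M (\<lambda>x. norm (F n x - f x) powr (2*p) + norm (G n x - g x) powr (2*p))" for n
      using i by auto
    show "(\<lambda>n. \<integral>x. norm (F n x - f x) powr (2*p) + norm (G n x - g x) powr (2*p) \<partial>M) \<longlonglongrightarrow> 0"
      using tendsto_add[OF FF GG] i by simp
    show "AE x in M. norm ((F n x - f x) *\<^sub>R (G n x - g x) - 0) powr p
        \<le> norm (F n x - f x) powr (2*p) + norm (G n x - g x) powr (2*p)" for n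
      using mult_le_powr_sum[of "norm (F n _ - f _) powr p" "norm (G n _ - g _) powr p" 2]
      by (simp add: powr_mult powr_powr mult.commute)
  qed (use lp_space_mult[OF lp(5) lp(6) p] lp_conv_zero[OF p, of M] p in \<open>auto simp: lp_conv_def\<close>)
  have 4: "lp_conv M p (\<lambda>n x. f x *\<^sub>R g x) (\<lambda>x. f x *\<^sub>R g x)"
    using lp_space_mult[OF lp(2) lp(4) p] p by (rule lp_conv_const)
  have "lp_conv M p (\<lambda>n x. (F n x - f x) *\<^sub>R g x + f x *\<^sub>R (G n x - g x) + (F n x - f x) *\<^sub>R (G n x - g x)
      + f x *\<^sub>R g x) (\<lambda>x. 0 + 0 + 0 + f x *\<^sub>R g x)"
    by (intro lp_conv_add 1 2 3 4 p)
  thus ?thesis by (simp add: algebra_simps)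
qed

lemma lp_conv_squeeze:
  fixes H :: "nat \<Rightarrow> 'x \<Rightarrow> 'b::{real_normed_vector, second_countable_topology}"
    and K :: "nat \<Rightarrow> 'x \<Rightarrow> real"
  assumes "\<And>n. H n \<in> lp_space M p" "h \<in> lp_space M p" "p > 0"
    and K: "lp_conv M p K (\<lambda>_. 0)"
    and le: "\<And>n. AE x in M. norm (H n x - h x) \<le> K n x"
  shows "lp_conv M p H h"
proof (rule lp_conv_bound[OF assms(1-3), where B = "\<lambda>n x. norm (K n x) powr p"])
  show "integrable M (\<lambda>x. norm (K n x) powr p)" for n
    using lp_convD(6)[OF K assms(3)] by simp
  show "(\<lambda>n. \<integral>x. norm (K n x) powr p \<partial>M) \<longlonglongrightarrow> 0"
    using lp_convD(7)[OF K assms(3)] by simp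
  show "AE x in M. norm (H n x - h x) powr p \<le> norm (K n x) powr p" for n
    using le[of n] by eventually_elim (use assms(3) in \<open>auto intro!: powr_mono2\<close>)
qed

lemma lp_conv_norm_diff:
  fixes F :: "nat \<Rightarrow> 'x \<Rightarrow> 'b::{real_normed_vector, second_countable_topology}"
  assumes "lp_conv M p F G" "p > 0"
  shows "lp_conv M p (\<lambda>n x. norm (F n x - G x)) (\<lambda>_. 0)"
  using lp_convD(5-7)[OF assms] assms(2) by (simp add: lp_conv_def lp_space_def)

lemma lp_conv_perturb:
  fixes F H :: "nat \<Rightarrow> 'x \<Rightarrow> 'b::{real_normed_vector, second_countable_topology}"
  assumes F: "lp_conv M p F G" and H: "\<And>n. H n \<in> lp_space M p" and p: "p > 0"
    and lim: "(\<lambda>n. \<integral>x. norm (H n x - F n x) powr p \<partial>M) \<longlonglongrightarrow> 0"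
  shows "lp_conv M p H G"
proof -
  have "(\<lambda>x. H n x - F n x) \<in> lp_space M p" for n
    by (rule lp_space_diff[OF H lp_convD(1)[OF F p] p])
  hence "lp_conv M p (\<lambda>n x. H n x - F n x) (\<lambda>_. 0)"
    using lim lp_convD(2)[OF lp_conv_zero[OF p, of M] p] by (simp add: lp_conv_def)
  from lp_conv_add[OF this F p] show ?thesis by simp
qed

text \<open>Bounded coefficients may converge merely almost everywhere: on the limit \<open>G\<close> they act by dominated
  convergence, on the remainder \<open>F n - G\<close> by boundedness.\<close>

lemma lp_conv_coeff:
  fixes F :: "nat \<Rightarrow> 'x \<Rightarrow> 'b::{real_normed_vector, second_countable_topology}"
    and c :: "nat \<Rightarrow> 'x \<Rightarrow> real"
  assumes F: "lp_conv M p F G" and p: "p > 0"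
    and c[measurable]: "\<And>n. c n \<in> borel_measurable M" "d \<in> borel_measurable M"
    and le: "\<And>n x. \<bar>c n x\<bar> \<le> L" "\<And>x. \<bar>d x\<bar> \<le> L"
    and lim: "AE x in M. (\<lambda>n. c n x) \<longlonglongrightarrow> d x"
  shows "lp_conv M p (\<lambda>n x. c n x *\<^sub>R F n x) (\<lambda>x. d x *\<^sub>R G x)"
proof -
  note [measurable] = lp_convD(3)[OF F p] lp_convD(4)[OF F p]
  have L: "L \<ge> 0" using le(2) by (meson abs_ge_zero order_trans)
  have mem: "(\<lambda>x. b x *\<^sub>R K x) \<in> lp_space M p"
    if "K \<in> lp_space M p" "b \<in> borel_measurable M" "\<And>x. \<bar>b x\<bar> \<le> L" for b and K :: "'x \<Rightarrow> 'b"
  proof (rule lp_space_bound[OF lp_space_scaleR[OF that(1), of L] _ p])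
    have [measurable]: "K \<in> borel_measurable M" "b \<in> borel_measurable M"
      using that by (auto simp: lp_space_def)
    show "(\<lambda>x. b x *\<^sub>R K x) \<in> borel_measurable M" by measurable
    show "AE x in M. norm (b x *\<^sub>R K x) \<le> norm (L *\<^sub>R K x)"
      using that(3) L by (auto intro!: mult_right_mono)
  qed
  have 1: "lp_conv M p (\<lambda>n x. c n x *\<^sub>R (F n x - G x)) (\<lambda>x. 0)"
  proof (rule lp_conv_squeeze[where K = "\<lambda>n x. L *\<^sub>R norm (F n x - G x)"])
    show "lp_conv M p (\<lambda>n x. L *\<^sub>R norm (F n x - G x)) (\<lambda>_. 0)"
      using lp_conv_scaleR[OF lp_conv_norm_diff[OF F p] p, of L] by simp
    show "(\<lambda>x. c n x *\<^sub>R (F n x - G x)) \<in> lp_space M p" for n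
      by (rule mem[OF lp_convD(5)[OF F p]]) (use le in auto)
    show "AE x in M. norm (c n x *\<^sub>R (F n x - G x) - 0) \<le> L *\<^sub>R norm (F n x - G x)" for n
      using le by (auto intro!: mult_right_mono)
  qed (use p lp_conv_zero[OF p, of M] in \<open>auto simp: lp_conv_def\<close>)
  have 2: "lp_conv M p (\<lambda>n x. c n x *\<^sub>R G x) (\<lambda>x. d x *\<^sub>R G x)"
  proof (rule lp_conv_dominated[where B = "\<lambda>x. L * norm (G x)"])
    show "(\<lambda>x. L * norm (G x)) \<in> lp_space M p"
      by (rule lp_space_bound[OF lp_space_scaleR[OF lp_convD(2)[OF F p], of L] _ p]) (auto simp: abs_mult)
    show "AE x in M. norm (c n x *\<^sub>R G x) \<le> L * norm (G x)" for n
      using le by (auto intro!: mult_right_mono)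
    show "AE x in M. (\<lambda>n. c n x *\<^sub>R G x) \<longlonglongrightarrow> d x *\<^sub>R G x"
      using lim by eventually_elim (intro tendsto_intros)
  qed (use p in auto)
  show ?thesis using lp_conv_add[OF 1 2 p] by (simp add: algebra_simps)
qed

text \<open>Almost everywhere convergence is a hypothesis, rather than a consequence of the convergence of a
  series of norms, because the type of the Hilbert space, of sort \<open>{real_inner, complete_space}\<close>, is
  not of class \<open>banach\<close>.\<close>

lemma AE_convergent_limit:
  fixes F :: "nat \<Rightarrow> 'x \<Rightarrow> 'b::{real_normed_vector, second_countable_topology}"
  assumes F[measurable]: "\<And>n. F n \<in> borel_measurable M" and conv: "AE x in M. convergent (\<lambda>n. F n x)"
  obtains G where "G \<in> borel_measurable M" "AE x in M. (\<lambda>n. F n x) \<longlonglongrightarrow> G x"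
proof -
  obtain N where N: "{x \<in> space M. \<not> convergent (\<lambda>n. F n x)} \<subseteq> N" "emeasure M N = 0" "N \<in> sets M"
    using AE_E[OF conv] by blast
  note [measurable] = N(3)
  define F' where "F' = (\<lambda>n x. indicator (space M - N) x *\<^sub>R F n x)"
  define G where "G = (\<lambda>x. lim (\<lambda>n. F' n x))"
  have lim: "(\<lambda>n. F' n x) \<longlonglongrightarrow> G x" if x: "x \<in> space M" for x
  proof (cases "x \<in> N")
    case True thus ?thesis by (simp add: F'_def G_def)
  next
    case False
    hence "convergent (\<lambda>n. F n x)" using N(1) x by auto
    thus ?thesis using False x by (simp add: F'_def G_def convergent_LIMSEQ_iff)
  qed
  have "F' n \<in> borel_measurable M" for n unfolding F'_def by measurable
  hence G: "G \<in> borel_measurable M" using lim by (rule borel_measurable_LIMSEQ_metric)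
  have "AE x in M. x \<notin> N" using N(2,3) by (intro AE_not_in null_setsI)
  hence "AE x in M. (\<lambda>n. F n x) \<longlonglongrightarrow> G x"
    using AE_space
  proof eventually_elim
    fix x assume "x \<notin> N" "x \<in> space M"
    thus "(\<lambda>n. F n x) \<longlonglongrightarrow> G x" using lim[of x] by (simp add: F'_def)
  qed
  thus ?thesis using that G by blast
qed

lemma norm_integral_le:
  fixes f k :: "'x \<Rightarrow> real"
  assumes "integrable M f" "integrable M k" "\<And>x. norm (f x) \<le> k x"
  shows "norm (\<integral>x. f x \<partial>M) \<le> (\<integral>x. k x \<partial>M)"
  by (rule order_trans[OF integral_norm_bound integral_mono]) (use assms in auto)

text \<open>A subsequence with summable increments converges almost everywhere; Fatou's lemma then shows that
  the whole sequence converges to its limit in the mean.\<close>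

lemma L1_complete:
  fixes u :: "nat \<Rightarrow> 'x \<Rightarrow> real"
  assumes i: "\<And>n. integrable M (u n)"
    and cauchy: "\<And>e. e > 0 \<Longrightarrow> \<exists>N. \<forall>m\<ge>N. \<forall>n\<ge>N. (\<integral>x. \<bar>u m x - u n x\<bar> \<partial>M) < e"
  obtains v where "integrable M v" "(\<lambda>n. \<integral>x. \<bar>u n x - v x\<bar> \<partial>M) \<longlonglongrightarrow> 0"
proof -
  note [measurable] = borel_measurable_integrable[OF i]
  have id: "integrable M (\<lambda>x. \<bar>u m x - u n x\<bar>)" for m n using i by auto
  have nn: "(\<integral>\<^sup>+x. ennreal \<bar>u m x - u n x\<bar> \<partial>M) = ennreal (\<integral>x. \<bar>u m x - u n x\<bar> \<partial>M)" for m n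
    using id by (intro nn_integral_eq_integral) auto
  obtain N where N: "\<And>k m n. m \<ge> N k \<Longrightarrow> n \<ge> N k \<Longrightarrow> (\<integral>x. \<bar>u m x - u n x\<bar> \<partial>M) < (1/2)^k"
  proof -
    have "\<exists>N. \<forall>m\<ge>N. \<forall>n\<ge>N. (\<integral>x. \<bar>u m x - u n x\<bar> \<partial>M) < (1/2)^k" for k by (rule cauchy) simp
    from choice[OF allI[OF this]] obtain N where
      "\<forall>k. \<forall>m\<ge>N k. \<forall>n\<ge>N k. (\<integral>x. \<bar>u m x - u n x\<bar> \<partial>M) < (1/2)^k" ..
    thus ?thesis using that[of N] by auto
  qed
  define s where "s = (\<lambda>k. k + (\<Sum>i\<le>k. N i))"
  have s: "s k \<ge> N k" "s (Suc k) \<ge> N k" "s k \<ge> k" for k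
    using member_le_sum[of k "{..k}" N] by (auto simp: s_def)
  let ?f = "\<lambda>k x. u (s (Suc k)) x - u (s k) x"
  have "(\<integral>\<^sup>+x. (\<Sum>k. ennreal \<bar>?f k x\<bar>) \<partial>M) = (\<Sum>k. \<integral>\<^sup>+x. ennreal \<bar>?f k x\<bar> \<partial>M)"
    by (rule nn_integral_suminf) measurable
  also have "\<dots> \<le> (\<Sum>k. ennreal ((1/2)^k))"
    unfolding nn by (intro suminf_le ennreal_leI less_imp_le N s) auto
  also have "\<dots> < \<infinity>" by (subst suminf_ennreal_eq[OF _ geometric_sums]) auto
  finally have "AE x in M. (\<Sum>k. ennreal \<bar>?f k x\<bar>) \<noteq> \<infinity>"
    by (intro nn_integral_PInf_AE) auto
  hence "AE x in M. convergent (\<lambda>k. u (s k) x)"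
  proof eventually_elim
    fix x assume "(\<Sum>k. ennreal \<bar>?f k x\<bar>) \<noteq> \<infinity>"
    hence "summable (\<lambda>k. \<bar>?f k x\<bar>)" by (intro summable_suminf_not_top) auto
    hence "summable (\<lambda>k. ?f k x)" by (rule summable_rabs_cancel)
    hence "convergent (\<lambda>n. \<Sum>k<n. ?f k x)" by (simp add: summable_iff_convergent)
    hence "convergent (\<lambda>n. (\<Sum>k<n. ?f k x) + u (s 0) x)" by (intro convergent_add convergent_const)
    thus "convergent (\<lambda>k. u (s k) x)" by (simp add: sum_lessThan_telescope[of "\<lambda>k. u (s k) x"])
  qed
  then obtain v where v[measurable]: "v \<in> borel_measurable M" and lim: "AE x in M. (\<lambda>k. u (s k) x) \<longlonglongrightarrow> v x"
    using AE_convergent_limit[of "\<lambda>k. u (s k)" M] by auto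
  have bound: "(\<integral>\<^sup>+x. ennreal \<bar>u n x - v x\<bar> \<partial>M) \<le> ennreal ((1/2)^k)" if n: "n \<ge> N k" for n k
  proof -
    have "(\<integral>\<^sup>+x. ennreal \<bar>u n x - v x\<bar> \<partial>M) = (\<integral>\<^sup>+x. liminf (\<lambda>j. ennreal \<bar>u n x - u (s j) x\<bar>) \<partial>M)"
    proof (rule nn_integral_cong_AE)
      show "AE x in M. ennreal \<bar>u n x - v x\<bar> = liminf (\<lambda>j. ennreal \<bar>u n x - u (s j) x\<bar>)"
        using lim
      proof eventually_elim
        fix x assume "(\<lambda>k. u (s k) x) \<longlonglongrightarrow> v x"
        hence "(\<lambda>j. ennreal \<bar>u n x - u (s j) x\<bar>) \<longlonglongrightarrow> ennreal \<bar>u n x - v x\<bar>"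
          by (intro tendsto_ennrealI tendsto_intros)
        thus "ennreal \<bar>u n x - v x\<bar> = liminf (\<lambda>j. ennreal \<bar>u n x - u (s j) x\<bar>)"
          by (intro lim_imp_Liminf[symmetric]) auto
      qed
    qed
    also have "\<dots> \<le> liminf (\<lambda>j. \<integral>\<^sup>+x. ennreal \<bar>u n x - u (s j) x\<bar> \<partial>M)"
      by (rule nn_integral_liminf) measurable
    also have "\<dots> \<le> ennreal ((1/2)^k)"
    proof -
      have "\<forall>\<^sub>F j in sequentially. (\<integral>\<^sup>+x. ennreal \<bar>u n x - u (s j) x\<bar> \<partial>M) \<le> ennreal ((1/2)^k)"
        using eventually_ge_at_top[of "N k"]
      proof eventually_elim
        fix j assume "j \<ge> N k"
        hence "s j \<ge> N k" using s(3)[of j] by linarith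
        thus "(\<integral>\<^sup>+x. ennreal \<bar>u n x - u (s j) x\<bar> \<partial>M) \<le> ennreal ((1/2)^k)"
          unfolding nn using n N by (intro ennreal_leI less_imp_le) auto
      qed
      hence "liminf (\<lambda>j. \<integral>\<^sup>+x. ennreal \<bar>u n x - u (s j) x\<bar> \<partial>M) \<le> liminf (\<lambda>j::nat. ennreal ((1/2)^k))"
        by (rule Liminf_mono)
      thus ?thesis by (simp add: Liminf_const)
    qed
    finally show ?thesis .
  qed
  have iv': "integrable M (\<lambda>x. u n x - v x)" if "n \<ge> N k" for n k
  proof (rule integrableI_bounded)
    show "(\<integral>\<^sup>+x. ennreal (norm (u n x - v x)) \<partial>M) < \<infinity>"
      using le_less_trans[OF bound[OF that] ennreal_less_top] by simp
  qed measurable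
  have iv: "integrable M v"
    using Bochner_Integration.integrable_diff[OF i[of "N 0"] iv'[of 0 "N 0"]] by simp
  have "(\<lambda>n. \<integral>x. \<bar>u n x - v x\<bar> \<partial>M) \<longlonglongrightarrow> 0"
  proof (rule LIMSEQ_I)
    fix e :: real assume "e > 0"
    then obtain k where k: "(1/2)^k < e" using real_arch_pow_inv[of e "1/2"] by auto
    have "norm ((\<integral>x. \<bar>u n x - v x\<bar> \<partial>M) - 0) < e" if n: "n \<ge> N k" for n
    proof -
      have "ennreal (\<integral>x. \<bar>u n x - v x\<bar> \<partial>M) \<le> ennreal ((1/2)^k)"
        using bound[OF n] iv'[OF n] by (subst nn_integral_eq_integral[symmetric]) auto
      hence "(\<integral>x. \<bar>u n x - v x\<bar> \<partial>M) \<le> (1/2)^k" by (subst (asm) ennreal_le_iff) auto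
      thus ?thesis using k by simp
    qed
    thus "\<exists>no. \<forall>n\<ge>no. norm ((\<integral>x. \<bar>u n x - v x\<bar> \<partial>M) - 0) < e" by blast
  qed
  thus ?thesis using that iv by blast
qed

lemma lp_conv_imp_Cauchy:
  fixes F :: "nat \<Rightarrow> 'x \<Rightarrow> 'b::{real_normed_vector, second_countable_topology}"
  assumes F: "lp_conv M p F G" and p: "p > 0" and d: "d > 0"
  shows "\<exists>N. \<forall>m\<ge>N. \<forall>n\<ge>N. (\<integral>x. norm (F m x - F n x) powr p \<partial>M) < d"
proof -
  let ?I = "\<lambda>n. \<integral>x. norm (F n x - G x) powr p \<partial>M"
  let ?c = "d / (2 * 2 powr p)"
  have "?c > 0" using d by simp
  hence "\<forall>\<^sub>F n in sequentially. ?I n < ?c" by (rule order_tendstoD(2)[OF lp_convD(7)[OF F p]])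
  then obtain N where N: "\<And>n. n \<ge> N \<Longrightarrow> ?I n < ?c" by (auto simp: eventually_sequentially)
  have "(\<integral>x. norm (F m x - F n x) powr p \<partial>M) < d" if "m \<ge> N" "n \<ge> N" for m n
  proof -
    have i: "integrable M (\<lambda>x. norm (F n x - G x) powr p)" for n by (rule lp_convD(6)[OF F p])
    have "(\<integral>x. norm (F m x - F n x) powr p \<partial>M)
        \<le> (\<integral>x. 2 powr p * (norm (F m x - G x) powr p + norm (F n x - G x) powr p) \<partial>M)"
    proof (rule integral_mono)
      show "integrable M (\<lambda>x. norm (F m x - F n x) powr p)"
        by (rule lp_space_integrable[OF lp_space_diff[OF lp_convD(1)[OF F p] lp_convD(1)[OF F p] p]])
      show "norm (F m x - F n x) powr p \<le> 2 powr p * (norm (F m x - G x) powr p + norm (F n x - G x) powr p)" for x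
        using norm_add_powr_le[OF p, of "F m x - G x" "- (F n x - G x)"] by (simp add: norm_minus_commute)
    qed (use i in auto)
    also have "\<dots> = 2 powr p * (?I m + ?I n)" using i by simp
    also have "\<dots> < 2 powr p * (?c + ?c)" using N that by (intro mult_strict_left_mono add_strict_mono) auto
    also have "\<dots> = d" by simp
    finally show ?thesis .
  qed
  thus ?thesis by blast
qed

section \<open>Calculus of bounded functions with bounded continuous gradient\<close>

lemma gradient_eq:
  assumes "GDERIV \<phi> x :> D" shows "gradient \<phi> x = D"
  unfolding gradient_def
proof (rule the_equality)
  fix E assume "GDERIV \<phi> x :> E"
  with assms have "(\<lambda>h. h \<bullet> E) = (\<lambda>h. h \<bullet> D)"
    unfolding gderiv_def by (rule has_derivative_unique[rotated])
  hence "(E - D) \<bullet> (E - D) = 0" by (metis inner_diff_right right_minus_eq)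
  thus "E = D" by simp
qed (rule assms)

lemma Cb1I:
  assumes "\<And>x. GDERIV \<phi> x :> D x" "continuous_on UNIV D"
    and "\<And>x. \<bar>\<phi> x\<bar> \<le> B" "\<And>x. norm (D x) \<le> C"
  shows "\<phi> \<in> Cb1" "gradient \<phi> = D"
proof -
  show g: "gradient \<phi> = D" using gradient_eq[OF assms(1)] by auto
  show "\<phi> \<in> Cb1"
    using assms by (auto simp: Cb1_def g intro!: boundedI)
qed

lemma Cb1D:
  assumes "\<phi> \<in> Cb1"
  shows "GDERIV \<phi> x :> gradient \<phi> x" "continuous_on UNIV (gradient \<phi>)" "continuous_on UNIV \<phi>"
proof -
  show 1: "GDERIV \<phi> x :> gradient \<phi> x" "continuous_on UNIV (gradient \<phi>)" for x
    using assms by (auto simp: Cb1_def)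
  show "continuous_on UNIV \<phi>"
    using 1(1) by (auto simp: gderiv_def continuous_on_eq_continuous_at intro: has_derivative_continuous)
qed

lemma Cb1_bounds:
  assumes "\<phi> \<in> Cb1"
  obtains B C where "\<And>x. \<bar>\<phi> x\<bar> \<le> B" "\<And>x. norm (gradient \<phi> x) \<le> C" "B \<ge> 0" "C \<ge> 0"
proof -
  obtain B where B: "\<And>x. norm (\<phi> x) \<le> B" using assms unfolding Cb1_def bounded_iff by auto
  obtain C where C: "\<And>x. norm (gradient \<phi> x) \<le> C" using assms unfolding Cb1_def bounded_iff by auto
  have "B \<ge> 0" "C \<ge> 0" using order_trans[OF norm_ge_zero B] order_trans[OF norm_ge_zero C] by auto
  thus ?thesis using that[of B C] B C by auto
qed

lemma Cb1_const: "(\<lambda>_. c) \<in> Cb1" "gradient (\<lambda>_. c) = (\<lambda>_. 0)"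
  using Cb1I[of "\<lambda>_. c" "\<lambda>_. 0" "\<bar>c\<bar>" 0] GDERIV_const by auto

lemma Cb1_add:
  assumes "\<phi> \<in> Cb1" "\<psi> \<in> Cb1"
  shows "(\<lambda>x. \<phi> x + \<psi> x) \<in> Cb1" "gradient (\<lambda>x. \<phi> x + \<psi> x) = (\<lambda>x. gradient \<phi> x + gradient \<psi> x)"
proof -
  obtain B C where 1: "\<And>x. \<bar>\<phi> x\<bar> \<le> B" "\<And>x. norm (gradient \<phi> x) \<le> C" "B \<ge> 0" "C \<ge> 0"
    by (rule Cb1_bounds[OF assms(1)]) (rule that)
  obtain B' C' where 2: "\<And>x. \<bar>\<psi> x\<bar> \<le> B'" "\<And>x. norm (gradient \<psi> x) \<le> C'" "B' \<ge> 0" "C' \<ge> 0"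
    by (rule Cb1_bounds[OF assms(2)]) (rule that)
  have "\<bar>\<phi> x + \<psi> x\<bar> \<le> B + B'" for x using 1(1)[of x] 2(1)[of x] by linarith
  have "norm (gradient \<phi> x + gradient \<psi> x) \<le> C + C'" for x
    using 1(2)[of x] 2(2)[of x] by (intro norm_triangle_le) linarith
  have "continuous_on UNIV (\<lambda>x. gradient \<phi> x + gradient \<psi> x)"
    by (intro continuous_on_add Cb1D(2) assms)
  have "GDERIV (\<lambda>x. \<phi> x + \<psi> x) x :> gradient \<phi> x + gradient \<psi> x" for x
    by (intro GDERIV_add Cb1D(1) assms)
  show "(\<lambda>x. \<phi> x + \<psi> x) \<in> Cb1" "gradient (\<lambda>x. \<phi> x + \<psi> x) = (\<lambda>x. gradient \<phi> x + gradient \<psi> x)"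
    by (rule Cb1I[of "\<lambda>x. \<phi> x + \<psi> x" "\<lambda>x. gradient \<phi> x + gradient \<psi> x" "B + B'" "C + C'"]; fact)+
qed

lemma Cb1_mult:
  assumes "\<phi> \<in> Cb1" "\<psi> \<in> Cb1"
  shows "(\<lambda>x. \<phi> x * \<psi> x) \<in> Cb1"
    and "gradient (\<lambda>x. \<phi> x * \<psi> x) = (\<lambda>x. \<phi> x *\<^sub>R gradient \<psi> x + \<psi> x *\<^sub>R gradient \<phi> x)"
proof -
  obtain B C where 1: "\<And>x. \<bar>\<phi> x\<bar> \<le> B" "\<And>x. norm (gradient \<phi> x) \<le> C" "B \<ge> 0" "C \<ge> 0"
    by (rule Cb1_bounds[OF assms(1)]) (rule that)
  obtain B' C' where 2: "\<And>x. \<bar>\<psi> x\<bar> \<le> B'" "\<And>x. norm (gradient \<psi> x) \<le> C'" "B' \<ge> 0" "C' \<ge> 0"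
    by (rule Cb1_bounds[OF assms(2)]) (rule that)
  have "\<bar>\<phi> x * \<psi> x\<bar> \<le> B * B'" for x
    unfolding abs_mult using 1 2 by (intro mult_mono) auto
  have "norm (\<phi> x *\<^sub>R gradient \<psi> x + \<psi> x *\<^sub>R gradient \<phi> x) \<le> B * C' + B' * C" for x
    using 1 2 by (intro norm_triangle_le add_mono) (auto intro!: mult_mono)
  have "continuous_on UNIV (\<lambda>x. \<phi> x *\<^sub>R gradient \<psi> x + \<psi> x *\<^sub>R gradient \<phi> x)"
    by (intro continuous_on_add continuous_on_scaleR Cb1D(2,3) assms)
  have "GDERIV (\<lambda>x. \<phi> x * \<psi> x) x :> \<phi> x *\<^sub>R gradient \<psi> x + \<psi> x *\<^sub>R gradient \<phi> x" for x
    by (intro GDERIV_mult Cb1D(1) assms)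
  show "(\<lambda>x. \<phi> x * \<psi> x) \<in> Cb1"
    "gradient (\<lambda>x. \<phi> x * \<psi> x) = (\<lambda>x. \<phi> x *\<^sub>R gradient \<psi> x + \<psi> x *\<^sub>R gradient \<phi> x)"
    by (rule Cb1I[of "\<lambda>x. \<phi> x * \<psi> x" "\<lambda>x. \<phi> x *\<^sub>R gradient \<psi> x + \<psi> x *\<^sub>R gradient \<phi> x" "B * B'" "B * C' + B' * C"]; fact)+
qed

lemma Cb1_diff:
  assumes "\<phi> \<in> Cb1" "\<psi> \<in> Cb1"
  shows "(\<lambda>x. \<phi> x - \<psi> x) \<in> Cb1" "gradient (\<lambda>x. \<phi> x - \<psi> x) = (\<lambda>x. gradient \<phi> x - gradient \<psi> x)"
  using Cb1_add[OF assms(1) Cb1_mult(1)[OF Cb1_const(1)[of "-1"] assms(2)]]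
    Cb1_mult(2)[OF Cb1_const(1)[of "-1"] assms(2)] by (simp_all add: Cb1_const(2))

lemma Cb1_sum:
  assumes "finite I" "\<And>i. i \<in> I \<Longrightarrow> \<phi> i \<in> Cb1"
  shows "(\<lambda>x. \<Sum>i\<in>I. \<phi> i x) \<in> Cb1 \<and> gradient (\<lambda>x. \<Sum>i\<in>I. \<phi> i x) = (\<lambda>x. \<Sum>i\<in>I. gradient (\<phi> i) x)"
  using assms by (induction I rule: finite_induct) (auto simp: Cb1_const Cb1_add)

lemma Cb1_compose:
  assumes "\<phi> \<in> Cb1" and d: "\<And>x. (\<theta> has_real_derivative \<theta>' (\<phi> x)) (at (\<phi> x))"
    and c: "continuous_on UNIV (\<lambda>x. \<theta>' (\<phi> x))"
    and b: "\<And>x. \<bar>\<theta> (\<phi> x)\<bar> \<le> B" "\<And>x. \<bar>\<theta>' (\<phi> x)\<bar> \<le> C"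
  shows "(\<lambda>x. \<theta> (\<phi> x)) \<in> Cb1" "gradient (\<lambda>x. \<theta> (\<phi> x)) = (\<lambda>x. \<theta>' (\<phi> x) *\<^sub>R gradient \<phi> x)"
proof -
  obtain B' C' where 2: "\<And>x. \<bar>\<phi> x\<bar> \<le> B'" "\<And>x. norm (gradient \<phi> x) \<le> C'" "B' \<ge> 0" "C' \<ge> 0"
    by (rule Cb1_bounds[OF assms(1)]) (rule that)
  have C: "C \<ge> 0" using b(2) by (meson abs_ge_zero order_trans)
  have "norm (\<theta>' (\<phi> x) *\<^sub>R gradient \<phi> x) \<le> C * C'" for x
    using 2 b C by (auto intro!: mult_mono)
  have "continuous_on UNIV (\<lambda>x. \<theta>' (\<phi> x) *\<^sub>R gradient \<phi> x)"
    by (intro continuous_on_scaleR c Cb1D(2) assms)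
  have "GDERIV (\<lambda>x. \<theta> (\<phi> x)) x :> \<theta>' (\<phi> x) *\<^sub>R gradient \<phi> x" for x
    by (intro GDERIV_DERIV_compose Cb1D(1) assms d)
  show "(\<lambda>x. \<theta> (\<phi> x)) \<in> Cb1" "gradient (\<lambda>x. \<theta> (\<phi> x)) = (\<lambda>x. \<theta>' (\<phi> x) *\<^sub>R gradient \<phi> x)"
    by (rule Cb1I[of "\<lambda>x. \<theta> (\<phi> x)" "\<lambda>x. \<theta>' (\<phi> x) *\<^sub>R gradient \<phi> x" B "C * C'"]; fact)+
qed

lemma Cb1_compose_C1:
  assumes "\<phi> \<in> Cb1" and d: "\<And>t. (\<theta> has_real_derivative \<theta>' t) (at t)"
    and c: "continuous_on UNIV \<theta>'"
  shows "(\<lambda>x. \<theta> (\<phi> x)) \<in> Cb1" "gradient (\<lambda>x. \<theta> (\<phi> x)) = (\<lambda>x. \<theta>' (\<phi> x) *\<^sub>R gradient \<phi> x)"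
proof -
  obtain b b' where b: "\<And>x. \<bar>\<phi> x\<bar> \<le> b" "\<And>x. norm (gradient \<phi> x) \<le> b'" "b \<ge> 0" "b' \<ge> 0"
    by (rule Cb1_bounds[OF assms(1)]) (rule that)
  have in_b: "\<phi> x \<in> {-b..b}" for x using b(1)[of x] by (auto simp: abs_le_iff)
  have "continuous_on UNIV \<theta>"
    using d by (auto simp: continuous_on_eq_continuous_at intro: DERIV_isCont)
  hence "bounded (\<theta> ` {-b..b})" "bounded (\<theta>' ` {-b..b})"
    using c by (auto intro!: compact_imp_bounded compact_continuous_image intro: continuous_on_subset)
  then obtain B C where "\<And>t. t \<in> {-b..b} \<Longrightarrow> norm (\<theta> t) \<le> B" "\<And>t. t \<in> {-b..b} \<Longrightarrow> norm (\<theta>' t) \<le> C"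
    unfolding bounded_iff by (metis imageI)
  hence "\<bar>\<theta> (\<phi> x)\<bar> \<le> B" "\<bar>\<theta>' (\<phi> x)\<bar> \<le> C" for x using in_b[of x] by auto
  have "continuous_on UNIV (\<lambda>x. \<theta>' (\<phi> x))"
    by (rule continuous_on_compose2[OF c Cb1D(3)[OF assms(1)]]) auto
  show "(\<lambda>x. \<theta> (\<phi> x)) \<in> Cb1" "gradient (\<lambda>x. \<theta> (\<phi> x)) = (\<lambda>x. \<theta>' (\<phi> x) *\<^sub>R gradient \<phi> x)"
    by (rule Cb1_compose[OF assms(1) d, of B C]; fact)+
qed

section \<open>The closed operator\<close>

locale closable_gradient =
  fixes \<nu> :: "'a::{real_inner, complete_space, second_countable_topology} measure" and R :: "'a \<Rightarrow> 'a"
  assumes sets_nu: "sets \<nu> = sets borel" and prob: "prob_space \<nu>" and R: "bounded_linear R"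
    and closable: "\<forall>p>1. closable_grad \<nu> R p"
begin

sublocale prob_space \<nu> by (rule prob)

abbreviation in_graph where "in_graph \<equiv> grad_closure \<nu> R"

abbreviation R_grad where "R_grad \<phi> x \<equiv> R (gradient \<phi> x)"

lemmas R_scale = linear_scale[OF bounded_linear.linear[OF R]]
  and R_add = linear_add[OF bounded_linear.linear[OF R]]
  and R_diff = linear_diff[OF bounded_linear.linear[OF R]]
  and R_sum = linear_sum[OF bounded_linear.linear[OF R]]

lemma continuous_measurable: "continuous_on UNIV f \<Longrightarrow> f \<in> borel_measurable \<nu>"
  using borel_measurable_continuous_onI measurable_cong_sets[OF sets_nu refl] by blast

lemma Cb1_lp: 
  assumes "\<phi> \<in> Cb1" "p > 0"
  shows "\<phi> \<in> lp_space \<nu> p" "(\<lambda>x. R_grad \<phi> x) \<in> lp_space \<nu> p"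
proof -
  obtain B C where B: "\<And>x. \<bar>\<phi> x\<bar> \<le> B" "\<And>x. norm (gradient \<phi> x) \<le> C" "B \<ge> 0" "C \<ge> 0"
    by (rule Cb1_bounds[OF assms(1)]) (rule that)
  show "\<phi> \<in> lp_space \<nu> p"
    by (rule lp_space_bounded[OF finite_measure_axioms _ _ assms(2)])
       (use B continuous_measurable Cb1D(3)[OF assms(1)] in auto)
  obtain K where K: "\<And>x. norm (R x) \<le> norm x * K" "K \<ge> 0"
    using bounded_linear.nonneg_bounded[OF R] by blast
  show "(\<lambda>x. R_grad \<phi> x) \<in> lp_space \<nu> p"
  proof (rule lp_space_bounded[OF finite_measure_axioms _ _ assms(2)])
    show "(\<lambda>x. R_grad \<phi> x) \<in> borel_measurable \<nu>"
      using Cb1D(2)[OF assms(1)] by (intro continuous_measurable bounded_linear.continuous_on[OF R])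
    show "norm (R_grad \<phi> x) \<le> C * K" for x
      using K(1)[of "gradient \<phi> x"] mult_right_mono[OF B(2)[of x] K(2)] by linarith
  qed
qed

lemma grad_closure_iff:
  assumes "p > 0"
  shows "in_graph p f G \<longleftrightarrow> (\<exists>\<phi>. (\<forall>n. \<phi> n \<in> Cb1) \<and> lp_conv \<nu> p \<phi> f \<and>
      lp_conv \<nu> p (\<lambda>n. R_grad (\<phi> n)) G)"
  using Cb1_lp[OF _ assms] 
  by (auto simp: grad_closure_def lp_conv_def lp_norm_tendsto_iff[OF assms])

lemma grad_closureE:
  assumes "in_graph p f G" "p > 0"
  obtains \<phi> where "\<And>n. \<phi> n \<in> Cb1" "lp_conv \<nu> p \<phi> f" "lp_conv \<nu> p (\<lambda>n. R_grad (\<phi> n)) G"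
  using assms grad_closure_iff by auto

lemma grad_closureI:
  assumes "\<And>n. \<phi> n \<in> Cb1" "lp_conv \<nu> p \<phi> f" "lp_conv \<nu> p (\<lambda>n. R_grad (\<phi> n)) G" "p > 0"
  shows "in_graph p f G"
  using assms grad_closure_iff by auto

lemma grad_closure_lp:
  assumes "in_graph p f G"
  shows "f \<in> lp_space \<nu> p" "G \<in> lp_space \<nu> p" "f \<in> borel_measurable \<nu>" "G \<in> borel_measurable \<nu>"
  using assms by (auto simp: grad_closure_def lp_space_def)

lemma grad_closure_Cb1:
  assumes "\<phi> \<in> Cb1" "p > 0"
  shows "in_graph p \<phi> (\<lambda>x. R_grad \<phi> x)"
  by (rule grad_closureI[where \<phi> = "\<lambda>_. \<phi>"]) (use assms Cb1_lp in \<open>auto intro!: lp_conv_const\<close>)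

lemma grad_closure_diff:
  assumes "in_graph p f F" "in_graph p g G" "p > 0"
  shows "in_graph p (\<lambda>x. f x - g x) (\<lambda>x. F x - G x)"
proof -
  obtain \<phi> where 1: "\<And>n. \<phi> n \<in> Cb1" "lp_conv \<nu> p \<phi> f" "lp_conv \<nu> p (\<lambda>n. R_grad (\<phi> n)) F"
    using grad_closureE[OF assms(1,3)] by blast
  obtain \<psi> where 2: "\<And>n. \<psi> n \<in> Cb1" "lp_conv \<nu> p \<psi> g" "lp_conv \<nu> p (\<lambda>n. R_grad (\<psi> n)) G"
    using grad_closureE[OF assms(2,3)] by blast
  show ?thesis
    by (rule grad_closureI[where \<phi> = "\<lambda>n x. \<phi> n x - \<psi> n x"])
       (use 1 2 assms(3) lp_conv_diff[OF 1(2) 2(2)] lp_conv_diff[OF 1(3) 2(3)] in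
         \<open>simp_all add: Cb1_diff R_diff\<close>)
qed

lemma grad_closure_zero:
  assumes "in_graph p (\<lambda>_. 0) G" "p > 1"
  shows "AE x in \<nu>. G x = 0"
proof -
  have "p > 0" using assms by simp
  from assms show ?thesis
    using closable unfolding closable_grad_def grad_closure_def by auto
qed

lemma grad_closure_unique:
  assumes "in_graph p f G" "in_graph p f G'" "p > 1"
  shows "AE x in \<nu>. G x = G' x"
  using grad_closure_zero[of p "\<lambda>x. G x - G' x"] grad_closure_diff[OF assms(1,2)] assms(3) by simp

lemma grad_closure_mono:
  assumes "in_graph q f G" "0 < p" "p \<le> q"
  shows "in_graph p f G"
proof -
  have "q > 0" using assms by simp
  then obtain \<phi> where 1: "\<And>n. \<phi> n \<in> Cb1" "lp_conv \<nu> q \<phi> f" "lp_conv \<nu> q (\<lambda>n. R_grad (\<phi> n)) G"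
    using grad_closureE[OF assms(1)] by blast
  show ?thesis
    by (rule grad_closureI[OF 1(1) lp_conv_mono[OF 1(2) finite_measure_axioms assms(2,3)]
          lp_conv_mono[OF 1(3) finite_measure_axioms assms(2,3)] assms(2)])
qed

lemma grad_closure_cong_AE:
  assumes "in_graph p f G" "G' \<in> borel_measurable \<nu>" "AE x in \<nu>. G' x = G x" "p > 0"
  shows "in_graph p f G'"
proof -
  obtain \<phi> where 1: "\<And>n. \<phi> n \<in> Cb1" "lp_conv \<nu> p \<phi> f" "lp_conv \<nu> p (\<lambda>n. R_grad (\<phi> n)) G"
    using grad_closureE[OF assms(1,4)] by blast
  show ?thesis
    by (rule grad_closureI[OF 1(1,2) lp_conv_cong_AE[OF 1(3) assms(2-4)] assms(4)])
qed

lemma sobolev_grad_AE: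
  assumes "in_graph p f G" "p > 1"
  shows "AE x in \<nu>. sobolev_grad \<nu> R p f x = G x"
proof -
  have "in_graph p f (sobolev_grad \<nu> R p f)"
    unfolding sobolev_grad_def using assms(1) by (rule someI[of "in_graph p f"])
  thus ?thesis by (rule grad_closure_unique[OF _ assms])
qed

text \<open>Closability makes the closures for different exponents agree, hence one representative of the
  gradient serves all exponents.\<close>

lemma sobolev_grad_all:
  assumes "\<forall>p>1. f \<in> sobolev \<nu> R p" "p > 1"
  shows "in_graph p f (sobolev_grad_all \<nu> R f)"
proof -
  have "\<forall>p. \<exists>G. p > 1 \<longrightarrow> in_graph p f G"
    using assms(1) unfolding sobolev_def by blast
  then obtain H where H: "\<And>p. p > 1 \<Longrightarrow> in_graph p f (H p)"
    by metis
  have "in_graph p f (H 2)" if p: "p > 1" for p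
  proof (cases "p \<le> 2")
    case True
    show ?thesis by (rule grad_closure_mono[OF H[of 2]]) (use True p in auto)
  next
    case False
    have "in_graph 2 f (H p)" by (rule grad_closure_mono[OF H[OF p]]) (use False in auto)
    hence eq: "AE x in \<nu>. H 2 x = H p x" by (rule grad_closure_unique[OF H[of 2], rotated]) auto
    show ?thesis
      by (rule grad_closure_cong_AE[OF H[OF p] grad_closure_lp(4)[OF H[of 2]] eq]) (use p in auto)
  qed
  hence "\<forall>p>1. in_graph p f (sobolev_grad_all \<nu> R f)"
    unfolding sobolev_grad_all_def
    using someI[of "\<lambda>G. \<forall>p>1. in_graph p f G" "H 2"] by blast
  thus ?thesis using assms(2) by blast
qed

lemma grad_closure_closed:
  assumes fG: "\<And>n. in_graph p (f n) (G n)" and p: "p > 0"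
    and f: "lp_conv \<nu> p f f'" and G: "lp_conv \<nu> p G G'"
  shows "in_graph p f' G'"
proof -
  let ?e = "\<lambda>n. inverse (real (Suc n))"
  have "\<exists>\<phi>. \<phi> \<in> Cb1 \<and> (\<integral>x. norm (\<phi> x - f n x) powr p \<partial>\<nu>) < ?e n \<and>
        (\<integral>x. norm (R_grad \<phi> x - G n x) powr p \<partial>\<nu>) < ?e n" for n
  proof -
    obtain \<phi> where 1: "\<And>n. \<phi> n \<in> Cb1" "lp_conv \<nu> p \<phi> (f n)" "lp_conv \<nu> p (\<lambda>n. R_grad (\<phi> n)) (G n)"
      using grad_closureE[OF fG p] by blast
    have "\<forall>\<^sub>F k in sequentially. (\<integral>x. norm (\<phi> k x - f n x) powr p \<partial>\<nu>) < ?e n \<and>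
        (\<integral>x. norm (R_grad (\<phi> k) x - G n x) powr p \<partial>\<nu>) < ?e n"
      by (intro eventually_conj order_tendstoD(2)[OF lp_convD(7)[OF 1(2) p]]
          order_tendstoD(2)[OF lp_convD(7)[OF 1(3) p]]) auto
    then obtain k where "(\<integral>x. norm (\<phi> k x - f n x) powr p \<partial>\<nu>) < ?e n \<and>
        (\<integral>x. norm (R_grad (\<phi> k) x - G n x) powr p \<partial>\<nu>) < ?e n"
      by (auto simp: eventually_sequentially)
    thus ?thesis using 1(1)[of k] by (intro exI[of _ "\<phi> k"]) simp
  qed
  from choice[OF allI[OF this]] obtain \<phi> where
    \<phi>': "\<forall>n. \<phi> n \<in> Cb1 \<and> (\<integral>x. norm (\<phi> n x - f n x) powr p \<partial>\<nu>) < ?e n \<and>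
      (\<integral>x. norm (R_grad (\<phi> n) x - G n x) powr p \<partial>\<nu>) < ?e n" ..
  hence \<phi>: "\<And>n. \<phi> n \<in> Cb1" "\<And>n. (\<integral>x. norm (\<phi> n x - f n x) powr p \<partial>\<nu>) < ?e n"
    "\<And>n. (\<integral>x. norm (R_grad (\<phi> n) x - G n x) powr p \<partial>\<nu>) < ?e n" by auto
  have lim0: "(\<lambda>n. I n) \<longlonglongrightarrow> 0" if "\<And>n. 0 \<le> I n" "\<And>n. I n < ?e n" for I :: "nat \<Rightarrow> real"
    by (rule tendsto_sandwich[OF _ _ tendsto_const LIMSEQ_inverse_real_of_nat])
       (use that in \<open>auto intro!: always_eventually order.strict_implies_order\<close>)
  have 1: "lp_conv \<nu> p \<phi> f'"
    by (rule lp_conv_perturb[OF f Cb1_lp(1)[OF \<phi>(1) p] p lim0[OF _ \<phi>(2)]]) simp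
  have 2: "lp_conv \<nu> p (\<lambda>n. R_grad (\<phi> n)) G'"
    by (rule lp_conv_perturb[OF G Cb1_lp(2)[OF \<phi>(1) p] p lim0[OF _ \<phi>(3)]]) simp
  show ?thesis by (rule grad_closureI[OF \<phi>(1) 1 2 p])
qed

text \<open>Halving the exponent is the price for controlling both factors by the Cauchy--Schwarz inequality
  only.\<close>

lemma grad_closure_mult:
  assumes u: "in_graph (2 * p) u U" and v: "in_graph (2 * p) v V" and p: "p > 0"
  shows "in_graph p (\<lambda>x. u x * v x) (\<lambda>x. u x *\<^sub>R V x + v x *\<^sub>R U x)"
proof -
  have p2: "2 * p > 0" using p by simp
  obtain \<phi> where 1: "\<And>n. \<phi> n \<in> Cb1" "lp_conv \<nu> (2*p) \<phi> u" "lp_conv \<nu> (2*p) (\<lambda>n. R_grad (\<phi> n)) U"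
    using grad_closureE[OF u p2] by blast
  obtain \<psi> where 2: "\<And>n. \<psi> n \<in> Cb1" "lp_conv \<nu> (2*p) \<psi> v" "lp_conv \<nu> (2*p) (\<lambda>n. R_grad (\<psi> n)) V"
    using grad_closureE[OF v p2] by blast
  have "lp_conv \<nu> p (\<lambda>n x. \<phi> n x * \<psi> n x) (\<lambda>x. u x * v x)"
    using lp_conv_mult[OF 1(2) 2(2) p] by simp
  moreover have "lp_conv \<nu> p (\<lambda>n x. R_grad (\<lambda>x. \<phi> n x * \<psi> n x) x) (\<lambda>x. u x *\<^sub>R V x + v x *\<^sub>R U x)"
    using lp_conv_add[OF lp_conv_mult[OF 1(2) 2(3) p] lp_conv_mult[OF 2(2) 1(3) p] p] 1(1) 2(1)
    by (simp add: Cb1_mult R_add R_scale)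
  ultimately show ?thesis
    by (rule grad_closureI[OF Cb1_mult(1)[OF 1(1) 2(1)] _ _ p])
qed

text \<open>Passing to a subsequence of the smooth approximations that converges almost everywhere makes the
  coefficients \<open>D i\<close> converge almost everywhere, so that \<open>lp_conv_coeff\<close> applies to the gradients.
  Several functions are treated at once for the sake of the Euclidean norm of finitely many
  components of a field.\<close>

lemma grad_closure_chain:
  fixes \<Theta> :: "('i \<Rightarrow> real) \<Rightarrow> real" and D :: "'i \<Rightarrow> ('i \<Rightarrow> real) \<Rightarrow> real"
  assumes I: "finite I" and f: "\<And>i. i \<in> I \<Longrightarrow> in_graph p (f i) (G i)" and p: "p > 0"
    and Cb1: "\<And>\<phi>. (\<And>i. i \<in> I \<Longrightarrow> \<phi> i \<in> Cb1) \<Longrightarrow> (\<lambda>x::'a. \<Theta> (\<lambda>i. \<phi> i x)) \<in> Cb1"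
    and grad: "\<And>\<phi> x::'a. (\<And>i. i \<in> I \<Longrightarrow> \<phi> i \<in> Cb1) \<Longrightarrow>
        gradient (\<lambda>x. \<Theta> (\<lambda>i. \<phi> i x)) x = (\<Sum>i\<in>I. D i (\<lambda>i. \<phi> i x) *\<^sub>R gradient (\<phi> i) x)"
    and lip: "\<And>a b. \<bar>\<Theta> a - \<Theta> b\<bar> \<le> L * (\<Sum>i\<in>I. \<bar>a i - b i\<bar>)"
    and D: "\<And>i a. i \<in> I \<Longrightarrow> \<bar>D i a\<bar> \<le> L"
    and cont: "\<And>i a b. i \<in> I \<Longrightarrow> (\<And>j. j \<in> I \<Longrightarrow> (\<lambda>n::nat. a n j) \<longlonglongrightarrow> b j) \<Longrightarrow> (\<lambda>n. D i (a n)) \<longlonglongrightarrow> D i b"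
    and meas: "\<And>h. (\<And>i. i \<in> I \<Longrightarrow> h i \<in> borel_measurable \<nu>) \<Longrightarrow> (\<lambda>x. \<Theta> (\<lambda>i. h i x)) \<in> borel_measurable \<nu>"
      "\<And>i h. i \<in> I \<Longrightarrow> (\<And>i. i \<in> I \<Longrightarrow> h i \<in> borel_measurable \<nu>) \<Longrightarrow> (\<lambda>x. D i (\<lambda>i. h i x)) \<in> borel_measurable \<nu>"
  shows "in_graph p (\<lambda>x. \<Theta> (\<lambda>i. f i x)) (\<lambda>x. \<Sum>i\<in>I. D i (\<lambda>i. f i x) *\<^sub>R G i x)"
proof -
  have "\<forall>i\<in>I. \<exists>\<phi>. (\<forall>n. \<phi> n \<in> Cb1) \<and> lp_conv \<nu> p \<phi> (f i) \<and> lp_conv \<nu> p (\<lambda>n. R_grad (\<phi> n)) (G i)"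
    using f grad_closure_iff[OF p] by blast
  from bchoice[OF this] obtain \<phi> where \<phi>': "\<forall>i\<in>I. (\<forall>n. \<phi> i n \<in> Cb1) \<and> lp_conv \<nu> p (\<phi> i) (f i) \<and>
      lp_conv \<nu> p (\<lambda>n. R_grad (\<phi> i n)) (G i)" ..
  hence \<phi>: "\<And>i n. i \<in> I \<Longrightarrow> \<phi> i n \<in> Cb1" "\<And>i. i \<in> I \<Longrightarrow> lp_conv \<nu> p (\<phi> i) (f i)"
    "\<And>i. i \<in> I \<Longrightarrow> lp_conv \<nu> p (\<lambda>n. R_grad (\<phi> i n)) (G i)" by auto
  obtain r where r: "strict_mono r" "AE x in \<nu>. \<forall>i\<in>I. (\<lambda>n. \<phi> i (r n) x) \<longlonglongrightarrow> f i x"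
    using lp_conv_imp_AE_subseq[where F = \<phi> and G = f, OF I \<phi>(2) p] by blast
  define \<psi> where "\<psi> = (\<lambda>i n. \<phi> i (r n))"
  have \<psi>: "\<And>i n. i \<in> I \<Longrightarrow> \<psi> i n \<in> Cb1" "\<And>i. i \<in> I \<Longrightarrow> lp_conv \<nu> p (\<psi> i) (f i)"
    "\<And>i. i \<in> I \<Longrightarrow> lp_conv \<nu> p (\<lambda>n. R_grad (\<psi> i n)) (G i)"
    using \<phi>(1) lp_conv_subseq[OF \<phi>(2) r(1)] lp_conv_subseq[OF \<phi>(3) r(1)] by (auto simp: \<psi>_def)
  have AE: "AE x in \<nu>. \<forall>i\<in>I. (\<lambda>n. \<psi> i n x) \<longlonglongrightarrow> f i x" using r(2) by (simp add: \<psi>_def)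
  have fm: "i \<in> I \<Longrightarrow> f i \<in> borel_measurable \<nu>" for i using grad_closure_lp[OF f] by blast
  have \<psi>m: "i \<in> I \<Longrightarrow> \<psi> i n \<in> borel_measurable \<nu>" for i n using lp_convD(3)[OF \<psi>(2) p] by blast
  have \<Psi>: "(\<lambda>x. \<Theta> (\<lambda>i. \<psi> i n x)) \<in> Cb1" for n using Cb1[of "\<lambda>i. \<psi> i n"] \<psi>(1) by auto
  have c: "lp_conv \<nu> p (\<lambda>n x. \<bar>f i x - 0\<bar>) (\<lambda>x. \<bar>f i x - 0\<bar>)" if "i \<in> I" for i
    by (rule lp_conv_const[OF _ p], rule lp_space_bound[OF grad_closure_lp(1)[OF f[OF that]] _ p])
       (use fm[OF that] in auto)
  have sl: "(\<lambda>x. \<Sum>i\<in>I. \<bar>f i x - 0\<bar>) \<in> lp_space \<nu> p"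
    by (rule lp_convD(2)[OF lp_conv_sum[OF I c p] p])
  have "lp_conv \<nu> p (\<lambda>n x. \<Theta> (\<lambda>i. \<psi> i n x)) (\<lambda>x. \<Theta> (\<lambda>i. f i x))"
  proof (rule lp_conv_squeeze[where K = "\<lambda>n x. L *\<^sub>R (\<Sum>i\<in>I. norm (\<psi> i n x - f i x))"])
    show "(\<lambda>x. \<Theta> (\<lambda>i. \<psi> i n x)) \<in> lp_space \<nu> p" for n by (rule Cb1_lp(1)[OF \<Psi> p])
    have "(\<lambda>x. \<bar>\<Theta> (\<lambda>_. 0)\<bar> + L *\<^sub>R (\<Sum>i\<in>I. \<bar>f i x - 0\<bar>)) \<in> lp_space \<nu> p"
      using lp_space_bounded[OF finite_measure_axioms, of "\<lambda>_. \<bar>\<Theta> (\<lambda>_. 0)\<bar>" "\<bar>\<Theta> (\<lambda>_. 0)\<bar>" p] p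
      by (intro lp_space_add lp_space_scaleR sl) auto
    then show "(\<lambda>x. \<Theta> (\<lambda>i. f i x)) \<in> lp_space \<nu> p"
    proof (rule lp_space_bound[OF _ meas(1)[OF fm] p])
      show "AE x in \<nu>. norm (\<Theta> (\<lambda>i. f i x)) \<le> norm (\<bar>\<Theta> (\<lambda>_. 0)\<bar> + L *\<^sub>R (\<Sum>i\<in>I. \<bar>f i x - 0\<bar>))"
      proof (rule AE_I2)
        fix x
        show "norm (\<Theta> (\<lambda>i. f i x)) \<le> norm (\<bar>\<Theta> (\<lambda>_. 0)\<bar> + L *\<^sub>R (\<Sum>i\<in>I. \<bar>f i x - 0\<bar>))"
          using lip[of "\<lambda>i. f i x" "\<lambda>_. 0"] by simp
      qed
    qed
    show "lp_conv \<nu> p (\<lambda>n x. L *\<^sub>R (\<Sum>i\<in>I. norm (\<psi> i n x - f i x))) (\<lambda>_. 0)"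
      using lp_conv_scaleR[where c = L, OF lp_conv_sum[OF I lp_conv_norm_diff[OF \<psi>(2) p] p] p] by simp
  qed (use p lip in auto)
  moreover have "lp_conv \<nu> p (\<lambda>n x. R (gradient (\<lambda>x. \<Theta> (\<lambda>i. \<psi> i n x)) x)) (\<lambda>x. \<Sum>i\<in>I. D i (\<lambda>i. f i x) *\<^sub>R G i x)"
  proof -
    have "R (gradient (\<lambda>x. \<Theta> (\<lambda>i. \<psi> i n x)) x) = (\<Sum>i\<in>I. D i (\<lambda>i. \<psi> i n x) *\<^sub>R R_grad (\<psi> i n) x)" for n x
      using grad[of "\<lambda>i. \<psi> i n" x] \<psi>(1)
      by (simp add: R_sum R_scale)
    moreover have "lp_conv \<nu> p (\<lambda>n x. \<Sum>i\<in>I. D i (\<lambda>i. \<psi> i n x) *\<^sub>R R_grad (\<psi> i n) x)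
        (\<lambda>x. \<Sum>i\<in>I. D i (\<lambda>i. f i x) *\<^sub>R G i x)"
    proof (rule lp_conv_sum[OF I _ p])
      fix i assume i: "i \<in> I"
      show "lp_conv \<nu> p (\<lambda>n x. D i (\<lambda>i. \<psi> i n x) *\<^sub>R R_grad (\<psi> i n) x) (\<lambda>x. D i (\<lambda>i. f i x) *\<^sub>R G i x)"
      proof (rule lp_conv_coeff[OF \<psi>(3)[OF i] p])
        show "AE x in \<nu>. (\<lambda>n. D i (\<lambda>i. \<psi> i n x)) \<longlonglongrightarrow> D i (\<lambda>i. f i x)"
          using AE by eventually_elim (intro cont i; auto)
      qed (use D[OF i] in \<open>auto intro!: meas(2)[OF i] fm \<psi>m\<close>)
    qed
    ultimately show ?thesis by simp
  qed
  ultimately show ?thesis by (rule grad_closureI[OF \<Psi>]) (rule p)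
qed

lemma grad_closure_compose:
  assumes f: "in_graph p f G" and p: "p > 0"
    and \<theta>: "\<And>t. (\<theta> has_real_derivative \<theta>' t) (at t)" "continuous_on UNIV \<theta>'" "\<And>t. \<bar>\<theta>' t\<bar> \<le> L"
  shows "in_graph p (\<lambda>x. \<theta> (f x)) (\<lambda>x. \<theta>' (f x) *\<^sub>R G x)"
proof -
  have ct: "continuous_on UNIV \<theta>"
    using \<theta>(1) by (auto simp: continuous_on_eq_continuous_at intro: DERIV_isCont)
  note [measurable] = borel_measurable_continuous_onI[OF ct] borel_measurable_continuous_onI[OF \<theta>(2)]
  have lip: "\<bar>\<theta> a - \<theta> b\<bar> \<le> L * \<bar>a - b\<bar>" for a b
    using field_differentiable_bound[of UNIV \<theta> \<theta>' L a b] \<theta> by auto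
  have "in_graph p (\<lambda>x. \<theta> (f x)) (\<lambda>x. \<Sum>i::unit\<in>UNIV. \<theta>' (f x) *\<^sub>R G x)"
  proof (rule grad_closure_chain[where L = L and \<Theta> = "\<lambda>a. \<theta> (a ())" and D = "\<lambda>_ a. \<theta>' (a ())"
        and f = "\<lambda>_. f" and G = "\<lambda>_. G" and I = "UNIV :: unit set"])
    show "(\<lambda>n. \<theta>' (a n ())) \<longlonglongrightarrow> \<theta>' (b ())" if "\<And>j. j \<in> UNIV \<Longrightarrow> (\<lambda>n. a n j) \<longlonglongrightarrow> b j" for a b
      using continuous_on_tendsto_compose[OF \<theta>(2) that[of "()"]] by simp
    show "(\<lambda>x. \<theta> (\<phi> () x)) \<in> Cb1" if "\<And>i. i \<in> UNIV \<Longrightarrow> \<phi> i \<in> Cb1" for \<phi> :: "unit \<Rightarrow> 'a \<Rightarrow> real"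
      using Cb1_compose_C1(1)[OF that \<theta>(1,2)] by simp
    show "gradient (\<lambda>x. \<theta> (\<phi> () x)) x = (\<Sum>i\<in>UNIV. \<theta>' (\<phi> () x) *\<^sub>R gradient (\<phi> i) x)"
      if "\<And>i. i \<in> UNIV \<Longrightarrow> \<phi> i \<in> Cb1" for \<phi> :: "unit \<Rightarrow> 'a \<Rightarrow> real" and x
      using Cb1_compose_C1(2)[OF that \<theta>(1,2)] by (simp add: UNIV_unit)
    show "(\<lambda>x. \<theta> (h () x)) \<in> borel_measurable \<nu>" "(\<lambda>x. \<theta>' (h () x)) \<in> borel_measurable \<nu>"
      if "\<And>i. i \<in> UNIV \<Longrightarrow> h i \<in> borel_measurable \<nu>" for h :: "unit \<Rightarrow> 'a \<Rightarrow> real"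
      using that[of "()"] by auto
  qed (use f p \<theta> lip in \<open>auto simp: UNIV_unit\<close>)
  thus ?thesis by (simp add: UNIV_unit)
qed

end

section \<open>The norm of a Sobolev vector field\<close>

lemma parseval:
  fixes e :: "nat \<Rightarrow> 'a::real_inner"
  assumes "orthonormal_basis e"
  shows "(\<Sum>i<n. (x \<bullet> e i)\<^sup>2) \<le> (norm x)\<^sup>2" "(\<lambda>n. \<Sum>i<n. (x \<bullet> e i)\<^sup>2) \<longlonglongrightarrow> (norm x)\<^sup>2"
proof -
  have on: "e i \<bullet> e j = (if i = j then 1 else 0)" for i j using assms by (simp add: orthonormal_basis_def)
  define P where "P = (\<lambda>n x. \<Sum>i<n. (x \<bullet> e i) *\<^sub>R e i)"
  have Pe: "P n x \<bullet> e j = (if j < n then x \<bullet> e j else 0)" for n x j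
  proof -
    have "P n x \<bullet> e j = (\<Sum>i<n. if i = j then x \<bullet> e i else 0)"
      unfolding P_def inner_sum_left by (intro sum.cong) (auto simp: on)
    thus ?thesis by simp
  qed
  have PP: "P n x \<bullet> P n x = (\<Sum>i<n. (x \<bullet> e i)\<^sup>2)" for n x
  proof -
    have "P n x \<bullet> P n x = (\<Sum>i<n. (x \<bullet> e i) * (P n x \<bullet> e i))"
      by (subst (2) P_def) (simp add: inner_sum_right)
    thus ?thesis by (simp add: Pe power2_eq_square)
  qed
  have xP: "x \<bullet> P n x = (\<Sum>i<n. (x \<bullet> e i)\<^sup>2)" for n x
    by (simp add: P_def inner_sum_right power2_eq_square)
  have pyth: "(norm (x - P n x))\<^sup>2 = (norm x)\<^sup>2 - (\<Sum>i<n. (x \<bullet> e i)\<^sup>2)" for n x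
    by (simp add: power2_norm_eq_inner inner_diff_left inner_diff_right PP xP inner_commute[of "P n x" x])
  show "(\<Sum>i<n. (x \<bullet> e i)\<^sup>2) \<le> (norm x)\<^sup>2" for n
    using pyth[of x n] zero_le_power2[of "norm (x - P n x)"] by linarith
  have contr: "norm (x - P n x) \<le> norm x" for n x
    by (rule power2_le_imp_le) (use pyth[of x n] in \<open>auto intro!: sum_nonneg\<close>)
  have span: "\<exists>N. \<forall>n\<ge>N. P n y = y" if "y \<in> span (range e)" for y
    using that
  proof (induction rule: span_induct_alt)
    case base
    show ?case by (auto simp: P_def)
  next
    case (step c b y)
    then obtain j N where j: "b = e j" and N: "\<forall>n\<ge>N. P n y = y" by auto
    have "P n (c *\<^sub>R b + y) = c *\<^sub>R b + y" if "n \<ge> max N (Suc j)" for n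
    proof -
      have "P n (c *\<^sub>R b + y) = c *\<^sub>R P n b + P n y"
        by (simp add: P_def inner_add_left scaleR_add_left sum.distrib scaleR_sum_right)
      moreover have "P n b = b" 
      proof -
        have "P n b = (\<Sum>i<n. if i = j then e i else 0)"
          unfolding P_def j on by (intro sum.cong) auto
        thus ?thesis using that j by simp
      qed
      ultimately show ?thesis using N that by simp
    qed
    thus ?case by blast
  qed
  have "(\<lambda>n. x - P n x) \<longlonglongrightarrow> 0"
  proof (rule LIMSEQ_I)
    fix r :: real assume "r > 0"
    then obtain y where y: "y \<in> span (range e)" "dist y x < r"
      using assms closure_approachable[of x "span (range e)"] by (auto simp: orthonormal_basis_def)
    obtain N where N: "\<forall>n\<ge>N. P n y = y" using span[OF y(1)] by blast
    have "norm (x - P n x - 0) < r" if "n \<ge> N" for n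
    proof -
      have "P n (x - y) = P n x - P n y"
        by (simp add: P_def inner_diff_left scaleR_diff_left sum_subtractf)
      hence eq: "x - P n x = (x - y) - P n (x - y)" using N that by simp
      have "norm (x - P n x) \<le> norm (x - y)" unfolding eq by (rule contr)
      thus ?thesis using y(2) by (simp add: dist_norm norm_minus_commute)
    qed
    thus "\<exists>N. \<forall>n\<ge>N. norm (x - P n x - 0) < r" by blast
  qed
  hence "(\<lambda>n. (norm x)\<^sup>2 - (norm (x - P n x))\<^sup>2) \<longlonglongrightarrow> (norm x)\<^sup>2 - (norm (0::'a))\<^sup>2"
    by (intro tendsto_intros)
  thus "(\<lambda>n. \<Sum>i<n. (x \<bullet> e i)\<^sup>2) \<longlonglongrightarrow> (norm x)\<^sup>2" by (simp add: pyth)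
qed

lemma sum_abs_mult_le:
  fixes a b :: "'i \<Rightarrow> real"
  shows "(\<Sum>i\<in>I. \<bar>a i\<bar> * \<bar>b i\<bar>) \<le> sqrt (\<Sum>i\<in>I. (a i)\<^sup>2) * sqrt (\<Sum>i\<in>I. (b i)\<^sup>2)"
  using L2_set_mult_ineq[of a b I] by (simp add: L2_set_def)

lemma sqrt_sum_squares_lipschitz:
  fixes a b :: "'i \<Rightarrow> real"
  assumes I: "finite I" and d: "d \<ge> 0"
  shows "\<bar>sqrt (d + (\<Sum>i\<in>I. (a i)\<^sup>2)) - sqrt (d + (\<Sum>i\<in>I. (b i)\<^sup>2))\<bar> \<le> (\<Sum>i\<in>I. \<bar>a i - b i\<bar>)"
proof -
  have *: "sqrt (d + (\<Sum>i\<in>I. (a i)\<^sup>2)) \<le> sqrt (d + (\<Sum>i\<in>I. (b i)\<^sup>2)) + (\<Sum>i\<in>I. \<bar>a i - b i\<bar>)"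
    for a b :: "'i \<Rightarrow> real"
  proof -
    \<comment> \<open>The constant \<open>d\<close> becomes the square of an additional coordinate, and the claim the triangle
      inequality for the Euclidean norm.\<close>
    let ?v = "\<lambda>b j. case j of None \<Rightarrow> sqrt d | Some i \<Rightarrow> b i"
    let ?J = "insert None (Some ` I)"
    have sum: "(\<Sum>j\<in>?J. h j) = h None + (\<Sum>i\<in>I. h (Some i))" for h :: "'i option \<Rightarrow> real"
      using I by (simp add: sum.reindex)
    have L: "L2_set (?v b) ?J = sqrt (d + (\<Sum>i\<in>I. (b i)\<^sup>2))" for b :: "'i \<Rightarrow> real"
      unfolding L2_set_def sum using d by simp
    have "L2_set (\<lambda>j. ?v b j + (?v a j - ?v b j)) ?J \<le> L2_set (?v b) ?J + L2_set (\<lambda>j. ?v a j - ?v b j) ?J"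
      by (rule L2_set_triangle_ineq)
    also have "L2_set (\<lambda>j. ?v a j - ?v b j) ?J \<le> (\<Sum>j\<in>?J. \<bar>?v a j - ?v b j\<bar>)"
      by (rule L2_set_le_sum_abs)
    finally show ?thesis unfolding sum using L by simp
  qed
  show ?thesis using *[of a b] *[of b a] by (simp add: abs_le_iff abs_minus_commute)
qed

context closable_gradient
begin

lemma grad_closure_sqrt_sum:
  assumes I: "finite I" and f: "\<And>i. i \<in> I \<Longrightarrow> in_graph p (f i) (G i)" and p: "p > 0" and d: "d > 0"
  shows "in_graph p (\<lambda>x. sqrt (d + (\<Sum>i\<in>I. (f i x)\<^sup>2)))
     (\<lambda>x. \<Sum>i\<in>I. (f i x / sqrt (d + (\<Sum>i\<in>I. (f i x)\<^sup>2))) *\<^sub>R G i x)"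
proof -
  let ?S = "\<lambda>a. sqrt (d + (\<Sum>i\<in>I. (a i)\<^sup>2))"
  have nn: "(\<Sum>i\<in>I. (a i)\<^sup>2) \<ge> 0" for a :: "_ \<Rightarrow> real" by (auto intro: sum_nonneg)
  have pos: "?S a > 0" for a :: "_ \<Rightarrow> real" using nn[of a] d by (auto intro: add_pos_nonneg)
  have C: "(\<lambda>x. ?S (\<lambda>i. \<phi> i x)) \<in> Cb1 \<and> (\<forall>x. gradient (\<lambda>x. ?S (\<lambda>i. \<phi> i x)) x =
      (\<Sum>i\<in>I. (\<phi> i x / ?S (\<lambda>i. \<phi> i x)) *\<^sub>R gradient (\<phi> i) x))"
    if \<phi>: "\<And>i. i \<in> I \<Longrightarrow> \<phi> i \<in> Cb1" for \<phi> :: "_ \<Rightarrow> 'a \<Rightarrow> real"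
  proof -
    let ?q = "\<lambda>x. \<Sum>i\<in>I. \<phi> i x * \<phi> i x"
    have m: "(\<lambda>x. \<phi> i x * \<phi> i x) \<in> Cb1" if "i \<in> I" for i using Cb1_mult(1)[OF \<phi> \<phi>] that by blast
    have q: "?q \<in> Cb1" and gq: "gradient ?q = (\<lambda>x. \<Sum>i\<in>I. gradient (\<lambda>x. \<phi> i x * \<phi> i x) x)"
      using Cb1_sum[of I "\<lambda>i x. \<phi> i x * \<phi> i x", OF I m] by auto
    have gq': "gradient ?q x = (\<Sum>i\<in>I. (2 * \<phi> i x) *\<^sub>R gradient (\<phi> i) x)" for x
      unfolding gq using Cb1_mult(2)[OF \<phi> \<phi>] by (intro sum.cong) (auto simp: scaleR_2 simp flip: scaleR_scaleR)
    have q0: "?q x \<ge> 0" for x by (auto intro: sum_nonneg)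
    obtain B B' where B: "\<And>x. \<bar>?q x\<bar> \<le> B" "\<And>x. norm (gradient ?q x) \<le> B'" "B \<ge> 0" "B' \<ge> 0"
      by (rule Cb1_bounds[OF q]) (rule that)
    have p0: "d + ?q x > 0" for x using q0[of x] d by linarith
    have der: "((\<lambda>t. sqrt (d + t)) has_real_derivative inverse (2 * sqrt (d + ?q x))) (at (?q x))" for x
      using p0[of x] by (auto intro!: derivative_eq_intros simp: field_simps)
    have cont: "continuous_on UNIV (\<lambda>x. inverse (2 * sqrt (d + ?q x)))"
    proof -
      have "2 * sqrt (d + ?q x) \<noteq> 0" for x using p0[of x] by simp
      thus ?thesis
        by (intro continuous_on_inverse continuous_on_mult continuous_on_real_sqrt continuous_on_add
            continuous_on_const Cb1D(3)[OF q]) auto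
    qed
    have b1: "\<bar>sqrt (d + ?q x)\<bar> \<le> sqrt (d + B)" for x
      using B(1)[of x] q0[of x] d by auto
    have b2: "\<bar>inverse (2 * sqrt (d + ?q x))\<bar> \<le> inverse (2 * sqrt d)" for x
      using q0[of x] d p0[of x] by (auto intro!: le_imp_inverse_le)
    note c = Cb1_compose[OF q der cont b1 b2]
    have e: "(\<lambda>x. ?S (\<lambda>i. \<phi> i x)) = (\<lambda>x. sqrt (d + ?q x))" by (simp add: power2_eq_square)
    show ?thesis
    proof (intro conjI allI)
      show "(\<lambda>x. ?S (\<lambda>i. \<phi> i x)) \<in> Cb1" unfolding e by (rule c(1))
      show "gradient (\<lambda>x. ?S (\<lambda>i. \<phi> i x)) x = (\<Sum>i\<in>I. (\<phi> i x / ?S (\<lambda>i. \<phi> i x)) *\<^sub>R gradient (\<phi> i) x)" for x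
        unfolding e c(2) gq' scaleR_sum_right by (intro sum.cong) (auto simp: field_simps power2_eq_square)
    qed
  qed
  show ?thesis
  proof (rule grad_closure_chain[where L = 1 and \<Theta> = ?S and D = "\<lambda>i a. a i / ?S a"])
    show "\<bar>?S a - ?S b\<bar> \<le> 1 * (\<Sum>i\<in>I. \<bar>a i - b i\<bar>)" for a b
      using sqrt_sum_squares_lipschitz[OF I, of d a b] d by simp
    show "\<bar>a i / ?S a\<bar> \<le> 1" if i: "i \<in> I" for i and a :: "_ \<Rightarrow> real"
    proof -
      have "(a i)\<^sup>2 \<le> d + (\<Sum>i\<in>I. (a i)\<^sup>2)"
        using member_le_sum[of i I "\<lambda>i. (a i)\<^sup>2"] i I d by simp
      hence "\<bar>a i\<bar> \<le> ?S a" by (intro real_le_rsqrt) simp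
      thus ?thesis using pos[of a] by (simp only: abs_divide abs_of_pos divide_le_eq_1_pos)
    qed
    show "(\<lambda>n. a n i / ?S (a n)) \<longlonglongrightarrow> b i / ?S b"
      if "i \<in> I" "\<And>j. j \<in> I \<Longrightarrow> (\<lambda>n. a n j) \<longlonglongrightarrow> b j" for i a b
      using that pos[of b] by (intro tendsto_intros) auto
    show "(\<lambda>x. ?S (\<lambda>i. h i x)) \<in> borel_measurable \<nu>" if "\<And>i. i \<in> I \<Longrightarrow> h i \<in> borel_measurable \<nu>" for h
      using that by measurable
    show "(\<lambda>x. h i x / ?S (\<lambda>i. h i x)) \<in> borel_measurable \<nu>"
      if "i \<in> I" "\<And>i. i \<in> I \<Longrightarrow> h i \<in> borel_measurable \<nu>" for i h
      using that by (intro borel_measurable_divide borel_measurable_sqrt borel_measurable_add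
          borel_measurable_sum borel_measurable_power) auto
  qed (use I f p C in auto)
qed

text \<open>The norm is approximated by \<open>sqrt (1/(n+1) + (\<Sum>i<n. (f i)\<^sup>2))\<close>, where \<open>f i\<close> are the components of
  the field. By the Cauchy--Schwarz inequality for sums, the gradients of the approximations are
  dominated by the Hilbert--Schmidt norm of the gradient of the field, and they converge almost
  everywhere as \<open>F x \<noteq> 0\<close>; so they converge in \<open>L\<^sup>q\<close>, and closedness of the operator applies.\<close>

lemma norm_field_sobolev:
  assumes e: "orthonormal_basis e" and F: "F \<in> sobolev_field e \<nu> R q" and q: "q > 1"
    and Flp: "F \<in> lp_space \<nu> q" and nz: "AE x in \<nu>. F x \<noteq> 0"
  shows "\<exists>G. in_graph q (\<lambda>x. norm (F x)) G"
proof -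
  define f where "f = (\<lambda>i x. F x \<bullet> e i)"
  define G where "G = (\<lambda>i. sobolev_grad \<nu> R q (f i))"
  have q0: "q > 0" using q by simp
  have fG: "in_graph q (f i) (G i)" for i
  proof -
    have "\<exists>G. in_graph q (f i) G"
      using F unfolding sobolev_field_def sobolev_def f_def by blast
    thus ?thesis unfolding G_def sobolev_grad_def by (rule someI_ex)
  qed
  have sm: "AE x in \<nu>. summable (\<lambda>i. (norm (G i x))\<^sup>2)"
    and H: "(\<lambda>x. sqrt (\<Sum>i. (norm (G i x))\<^sup>2)) \<in> lp_space \<nu> q"
    using F by (simp_all add: sobolev_field_def G_def f_def)
  note [measurable] = grad_closure_lp(3)[OF fG] grad_closure_lp(4)[OF fG] lp_space_measurable[OF Flp]
  define d where "d = (\<lambda>n. inverse (real (Suc n)))"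
  have d: "d n > 0" "d n \<le> 1" for n by (auto simp: d_def field_simps)
  define S where "S = (\<lambda>n x. sqrt (d n + (\<Sum>i<n. (f i x)\<^sup>2)))"
  have nn: "(\<Sum>i<n. (f i x)\<^sup>2) \<ge> 0" for n x by (auto intro: sum_nonneg)
  have S0: "S n x > 0" for n x using nn[of x n] d(1)[of n] by (auto simp: S_def intro: add_pos_nonneg)
  have Sf: "sqrt (\<Sum>i<n. (f i x)\<^sup>2) \<le> S n x" for n x using d(1)[of n] by (simp add: S_def)
  have [measurable]: "S n \<in> borel_measurable \<nu>" for n unfolding S_def by measurable
  define Z where "Z = (\<lambda>n x. \<Sum>i<n. (f i x / S n x) *\<^sub>R G i x)"
  have [measurable]: "Z n \<in> borel_measurable \<nu>" for n unfolding Z_def by measurable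
  have SZ: "in_graph q (S n) (Z n)" for n
    unfolding S_def Z_def by (rule grad_closure_sqrt_sum) (use fG q0 d in auto)
  have Slim: "(\<lambda>n. S n x) \<longlonglongrightarrow> norm (F x)" for x
  proof -
    have "(\<lambda>n. sqrt (d n + (\<Sum>i<n. (f i x)\<^sup>2))) \<longlonglongrightarrow> sqrt (0 + (norm (F x))\<^sup>2)"
      unfolding d_def f_def by (intro tendsto_intros LIMSEQ_inverse_real_of_nat parseval(2) e)
    thus ?thesis by (simp add: S_def)
  qed
  have Sconv: "lp_conv \<nu> q S (\<lambda>x. norm (F x))"
  proof (rule lp_conv_dominated[where B = "\<lambda>x. 1 + norm (F x)"])
    have "(\<lambda>x. norm (F x)) \<in> lp_space \<nu> q" using Flp by (auto simp: lp_space_def)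
    moreover have "(\<lambda>x. 1::real) \<in> lp_space \<nu> q"
      by (rule lp_space_bounded[OF finite_measure_axioms, where B = 1]) (use q0 in auto)
    ultimately show "(\<lambda>x. 1 + norm (F x)) \<in> lp_space \<nu> q" using lp_space_add q0 by blast
    show "AE x in \<nu>. norm (S n x) \<le> 1 + norm (F x)" for n
    proof (rule AE_I2)
      fix x
      have "d n + (\<Sum>i<n. (f i x)\<^sup>2) \<le> 1 + (norm (F x))\<^sup>2"
        using d(2)[of n] parseval(1)[OF e, of "F x" n] by (simp add: f_def)
      also have "\<dots> \<le> (1 + norm (F x))\<^sup>2" by (simp add: power2_sum)
      finally have "S n x \<le> 1 + norm (F x)" unfolding S_def by (intro real_le_lsqrt) auto
      thus "norm (S n x) \<le> 1 + norm (F x)" using S0[of n x] by simp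
    qed
  qed (use q0 Slim in auto)
  have "AE x in \<nu>. convergent (\<lambda>n. Z n x)"
    using sm nz
  proof eventually_elim
    fix x assume sm: "summable (\<lambda>i. (norm (G i x))\<^sup>2)" and nz: "F x \<noteq> 0"
    have "summable (\<lambda>i. (f i x)\<^sup>2)"
      using parseval(2)[OF e, of "F x"] by (auto simp: f_def summable_def sums_def)
    hence "summable (\<lambda>i. (f i x)\<^sup>2 + (norm (G i x))\<^sup>2)" using sm by (rule summable_add)
    moreover have "norm (norm (f i x *\<^sub>R G i x)) \<le> (f i x)\<^sup>2 + (norm (G i x))\<^sup>2" for i
    proof -
      have "0 \<le> \<bar>f i x\<bar> * norm (G i x)" "2 * (\<bar>f i x\<bar> * norm (G i x)) \<le> (f i x)\<^sup>2 + (norm (G i x))\<^sup>2"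
        using sum_squares_bound[of "\<bar>f i x\<bar>" "norm (G i x)"] by (simp_all add: mult.assoc)
      hence "\<bar>f i x\<bar> * norm (G i x) \<le> (f i x)\<^sup>2 + (norm (G i x))\<^sup>2" by linarith
      thus ?thesis by simp
    qed
    ultimately have sn: "summable (\<lambda>i. norm (f i x *\<^sub>R G i x))"
      by (intro summable_comparison_test[where f = "\<lambda>i. norm (f i x *\<^sub>R G i x)"]) auto
    have "Cauchy (\<lambda>n. \<Sum>i<n. f i x *\<^sub>R G i x)"
    proof (rule metric_CauchyI)
      fix r :: real assume "r > 0"
      then obtain N where N: "\<And>m n. m \<ge> N \<Longrightarrow> norm (\<Sum>i\<in>{m..<n}. norm (f i x *\<^sub>R G i x)) < r"
        using sn unfolding summable_Cauchy by blast
      have *: "dist (\<Sum>i<m. f i x *\<^sub>R G i x) (\<Sum>i<n. f i x *\<^sub>R G i x) < r" if "N \<le> m" "m \<le> n" for m n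
      proof -
        have "(\<Sum>i<n. f i x *\<^sub>R G i x) - (\<Sum>i<m. f i x *\<^sub>R G i x) = (\<Sum>i\<in>{m..<n}. f i x *\<^sub>R G i x)"
          using sum_diff_nat_ivl[of 0 m n "\<lambda>i. f i x *\<^sub>R G i x"] that by (simp add: atLeast0LessThan)
        moreover have "norm (\<Sum>i\<in>{m..<n}. f i x *\<^sub>R G i x) \<le> (\<Sum>i\<in>{m..<n}. norm (f i x *\<^sub>R G i x))"
          by (rule norm_sum)
        ultimately show ?thesis using N[OF that(1), of n]
          by (simp add: dist_norm norm_minus_commute[of "\<Sum>i<m. f i x *\<^sub>R G i x"])
      qed
      show "\<exists>M. \<forall>m\<ge>M. \<forall>n\<ge>M. dist (\<Sum>i<m. f i x *\<^sub>R G i x) (\<Sum>i<n. f i x *\<^sub>R G i x) < r"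
      proof (intro exI[of _ N] allI impI)
        fix m n assume "N \<le> m" "N \<le> n"
        thus "dist (\<Sum>i<m. f i x *\<^sub>R G i x) (\<Sum>i<n. f i x *\<^sub>R G i x) < r"
          using *[of m n] *[of n m] dist_commute[of "\<Sum>i<m. f i x *\<^sub>R G i x"] by (cases "m \<le> n") simp_all
      qed
    qed
    then obtain L where L: "(\<lambda>n. \<Sum>i<n. f i x *\<^sub>R G i x) \<longlonglongrightarrow> L"
      unfolding Cauchy_convergent_iff convergent_def by blast
    have "(\<lambda>n. inverse (S n x) *\<^sub>R (\<Sum>i<n. f i x *\<^sub>R G i x)) \<longlonglongrightarrow> inverse (norm (F x)) *\<^sub>R L"
      using nz by (intro tendsto_intros L Slim) simp
    moreover have "inverse (S n x) *\<^sub>R (\<Sum>i<n. f i x *\<^sub>R G i x) = Z n x" for n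
      by (simp add: Z_def scaleR_sum_right divide_inverse mult.commute)
    ultimately show "convergent (\<lambda>n. Z n x)" by (auto simp: convergent_def)
  qed
  then obtain W where W[measurable]: "W \<in> borel_measurable \<nu>" and Wlim: "AE x in \<nu>. (\<lambda>n. Z n x) \<longlonglongrightarrow> W x"
    using AE_convergent_limit[of Z \<nu>] by auto
  have "lp_conv \<nu> q Z W"
  proof (rule lp_conv_dominated[OF H q0 _ W _ Wlim])
    show "AE x in \<nu>. norm (Z n x) \<le> sqrt (\<Sum>i. (norm (G i x))\<^sup>2)" for n
      using sm
    proof eventually_elim
      fix x assume sm: "summable (\<lambda>i. (norm (G i x))\<^sup>2)"
      have "norm (Z n x) \<le> (\<Sum>i<n. norm ((f i x / S n x) *\<^sub>R G i x))" unfolding Z_def by (rule norm_sum)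
      also have "\<dots> = (\<Sum>i<n. \<bar>f i x\<bar> * \<bar>norm (G i x)\<bar>) / S n x"
        using S0[of n x] by (simp add: sum_divide_distrib)
      also have "\<dots> \<le> (sqrt (\<Sum>i<n. (f i x)\<^sup>2) * sqrt (\<Sum>i<n. (norm (G i x))\<^sup>2)) / S n x"
        using S0[of n x] by (intro divide_right_mono sum_abs_mult_le) auto
      also have "\<dots> \<le> (S n x * sqrt (\<Sum>i<n. (norm (G i x))\<^sup>2)) / S n x"
        using S0[of n x] by (intro divide_right_mono mult_right_mono Sf) (auto intro: sum_nonneg)
      also have "\<dots> = sqrt (\<Sum>i<n. (norm (G i x))\<^sup>2)" using S0[of n x] by simp
      also have "\<dots> \<le> sqrt (\<Sum>i. (norm (G i x))\<^sup>2)"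
        using sm by (intro real_sqrt_le_mono sum_le_suminf) auto
      finally show "norm (Z n x) \<le> sqrt (\<Sum>i. (norm (G i x))\<^sup>2)" .
    qed
  qed simp
  from grad_closure_closed[OF SZ q0 Sconv this] show ?thesis by blast
qed

end

section \<open>Integration by parts over thin slabs\<close>

subsection \<open>Smoothing the indicator of a half-line\<close>

definition half_square :: "real \<Rightarrow> real" where
  "half_square t = (max 0 t)\<^sup>2 / 2"

lemma half_square_deriv: "(half_square has_real_derivative max 0 t) (at t)"
proof -
  consider "t > 0" | "t < 0" | "t = 0" by linarith
  thus ?thesis
  proof cases
    case 1
    have "((\<lambda>s. s\<^sup>2 / 2) has_real_derivative max 0 t) (at t)"
      using 1 by (auto intro!: derivative_eq_intros)
    thus ?thesis
      by (rule has_field_derivative_transform_within_open[where S = "{0<..}"])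
         (use 1 in \<open>auto simp: half_square_def\<close>)
  next
    case 2
    have "((\<lambda>s. 0) has_real_derivative max 0 t) (at t)"
      using 2 by auto
    thus ?thesis
      by (rule has_field_derivative_transform_within_open[where S = "{..<0}"])
         (use 2 in \<open>auto simp: half_square_def\<close>)
  next
    case 3
    have "((\<lambda>h::real. max 0 h / 2) \<longlongrightarrow> max 0 0 / 2) (at 0)"
      by (intro tendsto_intros) auto
    hence "((\<lambda>h::real. max 0 h / 2) \<longlongrightarrow> 0) (at 0)" by simp
    hence "((\<lambda>h. (half_square (0 + h) - half_square 0) / h) \<longlongrightarrow> 0) (at 0)"
    proof (rule Lim_transform_eventually)
      show "\<forall>\<^sub>F h::real in at 0. max 0 h / 2 = (half_square (0 + h) - half_square 0) / h"
        by (auto simp: half_square_def max_def power2_eq_square eventually_at intro!: exI[of _ 1])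
    qed
    thus ?thesis using 3 by (simp add: DERIV_def)
  qed
qed

text \<open>A \<open>C\<^sup>1\<close> approximation of \<open>max 0 t\<close>; its derivative \<open>soft_step\<close> is the continuous approximation of the
  indicator of \<open>t > 0\<close> that rises linearly from \<open>0\<close> to \<open>1\<close> on \<open>[0, 1/(n+1)]\<close>.\<close>

definition soft_ramp :: "nat \<Rightarrow> real \<Rightarrow> real" where
  "soft_ramp n t = real (Suc n) * (half_square t - half_square (t - inverse (real (Suc n))))"

definition soft_step :: "nat \<Rightarrow> real \<Rightarrow> real" where
  "soft_step n t = real (Suc n) * (max 0 t - max 0 (t - inverse (real (Suc n))))"

lemma soft_ramp_deriv: "(soft_ramp n has_real_derivative soft_step n t) (at t)"
proof -
  have "((\<lambda>t. half_square (t - c)) has_real_derivative max 0 (t - c)) (at t)" for c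
    using DERIV_shift[of half_square "max 0 (t - c)" t "-c"] half_square_deriv[of "t - c"] by simp
  thus ?thesis
    unfolding soft_ramp_def[abs_def] soft_step_def
    by (intro DERIV_cmult DERIV_diff half_square_deriv)
qed

lemma soft_step_bounds: "0 \<le> soft_step n t" "soft_step n t \<le> 1"
proof -
  have "max 0 (t - inverse (real (Suc n))) \<le> max 0 t" by (intro max.mono) auto
  thus "0 \<le> soft_step n t" unfolding soft_step_def by (intro mult_nonneg_nonneg) auto
  have "max 0 t - max 0 (t - e) \<le> e" if "e > 0" for e using that by (auto simp: max_def)
  hence "max 0 t - max 0 (t - inverse (real (Suc n))) \<le> inverse (real (Suc n))" by simp
  hence "soft_step n t \<le> real (Suc n) * inverse (real (Suc n))"
    unfolding soft_step_def by (intro mult_left_mono) auto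
  thus "soft_step n t \<le> 1" by simp
qed

lemma soft_step_cont: "continuous_on UNIV (\<lambda>t. soft_step n (t - c))"
  unfolding soft_step_def by (intro continuous_intros)

lemma soft_step_lim: "(\<lambda>n. soft_step n t) \<longlonglongrightarrow> (if t > 0 then 1 else 0)"
proof (cases "t > 0")
  case True
  have "\<forall>\<^sub>F n in sequentially. inverse (real (Suc n)) < t"
    using LIMSEQ_inverse_real_of_nat True by (rule order_tendstoD)
  hence "\<forall>\<^sub>F n in sequentially. soft_step n t = 1"
  proof eventually_elim
    fix n assume "inverse (real (Suc n)) < t"
    hence "max 0 t - max 0 (t - inverse (real (Suc n))) = inverse (real (Suc n))" using True by simp
    thus "soft_step n t = 1" by (simp add: soft_step_def)
  qed
  hence "(\<lambda>n. soft_step n t) \<longlonglongrightarrow> 1" by (rule tendsto_eventually)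
  thus ?thesis using True by simp
next
  case False
  have "t - inverse (real (Suc n)) \<le> 0" for n
    using False positive_imp_inverse_positive[of "real (Suc n)"] by linarith
  hence "soft_step n t = 0" for n using False by (simp add: soft_step_def max_absorb1)
  thus ?thesis using False by simp
qed

lemma soft_ramp_lim: "(\<lambda>n. soft_ramp n t) \<longlonglongrightarrow> max 0 t"
proof (cases "t > 0")
  case True
  have "\<forall>\<^sub>F n in sequentially. inverse (real (Suc n)) < t"
    using LIMSEQ_inverse_real_of_nat True by (rule order_tendstoD)
  hence "\<forall>\<^sub>F n in sequentially. t - inverse (real (Suc n)) / 2 = soft_ramp n t"
  proof eventually_elim
    fix n assume n: "inverse (real (Suc n)) < t"
    define k where "k = real (Suc n)"
    have k: "k > 0" "inverse k < t" using n by (auto simp: k_def)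
    have "soft_ramp n t = k * (t\<^sup>2 / 2 - (t - inverse k)\<^sup>2 / 2)"
      using k True by (simp add: soft_ramp_def half_square_def k_def)
    also have "\<dots> = k * (t * inverse k - (inverse k)\<^sup>2 / 2)"
      by (simp add: power2_diff field_simps)
    also have "\<dots> = t - inverse k / 2"
      using k by (simp add: power2_eq_square field_simps)
    finally show "t - inverse (real (Suc n)) / 2 = soft_ramp n t" by (simp add: k_def)
  qed
  moreover have "(\<lambda>n. t - inverse (real (Suc n)) / 2) \<longlonglongrightarrow> t - 0 / 2"
    by (intro tendsto_intros LIMSEQ_inverse_real_of_nat) auto
  ultimately have "(\<lambda>n. soft_ramp n t) \<longlonglongrightarrow> t - 0 / 2" by (rule Lim_transform_eventually[rotated])
  thus ?thesis using True by simp
next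
  case False
  have "t - inverse (real (Suc n)) \<le> 0" for n
    using False positive_imp_inverse_positive[of "real (Suc n)"] by linarith
  hence "soft_ramp n t = 0" for n using False by (simp add: soft_ramp_def half_square_def max_absorb1)
  thus ?thesis using False by simp
qed

lemma soft_ramp_diff_bounds:
  assumes "a \<le> b" shows "\<bar>soft_ramp n (s - a) - soft_ramp n (s - b)\<bar> \<le> b - a"
proof -
  have "norm (soft_ramp n (s - a) - soft_ramp n (s - b)) \<le> 1 * norm ((s - a) - (s - b))"
    by (rule field_differentiable_bound[of UNIV _ "soft_step n"])
       (use soft_ramp_deriv soft_step_bounds[of n] in \<open>auto intro: has_field_derivative_at_within\<close>)
  thus ?thesis using assms by simp
qed

subsection \<open>The slab identity\<close>

context closable_gradient
begin

text \<open>\<open>\<Psi>\<close> is in the domain of the adjoint \<open>M\<^sub>p\<^sup>*\<close>, and \<open>h\<close> is its image. The relation is stated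
  for every representative \<open>U\<close> of the gradient of \<open>f\<close>.\<close>

definition dual_field :: "real \<Rightarrow> ('a \<Rightarrow> 'a) \<Rightarrow> ('a \<Rightarrow> real) \<Rightarrow> bool" where
  "dual_field p \<Psi> h \<longleftrightarrow> p > 1 \<and> \<Psi> \<in> lp_space \<nu> (p / (p - 1)) \<and> h \<in> lp_space \<nu> (p / (p - 1)) \<and>
     (\<forall>f U. in_graph p f U \<longrightarrow> (\<integral>x. U x \<bullet> \<Psi> x \<partial>\<nu>) = (\<integral>x. f x * h x \<partial>\<nu>))"

lemma adjoint_domain_dual_field:
  assumes "\<Psi> \<in> adjoint_domain \<nu> R p" "p > 1"
  obtains h where "dual_field p \<Psi> h"
proof -
  obtain h where \<Psi>: "\<Psi> \<in> lp_space \<nu> (p / (p - 1))" and h: "h \<in> lp_space \<nu> (p / (p - 1))"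
    and eq: "\<And>f. f \<in> sobolev \<nu> R p \<Longrightarrow> (\<integral>x. sobolev_grad \<nu> R p f x \<bullet> \<Psi> x \<partial>\<nu>) = (\<integral>x. f x * h x \<partial>\<nu>)"
    using assms(1) unfolding adjoint_domain_def by blast
  note [measurable] = lp_space_measurable[OF \<Psi>]
  have "(\<integral>x. U x \<bullet> \<Psi> x \<partial>\<nu>) = (\<integral>x. f x * h x \<partial>\<nu>)" if fU: "in_graph p f U" for f U
  proof -
    have c: "in_graph p f (sobolev_grad \<nu> R p f)"
      unfolding sobolev_grad_def using fU by (rule someI[of "in_graph p f"])
    note [measurable] = grad_closure_lp(4)[OF fU] grad_closure_lp(4)[OF c]
    have "(\<integral>x. U x \<bullet> \<Psi> x \<partial>\<nu>) = (\<integral>x. sobolev_grad \<nu> R p f x \<bullet> \<Psi> x \<partial>\<nu>)"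
      by (rule integral_cong_AE) (use sobolev_grad_AE[OF fU assms(2)] in auto)
    also have "\<dots> = (\<integral>x. f x * h x \<partial>\<nu>)" by (rule eq) (use fU in \<open>auto simp: sobolev_def\<close>)
    finally show ?thesis .
  qed
  thus ?thesis using that \<Psi> h assms(2) unfolding dual_field_def by blast
qed

lemma dual_field_integrable:
  assumes d: "dual_field p \<Psi> h"
  shows "u \<in> lp_space \<nu> p \<Longrightarrow> integrable \<nu> (\<lambda>x. u x * h x)"
    and "U \<in> lp_space \<nu> p \<Longrightarrow> integrable \<nu> (\<lambda>x. U x \<bullet> \<Psi> x)"
    and "\<Psi> \<in> borel_measurable \<nu>" "h \<in> borel_measurable \<nu>" "p > 1"
proof -
  have p: "p > 1" and lp: "\<Psi> \<in> lp_space \<nu> (p / (p - 1))" "h \<in> lp_space \<nu> (p / (p - 1))"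
    using d by (auto simp: dual_field_def)
  thus "p > 1" and [measurable]: "\<Psi> \<in> borel_measurable \<nu>" "h \<in> borel_measurable \<nu>"
    using lp_space_measurable by auto
  show "integrable \<nu> (\<lambda>x. u x * h x)" if u: "u \<in> lp_space \<nu> p"
  proof (rule Bochner_Integration.integrable_bound[OF integrable_norm_mult[OF u lp(2) p]])
    note [measurable] = lp_space_measurable[OF u]
    show "(\<lambda>x. u x * h x) \<in> borel_measurable \<nu>" by measurable
  qed (auto simp: abs_mult)
  show "integrable \<nu> (\<lambda>x. U x \<bullet> \<Psi> x)" if U: "U \<in> lp_space \<nu> p"
  proof (rule Bochner_Integration.integrable_bound[OF integrable_norm_mult[OF U lp(1) p]])
    note [measurable] = lp_space_measurable[OF U]
    show "(\<lambda>x. U x \<bullet> \<Psi> x) \<in> borel_measurable \<nu>" by measurable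
  qed (auto simp: Cauchy_Schwarz_ineq2)
qed

text \<open>The adjoint relation for the product \<open>u \<theta>(g)\<close>, whose gradient is \<open>u \<theta>'(g) G + \<theta>(g) U\<close>.\<close>

lemma slab_identity_smooth:
  assumes d: "dual_field p \<Psi> h"
    and u: "in_graph (2 * p) u U" and g: "in_graph (2 * p) g G"
    and \<theta>: "\<And>t. (\<theta> has_real_derivative \<theta>' t) (at t)" "continuous_on UNIV \<theta>'" "\<And>t. \<bar>\<theta>' t\<bar> \<le> L"
  shows "(\<integral>x. \<theta>' (g x) * (u x * (G x \<bullet> \<Psi> x)) \<partial>\<nu>) = (\<integral>x. \<theta> (g x) * (u x * h x - U x \<bullet> \<Psi> x) \<partial>\<nu>)"
proof -
  have p: "p > 0" "2 * p > 0" using dual_field_integrable(5)[OF d] by auto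
  have c: "in_graph (2 * p) (\<lambda>x. \<theta> (g x)) (\<lambda>x. \<theta>' (g x) *\<^sub>R G x)"
    by (rule grad_closure_compose[OF g p(2) \<theta>])
  have m: "in_graph p (\<lambda>x. u x * \<theta> (g x)) (\<lambda>x. u x *\<^sub>R (\<theta>' (g x) *\<^sub>R G x) + \<theta> (g x) *\<^sub>R U x)"
    by (rule grad_closure_mult[OF u c p(1)])
  have 1: "integrable \<nu> (\<lambda>x. u x *\<^sub>R (\<theta>' (g x) *\<^sub>R G x) \<bullet> \<Psi> x)"
    by (rule dual_field_integrable(2)[OF d lp_space_mult[OF grad_closure_lp(1)[OF u] grad_closure_lp(2)[OF c] p(1)]])
  have 2: "integrable \<nu> (\<lambda>x. \<theta> (g x) *\<^sub>R U x \<bullet> \<Psi> x)"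
    by (rule dual_field_integrable(2)[OF d lp_space_mult[OF grad_closure_lp(1)[OF c] grad_closure_lp(2)[OF u] p(1)]])
  have 3: "integrable \<nu> (\<lambda>x. (u x * \<theta> (g x)) * h x)"
    by (rule dual_field_integrable(1)[OF d grad_closure_lp(1)[OF m]])
  have "(\<integral>x. (u x *\<^sub>R (\<theta>' (g x) *\<^sub>R G x) + \<theta> (g x) *\<^sub>R U x) \<bullet> \<Psi> x \<partial>\<nu>) = (\<integral>x. (u x * \<theta> (g x)) * h x \<partial>\<nu>)"
    using d m unfolding dual_field_def by blast
  also have "(\<integral>x. (u x *\<^sub>R (\<theta>' (g x) *\<^sub>R G x) + \<theta> (g x) *\<^sub>R U x) \<bullet> \<Psi> x \<partial>\<nu>)
      = (\<integral>x. u x *\<^sub>R (\<theta>' (g x) *\<^sub>R G x) \<bullet> \<Psi> x \<partial>\<nu>) + (\<integral>x. \<theta> (g x) *\<^sub>R U x \<bullet> \<Psi> x \<partial>\<nu>)"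
    using 1 2 by (simp add: inner_add_left)
  finally have "(\<integral>x. u x *\<^sub>R (\<theta>' (g x) *\<^sub>R G x) \<bullet> \<Psi> x \<partial>\<nu>)
      = (\<integral>x. (u x * \<theta> (g x)) * h x - \<theta> (g x) *\<^sub>R U x \<bullet> \<Psi> x \<partial>\<nu>)"
    using 2 3 by simp
  thus ?thesis by (simp add: algebra_simps)
qed

lemma slab_integrable:
  assumes d: "dual_field p \<Psi> h"
    and u: "in_graph (2 * p) u U" and g: "in_graph (2 * p) g G"
  shows "integrable \<nu> (\<lambda>x. u x * (G x \<bullet> \<Psi> x))" "integrable \<nu> (\<lambda>x. u x * h x - U x \<bullet> \<Psi> x)"
proof -
  have p: "p > 0" "p \<le> 2 * p" using dual_field_integrable(5)[OF d] by auto
  show "integrable \<nu> (\<lambda>x. u x * (G x \<bullet> \<Psi> x))"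
    using dual_field_integrable(2)[OF d lp_space_mult[OF grad_closure_lp(1)[OF u] grad_closure_lp(2)[OF g] p(1)]]
    by simp
  have uU: "in_graph p u U" by (rule grad_closure_mono[OF u p])
  show "integrable \<nu> (\<lambda>x. u x * h x - U x \<bullet> \<Psi> x)"
    by (intro Bochner_Integration.integrable_diff dual_field_integrable(1)[OF d grad_closure_lp(1)[OF uU]]
        dual_field_integrable(2)[OF d grad_closure_lp(2)[OF uU]])
qed

text \<open>Smooth \<open>\<theta>\<close> are enough: the limit from \<open>\<theta>'\<close> to the indicator of \<open>]a, b]\<close> is taken in the
  integrals, by dominated convergence, and not in the Sobolev space.\<close>

lemma slab_identity:
  assumes d: "dual_field p \<Psi> h"
    and u: "in_graph (2 * p) u U" and g: "in_graph (2 * p) g G" and ab: "a \<le> b"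
  shows "(\<integral>x. indicator {x. a < g x \<and> g x \<le> b} x * (u x * (G x \<bullet> \<Psi> x)) \<partial>\<nu>) =
    (\<integral>x. (max 0 (g x - a) - max 0 (g x - b)) * (u x * h x - U x \<bullet> \<Psi> x) \<partial>\<nu>)"
proof -
  let ?J = "\<lambda>x. u x * (G x \<bullet> \<Psi> x)" and ?K = "\<lambda>x. u x * h x - U x \<bullet> \<Psi> x"
  note int = slab_integrable[OF d u g]
  note [measurable] = grad_closure_lp(3)[OF g] borel_measurable_integrable[OF int(1)] borel_measurable_integrable[OF int(2)]
  define \<theta> where "\<theta> = (\<lambda>n s. soft_ramp n (s - a) - soft_ramp n (s - b))"
  define \<theta>' where "\<theta>' = (\<lambda>n s. soft_step n (s - a) - soft_step n (s - b))"
  have shift: "((\<lambda>t. soft_ramp n (t - c)) has_real_derivative soft_step n (t - c)) (at t)" for n c t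
    using DERIV_shift[of "soft_ramp n" "soft_step n (t - c)" t "-c"] soft_ramp_deriv[of n "t - c"] by simp
  have der: "(\<theta> n has_real_derivative \<theta>' n t) (at t)" for n t
    unfolding \<theta>_def \<theta>'_def by (intro DERIV_diff shift)
  have cont': "continuous_on UNIV (\<theta>' n)" for n
    unfolding \<theta>'_def by (intro continuous_intros soft_step_cont)
  have cont: "continuous_on UNIV (\<theta> n)" for n
    using der by (auto simp: continuous_on_eq_continuous_at intro: DERIV_isCont)
  have b': "\<bar>\<theta>' n t\<bar> \<le> 1" for n t
    using soft_step_bounds[of n "t - a"] soft_step_bounds[of n "t - b"] by (simp add: \<theta>'_def)
  have b: "\<bar>\<theta> n t\<bar> \<le> b - a" for n t
    unfolding \<theta>_def by (rule soft_ramp_diff_bounds[OF ab])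
  note [measurable] = borel_measurable_continuous_onI[OF cont] borel_measurable_continuous_onI[OF cont']
  have "(\<lambda>n. \<integral>x. \<theta>' n (g x) * ?J x \<partial>\<nu>) \<longlonglongrightarrow> (\<integral>x. indicator {x. a < g x \<and> g x \<le> b} x * ?J x \<partial>\<nu>)"
  proof (rule integral_dominated_convergence[where w = "\<lambda>x. \<bar>?J x\<bar>"])
    show "AE x in \<nu>. (\<lambda>n. \<theta>' n (g x) * ?J x) \<longlonglongrightarrow> indicator {x. a < g x \<and> g x \<le> b} x * ?J x"
    proof (rule AE_I2)
      fix x
      have "(\<lambda>n. \<theta>' n (g x)) \<longlonglongrightarrow> (if g x - a > 0 then 1 else 0) - (if g x - b > 0 then 1 else 0)"
        unfolding \<theta>'_def by (intro tendsto_diff soft_step_lim)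
      moreover have "(if g x - a > 0 then 1 else 0) - (if g x - b > 0 then 1 else 0)
          = (indicator {x. a < g x \<and> g x \<le> b} x :: real)" using ab by (auto simp: indicator_def)
      ultimately show "(\<lambda>n. \<theta>' n (g x) * ?J x) \<longlonglongrightarrow> indicator {x. a < g x \<and> g x \<le> b} x * ?J x"
        by (intro tendsto_intros) simp
    qed
    show "AE x in \<nu>. norm (\<theta>' n (g x) * ?J x) \<le> \<bar>?J x\<bar>" for n
      using b'[of n] by (auto simp: abs_mult intro!: mult_left_le_one_le mult_nonneg_nonneg)
    show "(\<lambda>x. indicator {x. a < g x \<and> g x \<le> b} x * ?J x) \<in> borel_measurable \<nu>" by measurable
  qed (use int in auto)
  moreover have "(\<lambda>n. \<integral>x. \<theta> n (g x) * ?K x \<partial>\<nu>) \<longlonglongrightarrow> (\<integral>x. (max 0 (g x - a) - max 0 (g x - b)) * ?K x \<partial>\<nu>)"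
  proof (rule integral_dominated_convergence[where w = "\<lambda>x. (b - a) * \<bar>?K x\<bar>"])
    show "AE x in \<nu>. (\<lambda>n. \<theta> n (g x) * ?K x) \<longlonglongrightarrow> (max 0 (g x - a) - max 0 (g x - b)) * ?K x"
      unfolding \<theta>_def by (intro AE_I2 tendsto_mult tendsto_diff soft_ramp_lim tendsto_const)
    show "AE x in \<nu>. norm (\<theta> n (g x) * ?K x) \<le> (b - a) * \<bar>?K x\<bar>" for n
      using b[of n] by (auto simp: abs_mult intro!: mult_right_mono)
  qed (use int in auto)
  moreover have "(\<integral>x. \<theta>' n (g x) * ?J x \<partial>\<nu>) = (\<integral>x. \<theta> n (g x) * ?K x \<partial>\<nu>)" for n
    by (rule slab_identity_smooth[OF d u g der cont' b'])
  ultimately show ?thesis using LIMSEQ_unique by simp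
qed

definition slab :: "('a \<Rightarrow> real) \<Rightarrow> real \<Rightarrow> nat \<Rightarrow> 'a set" where
  "slab g r n = {x. r - inverse (real (Suc n)) < g x \<and> g x \<le> r}"

text \<open>After division by \<open>b - a\<close> the ramp \<open>max 0 (s - a) - max 0 (s - b)\<close> tends to the indicator of
  \<open>s \<ge> r\<close> as \<open>a\<close> tends to \<open>b = r\<close>. Subtracting the constant \<open>1\<close> from it does not change the integral, because
  \<open>u h - U \<bullet> \<Psi>\<close> integrates to zero by the adjoint relation for \<open>u\<close> itself; what remains is minus the
  indicator of the sublevel set.\<close>

lemma slab_limit:
  assumes d: "dual_field p \<Psi> h"
    and u: "in_graph (2 * p) u U" and g: "in_graph (2 * p) g G"
  shows "(\<lambda>n. real (Suc n) * (\<integral>x. indicator (slab g r n) x * (u x * (G x \<bullet> \<Psi> x)) \<partial>\<nu>))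
     \<longlonglongrightarrow> - (\<integral>x. indicator {x. g x < r} x * (u x * h x - U x \<bullet> \<Psi> x) \<partial>\<nu>)"
proof -
  let ?K = "\<lambda>x. u x * h x - U x \<bullet> \<Psi> x"
  let ?e = "\<lambda>n. inverse (real (Suc n))"
  have p: "p > 0" "p \<le> 2 * p" using dual_field_integrable(5)[OF d] by auto
  note int = slab_integrable[OF d u g]
  note [measurable] = grad_closure_lp(3)[OF g] borel_measurable_integrable[OF int(2)]
  define X where "X = (\<lambda>n s. max 0 (s - (r - ?e n)) - max 0 (s - r))"
  have Xm: "(\<lambda>x. X n (g x)) \<in> borel_measurable \<nu>" for n unfolding X_def by measurable
  note [measurable] = Xm
  have X': "0 \<le> max 0 (s - (r - c)) - max 0 (s - r) \<and> max 0 (s - (r - c)) - max 0 (s - r) \<le> c"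
    if "c > 0" for c s :: real using that by (auto simp: max_def)
  have Xb: "0 \<le> X n s" "X n s \<le> ?e n" for n s using X'[of "?e n" s] by (auto simp: X_def)
  have iX: "integrable \<nu> (\<lambda>x. X n (g x) * ?K x)" for n
  proof (rule Bochner_Integration.integrable_bound[where f = "\<lambda>x. ?e n * ?K x"])
    show "AE x in \<nu>. norm (X n (g x) * ?K x) \<le> norm (?e n * ?K x)"
      using Xb[of n] by (intro AE_I2) (simp add: abs_mult mult_right_mono)
  qed (use int in auto)
  have uU: "in_graph p u U" by (rule grad_closure_mono[OF u p])
  have K0: "(\<integral>x. ?K x \<partial>\<nu>) = 0"
    using uU d dual_field_integrable(1)[OF d grad_closure_lp(1)[OF uU]]
      dual_field_integrable(2)[OF d grad_closure_lp(2)[OF uU]] by (simp add: dual_field_def)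
  have eq: "real (Suc n) * (\<integral>x. indicator (slab g r n) x * (u x * (G x \<bullet> \<Psi> x)) \<partial>\<nu>)
      = (\<integral>x. (real (Suc n) * X n (g x) - 1) * ?K x \<partial>\<nu>)" for n
  proof -
    have "(\<integral>x. indicator (slab g r n) x * (u x * (G x \<bullet> \<Psi> x)) \<partial>\<nu>) = (\<integral>x. X n (g x) * ?K x \<partial>\<nu>)"
      unfolding X_def slab_def by (rule slab_identity[OF d u g]) simp
    hence "real (Suc n) * (\<integral>x. indicator (slab g r n) x * (u x * (G x \<bullet> \<Psi> x)) \<partial>\<nu>)
       = (\<integral>x. real (Suc n) * (X n (g x) * ?K x) \<partial>\<nu>) - (\<integral>x. ?K x \<partial>\<nu>)" using K0 by simp
    also have "\<dots> = (\<integral>x. real (Suc n) * (X n (g x) * ?K x) - ?K x \<partial>\<nu>)"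
      using iX[of n] int(2) by (intro Bochner_Integration.integral_diff[symmetric]) auto
    also have "\<dots> = (\<integral>x. (real (Suc n) * X n (g x) - 1) * ?K x \<partial>\<nu>)"
      by (simp only: left_diff_distrib mult.assoc mult_1)
    finally show ?thesis .
  qed
  have "(\<lambda>n. \<integral>x. (real (Suc n) * X n (g x) - 1) * ?K x \<partial>\<nu>) \<longlonglongrightarrow> (\<integral>x. - indicator {x. g x < r} x * ?K x \<partial>\<nu>)"
  proof (rule integral_dominated_convergence[where w = "\<lambda>x. \<bar>?K x\<bar>"])
    show "AE x in \<nu>. (\<lambda>n. (real (Suc n) * X n (g x) - 1) * ?K x) \<longlonglongrightarrow> - indicator {x. g x < r} x * ?K x"
    proof (rule AE_I2)
      fix x
      have "(\<lambda>n. real (Suc n) * X n (g x) - 1) \<longlonglongrightarrow> - indicator {x. g x < r} x"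
      proof (cases "g x < r")
        case True
        have "\<forall>\<^sub>F n in sequentially. ?e n < r - g x"
          by (rule order_tendstoD(2)[OF LIMSEQ_inverse_real_of_nat]) (use True in simp)
        hence "\<forall>\<^sub>F n in sequentially. real (Suc n) * X n (g x) - 1 = - indicator {x. g x < r} x"
          by eventually_elim (use True in \<open>simp add: X_def max_def\<close>)
        thus ?thesis by (rule tendsto_eventually)
      next
        case False
        have "max 0 (g x - (r - c)) - max 0 (g x - r) = c" if "c > 0" for c
          using False that by (auto simp: max_def)
        hence "real (Suc n) * X n (g x) = real (Suc n) * ?e n" for n by (simp add: X_def)
        thus ?thesis using False by simp
      qed
      thus "(\<lambda>n. (real (Suc n) * X n (g x) - 1) * ?K x) \<longlonglongrightarrow> - indicator {x. g x < r} x * ?K x"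
        by (intro tendsto_intros)
    qed
    show "AE x in \<nu>. norm ((real (Suc n) * X n (g x) - 1) * ?K x) \<le> \<bar>?K x\<bar>" for n
    proof (rule AE_I2)
      fix x
      have "real (Suc n) * X n (g x) \<le> real (Suc n) * ?e n" using Xb(2) by (intro mult_left_mono) auto
      moreover have "0 \<le> real (Suc n) * X n (g x)" using Xb(1) by simp
      ultimately have "\<bar>real (Suc n) * X n (g x) - 1\<bar> \<le> 1" by (simp add: abs_le_iff)
      thus "norm ((real (Suc n) * X n (g x) - 1) * ?K x) \<le> \<bar>?K x\<bar>"
        unfolding real_norm_def abs_mult by (intro mult_left_le_one_le) auto
    qed
    show "(\<lambda>x. - indicator {x. g x < r} x * ?K x) \<in> borel_measurable \<nu>" by measurable
    show "(\<lambda>x. (real (Suc n) * X n (g x) - 1) * ?K x) \<in> borel_measurable \<nu>" for n by measurable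
  qed (use int in auto)
  thus ?thesis unfolding eq by simp
qed

section \<open>Surface measures and traces\<close>

lemma surface_measure_slab:
  assumes \<sigma>: "is_surface_measure \<nu> g r \<sigma>" and g[measurable]: "g \<in> borel_measurable \<nu>"
    and \<phi>: "continuous_on UNIV \<phi>" "bounded (range \<phi>)"
  shows "(\<lambda>n. real (Suc n) * (\<integral>x. indicator (slab g r n) x * \<phi> x \<partial>\<nu>)) \<longlonglongrightarrow> (\<integral>x. \<phi> x \<partial>\<sigma>)"
proof -
  define F where "F = (\<lambda>s. LINT x:{x. g x \<le> s}|\<nu>. \<phi> x)"
  have [measurable]: "\<phi> \<in> borel_measurable \<nu>" using \<phi>(1) by (rule continuous_measurable)
  obtain B where B: "\<And>x. norm (\<phi> x) \<le> B" using \<phi>(2) by (auto simp: bounded_iff)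
  have \<phi>i: "integrable \<nu> \<phi>" by (rule integrable_const_bound[of _ B]) (use B in auto)
  have [simp]: "space \<nu> = UNIV" using sets_eq_imp_space_eq[OF sets_nu] by simp
  have i: "integrable \<nu> (\<lambda>x. indicator {x. g x \<le> s} x * \<phi> x)" for s
  proof -
    have "{x \<in> space \<nu>. g x \<le> s} \<in> sets \<nu>" by measurable
    thus ?thesis using integrable_mult_indicator[OF _ \<phi>i, of "{x. g x \<le> s}"] by simp
  qed
  have D: "(F has_real_derivative (\<integral>x. \<phi> x \<partial>\<sigma>)) (at r)"
    using \<sigma> \<phi> unfolding is_surface_measure_def F_def by blast
  hence "((\<lambda>h. (F (r + h) - F r) / h) \<longlongrightarrow> (\<integral>x. \<phi> x \<partial>\<sigma>)) (at 0)" by (simp add: DERIV_def)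
  moreover have "filterlim (\<lambda>n. - inverse (real (Suc n))) (at 0) sequentially"
    unfolding filterlim_at using tendsto_minus[OF LIMSEQ_inverse_real_of_nat] by simp
  ultimately have "(\<lambda>n. (F (r + - inverse (real (Suc n))) - F r) / - inverse (real (Suc n))) \<longlonglongrightarrow> (\<integral>x. \<phi> x \<partial>\<sigma>)"
    by (rule filterlim_compose)
  moreover have "(F (r + - inverse (real (Suc n))) - F r) / - inverse (real (Suc n))
      = real (Suc n) * (\<integral>x. indicator (slab g r n) x * \<phi> x \<partial>\<nu>)" for n
  proof -
    let ?e = "inverse (real (Suc n))"
    have ind: "indicator (slab g r n) x = (indicator {x. g x \<le> r} x - indicator {x. g x \<le> r - ?e} x :: real)" for x
    proof -
      have "g x \<le> r - ?e \<Longrightarrow> g x \<le> r" using positive_imp_inverse_positive[of "real (Suc n)"] by linarith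
      thus ?thesis by (auto simp: slab_def indicator_def simp del: of_nat_Suc)
    qed
    have "(\<integral>x. indicator (slab g r n) x * \<phi> x \<partial>\<nu>) = F r - F (r - ?e)"
      using i unfolding ind F_def set_lebesgue_integral_def by (simp add: left_diff_distrib)
    moreover have "(A - B) / - inverse k = k * (B - A)" if "k > 0" for A B k :: real
      using that by (simp add: field_simps)
    ultimately show ?thesis by (simp del: of_nat_Suc)
  qed
  ultimately show ?thesis by simp
qed

text \<open>The condition \<open>G x \<bullet> \<Psi> x = 1\<close> turns the averages over slabs into those whose limit is, by
  definition, the surface integral.\<close>

lemma surface_integral_Cb1:
  assumes d: "dual_field p \<Psi> h" and g: "in_graph (2 * p) g G" and t: "AE x in \<nu>. G x \<bullet> \<Psi> x = 1"
    and \<sigma>: "is_surface_measure \<nu> g r \<sigma>" and \<phi>: "\<phi> \<in> Cb1"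
  shows "(\<integral>x. \<phi> x \<partial>\<sigma>) = - (\<integral>x. indicator {x. g x < r} x * (\<phi> x * h x - R_grad \<phi> x \<bullet> \<Psi> x) \<partial>\<nu>)"
proof (rule LIMSEQ_unique)
  note [measurable] = grad_closure_lp(3)[OF g] grad_closure_lp(4)[OF g] dual_field_integrable(3,4)[OF d]
  have [measurable]: "\<phi> \<in> borel_measurable \<nu>" using Cb1D(3)[OF \<phi>] by (rule continuous_measurable)
  have [simp]: "space \<nu> = UNIV" using sets_eq_imp_space_eq[OF sets_nu] by simp
  have "{x \<in> space \<nu>. r - inverse (real (Suc n)) < g x \<and> g x \<le> r} \<in> sets \<nu>" for n by measurable
  hence [measurable]: "slab g r n \<in> sets \<nu>" for n by (simp add: slab_def)
  have "2 * p > 0" using dual_field_integrable(5)[OF d] by simp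
  note lim = slab_limit[OF d grad_closure_Cb1[OF \<phi> this] g, of r]
  have "(\<integral>x. indicator (slab g r n) x * (\<phi> x * (G x \<bullet> \<Psi> x)) \<partial>\<nu>) = (\<integral>x. indicator (slab g r n) x * \<phi> x \<partial>\<nu>)" for n
    by (rule integral_cong_AE) (use t in auto)
  with lim show "(\<lambda>n. real (Suc n) * (\<integral>x. indicator (slab g r n) x * \<phi> x \<partial>\<nu>)) \<longlonglongrightarrow>
     - (\<integral>x. indicator {x. g x < r} x * (\<phi> x * h x - R_grad \<phi> x \<bullet> \<Psi> x) \<partial>\<nu>)" by simp
  show "(\<lambda>n. real (Suc n) * (\<integral>x. indicator (slab g r n) x * \<phi> x \<partial>\<nu>)) \<longlonglongrightarrow> (\<integral>x. \<phi> x \<partial>\<sigma>)"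
    by (rule surface_measure_slab[OF \<sigma>]) (use Cb1D(3)[OF \<phi>] \<phi> in \<open>auto simp: Cb1_def\<close>)
qed

end

text \<open>\<open>G\<close> is a gradient of \<open>g\<close> and \<open>\<Psi>\<close> a field transversal to the level sets of \<open>g\<close>, normalized by
  \<open>G \<bullet> \<Psi> = 1\<close>; for an admissible \<open>g\<close>, \<open>\<Psi> = G \<parallel>G\<parallel>\<^sup>-\<^sup>2\<close>.\<close>

locale level_function = closable_gradient +
  fixes g :: "'a \<Rightarrow> real" and G \<Psi> :: "'a \<Rightarrow> 'a" and r :: real and \<sigma> :: "'a measure"
  assumes gG: "\<And>p. p > 1 \<Longrightarrow> in_graph p g G"
    and dual: "\<And>p. p > 1 \<Longrightarrow> \<exists>h. dual_field p \<Psi> h"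
    and transversal: "AE x in \<nu>. G x \<bullet> \<Psi> x = 1"
    and surface: "is_surface_measure \<nu> g r \<sigma>"
begin

sublocale surf: finite_measure \<sigma> using surface by (simp add: is_surface_measure_def)

lemma sets_surf: "sets \<sigma> = sets borel" using surface by (simp add: is_surface_measure_def)

lemma surf_measurable: "continuous_on UNIV \<phi> \<Longrightarrow> \<phi> \<in> borel_measurable \<sigma>"
  using borel_measurable_continuous_onI measurable_cong_sets[OF sets_surf refl] by blast

lemma surf_integrable:
  fixes \<phi> :: "'a \<Rightarrow> real"
  assumes "\<phi> \<in> Cb1" shows "integrable \<sigma> \<phi>"
proof -
  obtain B C where B: "\<And>x. \<bar>\<phi> x\<bar> \<le> B" "\<And>x. norm (gradient \<phi> x) \<le> C" "B \<ge> 0" "C \<ge> 0"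
    by (rule Cb1_bounds[OF assms]) (rule that)
  show ?thesis
    by (rule surf.integrable_const_bound[of _ B]) (use B surf_measurable[OF Cb1D(3)[OF assms]] in auto)
qed

lemma two_gG: "dual_field p \<Psi> h \<Longrightarrow> in_graph (2 * p) g G"
  by (rule gG) (simp add: dual_field_def)

lemma Cb1_surface_integral:
  assumes "dual_field p \<Psi> h" "\<phi> \<in> Cb1"
  shows "(\<integral>x. \<phi> x \<partial>\<sigma>) = - (\<integral>x. indicator {x. g x < r} x * (\<phi> x * h x - R_grad \<phi> x \<bullet> \<Psi> x) \<partial>\<nu>)"
  by (rule surface_integral_Cb1[OF assms(1) two_gG[OF assms(1)] transversal surface assms(2)])

lemma sublevel_measurable: "(\<lambda>x. indicator {x. g x < r} x :: real) \<in> borel_measurable \<nu>"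
proof -
  note [measurable] = grad_closure_lp(3)[OF gG[of 2], simplified]
  show ?thesis by measurable
qed

text \<open>By duality of \<open>L\<^sup>p\<close> and \<open>L\<^bsup>p'\<^esup>\<close>, the volume integral in \<open>Cb1_surface_integral\<close> is continuous on
  \<open>W\<^bsup>1,p\<^esup>\<close>.\<close>

lemma surface_integral_tendsto:
  assumes d: "dual_field p \<Psi> h" and v: "\<And>n. v n \<in> Cb1"
    and f: "lp_conv \<nu> p v f" and F: "lp_conv \<nu> p (\<lambda>n. R_grad (v n)) F"
  shows "(\<lambda>n. \<integral>x. v n x \<partial>\<sigma>) \<longlonglongrightarrow> - (\<integral>x. indicator {x. g x < r} x * (f x * h x - F x \<bullet> \<Psi> x) \<partial>\<nu>)"
proof -
  let ?I = "\<lambda>x. indicator {x. g x < r} x :: real"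
  let ?K = "\<lambda>x. f x * h x - F x \<bullet> \<Psi> x" and ?Kn = "\<lambda>n x. v n x * h x - R_grad (v n) x \<bullet> \<Psi> x"
  let ?B = "\<lambda>n x. norm (v n x - f x) * norm (h x) + norm (R_grad (v n) x - F x) * norm (\<Psi> x)"
  have p: "p > 1" "p > 0" using dual_field_integrable(5)[OF d] by auto
  have lp: "h \<in> lp_space \<nu> (p / (p - 1))" "\<Psi> \<in> lp_space \<nu> (p / (p - 1))" using d by (auto simp: dual_field_def)
  have i1: "integrable \<nu> (\<lambda>x. norm (v n x - f x) * norm (h x))" for n
    by (rule integrable_norm_mult[OF lp_convD(5)[OF f p(2)] lp(1) p(1)])
  have i2: "integrable \<nu> (\<lambda>x. norm (R_grad (v n) x - F x) * norm (\<Psi> x))" for n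
    by (rule integrable_norm_mult[OF lp_convD(5)[OF F p(2)] lp(2) p(1)])
  have "(\<lambda>n. \<integral>x. norm (v n x - f x) * norm (h x) \<partial>\<nu>) \<longlonglongrightarrow> 0"
    by (rule lp_mult_tendsto_0[OF lp_convD(5)[OF f p(2)] lp_convD(7)[OF f p(2)] lp(1) p(1)])
  moreover have "(\<lambda>n. \<integral>x. norm (R_grad (v n) x - F x) * norm (\<Psi> x) \<partial>\<nu>) \<longlonglongrightarrow> 0"
    by (rule lp_mult_tendsto_0[OF lp_convD(5)[OF F p(2)] lp_convD(7)[OF F p(2)] lp(2) p(1)])
  ultimately have B: "(\<lambda>n. \<integral>x. ?B n x \<partial>\<nu>) \<longlonglongrightarrow> 0"
    unfolding Bochner_Integration.integral_add[OF i1 i2] by (rule tendsto_add_zero)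
  have iK: "integrable \<nu> ?K" 
    by (intro Bochner_Integration.integrable_diff dual_field_integrable(1)[OF d lp_convD(2)[OF f p(2)]]
        dual_field_integrable(2)[OF d lp_convD(2)[OF F p(2)]])
  have iKn: "integrable \<nu> (?Kn n)" for n
    by (intro Bochner_Integration.integrable_diff dual_field_integrable(1)[OF d lp_convD(1)[OF f p(2)]]
        dual_field_integrable(2)[OF d lp_convD(1)[OF F p(2)]])
  have j: "integrable \<nu> (\<lambda>x. ?I x * k x)" if k: "integrable \<nu> k" for k :: "'a \<Rightarrow> real"
  proof (rule Bochner_Integration.integrable_bound[OF k])
    note [measurable] = borel_measurable_integrable[OF k] sublevel_measurable
    show "(\<lambda>x. ?I x * k x) \<in> borel_measurable \<nu>" by measurable
  qed (auto simp: indicator_def)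
  have "(\<lambda>n. (\<integral>x. ?I x * ?Kn n x \<partial>\<nu>) - (\<integral>x. ?I x * ?K x \<partial>\<nu>)) \<longlonglongrightarrow> 0"
  proof (rule Lim_null_comparison[OF _ B], rule always_eventually, rule allI)
    fix n
    have pt: "norm (?I x * ?Kn n x - ?I x * ?K x) \<le> ?B n x" for x
    proof -
      let ?a = "(v n x - f x) * h x" and ?b = "(R_grad (v n) x - F x) \<bullet> \<Psi> x"
      have eq: "?I x * ?Kn n x - ?I x * ?K x = ?I x * (?a - ?b)"
        by (simp add: algebra_simps inner_diff_left)
      have "norm (?I x * (?a - ?b)) \<le> 1 * norm (?a - ?b)"
        unfolding norm_mult by (intro mult_right_mono) (auto simp: indicator_def)
      moreover have "norm (?a - ?b) \<le> norm ?a + norm ?b" by (rule norm_triangle_ineq4)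
      moreover have "norm ?a = norm (v n x - f x) * norm (h x)" by (simp add: abs_mult)
      moreover have "norm ?b \<le> norm (R_grad (v n) x - F x) * norm (\<Psi> x)"
        unfolding real_norm_def by (rule Cauchy_Schwarz_ineq2)
      ultimately show ?thesis unfolding eq by linarith
    qed
    have "norm (\<integral>x. ?I x * ?Kn n x - ?I x * ?K x \<partial>\<nu>) \<le> (\<integral>x. ?B n x \<partial>\<nu>)"
      by (rule norm_integral_le[OF Bochner_Integration.integrable_diff[OF j[OF iKn] j[OF iK]]
            Bochner_Integration.integrable_add[OF i1 i2] pt])
    thus "norm ((\<integral>x. ?I x * ?Kn n x \<partial>\<nu>) - (\<integral>x. ?I x * ?K x \<partial>\<nu>)) \<le> (\<integral>x. ?B n x \<partial>\<nu>)"
      unfolding Bochner_Integration.integral_diff[OF j[OF iKn] j[OF iK]] .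
  qed
  hence "(\<lambda>n. \<integral>x. ?I x * ?Kn n x \<partial>\<nu>) \<longlonglongrightarrow> (\<integral>x. ?I x * ?K x \<partial>\<nu>)" by (rule LIM_zero_cancel)
  thus ?thesis unfolding Cb1_surface_integral[OF d v] by (rule tendsto_minus)
qed

text \<open>As \<open>\<bar>v\<bar>\<close> is not smooth, it is replaced by the functions \<open>sqrt (\<epsilon>\<^sup>2 + v\<^sup>2) - \<epsilon>\<close>, whose values
  and gradients are pointwise not larger than those of \<open>v\<close>. The estimate makes the restriction of smooth
  functions to the surface continuous from \<open>W\<^bsup>1,p\<^esup>\<close> to \<open>L\<^sup>1\<close>.\<close>

lemma surface_abs_le:
  assumes d: "dual_field p \<Psi> h" and v: "v \<in> Cb1"
  shows "(\<integral>x. \<bar>v x\<bar> \<partial>\<sigma>) \<le> (\<integral>x. norm (v x) * norm (h x) \<partial>\<nu>) + (\<integral>x. norm (R_grad v x) * norm (\<Psi> x) \<partial>\<nu>)"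
    (is "_ \<le> ?A + ?B")
proof (rule field_le_epsilon)
  fix e0 :: real assume e0: "e0 > 0"
  define e where "e = e0 / (measure \<sigma> (space \<sigma>) + 1)"
  have m: "measure \<sigma> (space \<sigma>) \<ge> 0" by simp
  have e: "e > 0" using e0 m by (simp add: e_def add_nonneg_pos)
  have em: "e * measure \<sigma> (space \<sigma>) \<le> e0"
    using e0 m by (simp add: e_def divide_le_eq add_nonneg_pos mult_left_mono)
  have p: "p > 1" "p > 0" using dual_field_integrable(5)[OF d] by auto
  have lp: "h \<in> lp_space \<nu> (p / (p - 1))" "\<Psi> \<in> lp_space \<nu> (p / (p - 1))" using d by (auto simp: dual_field_def)
  have i1: "integrable \<nu> (\<lambda>x. norm (v x) * norm (h x))"
    by (rule integrable_norm_mult[OF Cb1_lp(1)[OF v p(2)] lp(1) p(1)])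
  have i2: "integrable \<nu> (\<lambda>x. norm (R_grad v x) * norm (\<Psi> x))"
    by (rule integrable_norm_mult[OF Cb1_lp(2)[OF v p(2)] lp(2) p(1)])
  define \<theta> where "\<theta> = (\<lambda>t::real. sqrt (e\<^sup>2 + t\<^sup>2) - e)"
  define \<theta>' where "\<theta>' = (\<lambda>t::real. t / sqrt (e\<^sup>2 + t\<^sup>2))"
  have pos: "e\<^sup>2 + t\<^sup>2 > 0" for t :: real using e by (auto intro: add_pos_nonneg)
  have der: "(\<theta> has_real_derivative \<theta>' t) (at t)" for t
    unfolding \<theta>_def \<theta>'_def using pos[of t] by (auto intro!: derivative_eq_intros simp: field_simps)
  have cont: "continuous_on UNIV \<theta>'"
  proof -
    have "sqrt (e\<^sup>2 + t\<^sup>2) \<noteq> 0" for t using e by simp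
    thus ?thesis unfolding \<theta>'_def by (intro continuous_intros) auto
  qed
  have abs_le: "\<bar>t\<bar> \<le> sqrt (e\<^sup>2 + t\<^sup>2)" for t by (rule real_le_rsqrt) simp
  have b': "\<bar>\<theta>' t\<bar> \<le> 1" for t
    using abs_le[of t] pos[of t] unfolding \<theta>'_def by (simp add: abs_divide divide_le_eq_1_pos)
  have b: "\<bar>\<theta> t\<bar> \<le> \<bar>t\<bar>" for t
  proof -
    have "e \<le> sqrt (e\<^sup>2 + t\<^sup>2)" using e by (intro real_le_rsqrt) auto
    moreover have "sqrt (e\<^sup>2 + t\<^sup>2) \<le> e + \<bar>t\<bar>" 
      using e by (intro real_le_lsqrt) (auto simp: power2_sum)
    ultimately show ?thesis by (simp add: \<theta>_def)
  qed
  note C = Cb1_compose_C1[OF v der cont]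
  have "(\<integral>x. \<bar>v x\<bar> \<partial>\<sigma>) \<le> (\<integral>x. \<theta> (v x) + e \<partial>\<sigma>)"
  proof (rule integral_mono)
    show "integrable \<sigma> (\<lambda>x. \<bar>v x\<bar>)" using surf_integrable[OF v] by simp
    show "integrable \<sigma> (\<lambda>x. \<theta> (v x) + e)"
      by (intro Bochner_Integration.integrable_add surf_integrable[OF C(1)] surf.integrable_const)
    show "\<bar>v x\<bar> \<le> \<theta> (v x) + e" for x using abs_le[of "v x"] by (simp add: \<theta>_def)
  qed
  also have "\<dots> = (\<integral>x. \<theta> (v x) \<partial>\<sigma>) + e * measure \<sigma> (space \<sigma>)"
    using surf_integrable[OF C(1)] by simp
  also have "(\<integral>x. \<theta> (v x) \<partial>\<sigma>) \<le> ?A + ?B"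
  proof -
    let ?k = "\<lambda>x. indicator {x. g x < r} x * (\<theta> (v x) * h x - R (gradient (\<lambda>x. \<theta> (v x)) x) \<bullet> \<Psi> x)"
    have "(\<integral>x. \<theta> (v x) \<partial>\<sigma>) = - (\<integral>x. ?k x \<partial>\<nu>)" by (rule Cb1_surface_integral[OF d C(1)])
    also have "\<dots> \<le> norm (\<integral>x. ?k x \<partial>\<nu>)" by simp
    also have "\<dots> \<le> (\<integral>x. norm (v x) * norm (h x) + norm (R_grad v x) * norm (\<Psi> x) \<partial>\<nu>)"
    proof (rule norm_integral_le)
      show "integrable \<nu> (\<lambda>x. norm (v x) * norm (h x) + norm (R_grad v x) * norm (\<Psi> x))"
        using i1 i2 by auto
      have k: "norm (?k x) \<le> norm (v x) * norm (h x) + norm (R_grad v x) * norm (\<Psi> x)" for x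
      proof -
        let ?a = "\<theta> (v x) * h x" and ?b = "R (gradient (\<lambda>x. \<theta> (v x)) x) \<bullet> \<Psi> x"
        have "norm (?k x) \<le> 1 * norm (?a - ?b)"
          unfolding norm_mult by (intro mult_right_mono) (auto simp: indicator_def)
        moreover have "norm (?a - ?b) \<le> norm ?a + norm ?b" by (rule norm_triangle_ineq4)
        moreover have "norm ?a \<le> norm (v x) * norm (h x)"
          unfolding norm_mult using b[of "v x"] by (intro mult_right_mono) auto
        moreover have "norm ?b \<le> norm (R_grad v x) * norm (\<Psi> x)"
        proof -
          have eq: "?b = \<theta>' (v x) * (R_grad v x \<bullet> \<Psi> x)"
            unfolding C(2) by (simp add: R_scale)
          have "norm ?b \<le> 1 * \<bar>R_grad v x \<bullet> \<Psi> x\<bar>"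
            unfolding eq real_norm_def abs_mult using b'[of "v x"] by (intro mult_right_mono) auto
          thus ?thesis using Cauchy_Schwarz_ineq2[of "R_grad v x" "\<Psi> x"] by linarith
        qed
        ultimately show ?thesis by linarith
      qed
      show "norm (?k x) \<le> norm (v x) * norm (h x) + norm (R_grad v x) * norm (\<Psi> x)" for x
        by (rule k)
      have iD: "integrable \<nu> (\<lambda>x. \<theta> (v x) * h x - R (gradient (\<lambda>x. \<theta> (v x)) x) \<bullet> \<Psi> x)"
        by (intro Bochner_Integration.integrable_diff dual_field_integrable(1)[OF d Cb1_lp(1)[OF C(1) p(2)]]
            dual_field_integrable(2)[OF d Cb1_lp(2)[OF C(1) p(2)]])
      show "integrable \<nu> ?k"
      proof (rule Bochner_Integration.integrable_bound[OF iD])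
        note [measurable] = borel_measurable_integrable[OF iD] sublevel_measurable
        show "?k \<in> borel_measurable \<nu>" by measurable
      qed (auto simp: indicator_def)
    qed
    also have "\<dots> = ?A + ?B" using i1 i2 by simp
    finally show ?thesis .
  qed
  finally show "(\<integral>x. \<bar>v x\<bar> \<partial>\<sigma>) \<le> ?A + ?B + e0" using em by simp
qed

lemma surface_L1_small:
  assumes p: "p > 1" and e: "e > 0"
  shows "\<exists>d>0. \<forall>v\<in>Cb1. (\<integral>x. norm (v x) powr p \<partial>\<nu>) < d \<longrightarrow> (\<integral>x. norm (R_grad v x) powr p \<partial>\<nu>) < d \<longrightarrow>
     (\<integral>x. \<bar>v x\<bar> \<partial>\<sigma>) < e"
proof -
  obtain h where d: "dual_field p \<Psi> h" using dual[OF p] by blast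
  have lp: "h \<in> lp_space \<nu> (p / (p - 1))" "\<Psi> \<in> lp_space \<nu> (p / (p - 1))" using d by (auto simp: dual_field_def)
  have e2: "e / 2 > 0" and p0: "p > 0" using e p by auto
  obtain d1 where d1: "d1 > 0" "\<And>f::'a \<Rightarrow> real. f \<in> lp_space \<nu> p \<Longrightarrow> (\<integral>x. norm (f x) powr p \<partial>\<nu>) < d1 \<Longrightarrow>
      (\<integral>x. norm (f x) * norm (h x) \<partial>\<nu>) < e / 2"
    using lp_mult_small[OF lp(1) p e2, where 'b = real] by blast
  obtain d2 where d2: "d2 > 0" "\<And>f::'a \<Rightarrow> 'a. f \<in> lp_space \<nu> p \<Longrightarrow> (\<integral>x. norm (f x) powr p \<partial>\<nu>) < d2 \<Longrightarrow>
      (\<integral>x. norm (f x) * norm (\<Psi> x) \<partial>\<nu>) < e / 2"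
    using lp_mult_small[OF lp(2) p e2, where 'b = 'a] by blast
  have "(\<integral>x. \<bar>v x\<bar> \<partial>\<sigma>) < e" if v: "v \<in> Cb1" and "(\<integral>x. norm (v x) powr p \<partial>\<nu>) < min d1 d2"
    "(\<integral>x. norm (R_grad v x) powr p \<partial>\<nu>) < min d1 d2" for v
    using surface_abs_le[OF d v] d1(2)[OF Cb1_lp(1)[OF v p0]] d2(2)[OF Cb1_lp(2)[OF v p0]] that by linarith
  thus ?thesis using d1(1) d2(1) by (intro exI[of _ "min d1 d2"]) auto
qed

lemma R_gradient_diff:
  assumes "v \<in> Cb1" "w \<in> Cb1"
  shows "R_grad (\<lambda>x. v x - w x) x = R_grad v x - R_grad w x"
  using assms by (simp add: Cb1_diff R_diff)

lemma surface_L1_Cauchy: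
  assumes p: "p > 1" and v: "\<And>n. v n \<in> Cb1"
    and f: "lp_conv \<nu> p v f" and F: "lp_conv \<nu> p (\<lambda>n. R_grad (v n)) F" and e: "e > 0"
  shows "\<exists>N. \<forall>m\<ge>N. \<forall>n\<ge>N. (\<integral>x. \<bar>v m x - v n x\<bar> \<partial>\<sigma>) < e"
proof -
  have p0: "p > 0" using p by simp
  obtain d where d: "d > 0" "\<And>v. v \<in> Cb1 \<Longrightarrow> (\<integral>x. norm (v x) powr p \<partial>\<nu>) < d \<Longrightarrow>
      (\<integral>x. norm (R_grad v x) powr p \<partial>\<nu>) < d \<Longrightarrow> (\<integral>x. \<bar>v x\<bar> \<partial>\<sigma>) < e"
    using surface_L1_small[OF p e] by blast
  obtain N1 where N1: "\<forall>m\<ge>N1. \<forall>n\<ge>N1. (\<integral>x. norm (v m x - v n x) powr p \<partial>\<nu>) < d"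
    using lp_conv_imp_Cauchy[OF f p0 d(1)] by blast
  obtain N2 where N2: "\<forall>m\<ge>N2. \<forall>n\<ge>N2. (\<integral>x. norm (R_grad (v m) x - R_grad (v n) x) powr p \<partial>\<nu>) < d"
    using lp_conv_imp_Cauchy[OF F p0 d(1)] by blast
  have "(\<integral>x. \<bar>v m x - v n x\<bar> \<partial>\<sigma>) < e" if "m \<ge> max N1 N2" "n \<ge> max N1 N2" for m n
    by (rule d(2)[OF Cb1_diff(1)[OF v v]]) (use N1 N2 that in \<open>auto simp: R_gradient_diff[OF v v]\<close>)
  thus ?thesis by blast
qed

lemma surface_L1_diff_tendsto_0:
  assumes p: "p > 1" and v: "\<And>n. v n \<in> Cb1" and w: "\<And>n. w n \<in> Cb1"
    and f: "lp_conv \<nu> p v f" "lp_conv \<nu> p w f"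
    and F: "lp_conv \<nu> p (\<lambda>n. R_grad (v n)) F" "lp_conv \<nu> p (\<lambda>n. R_grad (w n)) F"
  shows "(\<lambda>n. \<integral>x. \<bar>v n x - w n x\<bar> \<partial>\<sigma>) \<longlonglongrightarrow> 0"
proof (rule LIMSEQ_I)
  fix e :: real assume e: "e > 0"
  have p0: "p > 0" using p by simp
  obtain d where d: "d > 0" "\<And>v. v \<in> Cb1 \<Longrightarrow> (\<integral>x. norm (v x) powr p \<partial>\<nu>) < d \<Longrightarrow>
      (\<integral>x. norm (R_grad v x) powr p \<partial>\<nu>) < d \<Longrightarrow> (\<integral>x. \<bar>v x\<bar> \<partial>\<sigma>) < e"
    using surface_L1_small[OF p e] by blast
  have 1: "(\<lambda>n. \<integral>x. norm (v n x - w n x) powr p \<partial>\<nu>) \<longlonglongrightarrow> 0"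
    using lp_convD(7)[OF lp_conv_diff[OF f p0] p0] by simp
  have 2: "(\<lambda>n. \<integral>x. norm (R_grad (v n) x - R_grad (w n) x) powr p \<partial>\<nu>) \<longlonglongrightarrow> 0"
    using lp_convD(7)[OF lp_conv_diff[OF F p0] p0] by simp
  have "\<forall>\<^sub>F n in sequentially. (\<integral>x. \<bar>v n x - w n x\<bar> \<partial>\<sigma>) < e"
    using order_tendstoD(2)[OF 1 d(1)] order_tendstoD(2)[OF 2 d(1)]
  proof eventually_elim
    case (elim n)
    show ?case by (rule d(2)[OF Cb1_diff(1)[OF v w]]) (use elim in \<open>auto simp: R_gradient_diff[OF v w]\<close>)
  qed
  thus "\<exists>no. \<forall>n\<ge>no. norm ((\<integral>x. \<bar>v n x - w n x\<bar> \<partial>\<sigma>) - 0) < e"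
    by (auto simp: eventually_sequentially)
qed

end

context closable_gradient
begin

lemma sobolev_norm_tendsto_iff:
  assumes f: "in_graph p f F" and p: "p > 1" and v: "\<And>n. v n \<in> Cb1"
  shows "(\<lambda>n. sobolev_norm \<nu> R p (\<lambda>x. v n x - f x)) \<longlonglongrightarrow> 0 \<longleftrightarrow>
    lp_conv \<nu> p v f \<and> lp_conv \<nu> p (\<lambda>n. R_grad (v n)) F"
proof -
  have p0: "p > 0" using p by simp
  let ?a = "\<lambda>n. lp_norm \<nu> p (\<lambda>x. v n x - f x)" and ?b = "\<lambda>n. lp_norm \<nu> p (\<lambda>x. R_grad (v n) x - F x)"
  have "lp_norm \<nu> p (sobolev_grad \<nu> R p (\<lambda>x. v n x - f x)) = ?b n" for n
  proof -
    have c: "in_graph p (\<lambda>x. v n x - f x) (\<lambda>x. R_grad (v n) x - F x)"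
      by (rule grad_closure_diff[OF grad_closure_Cb1[OF v p0] f p0])
    have c': "in_graph p (\<lambda>x. v n x - f x) (sobolev_grad \<nu> R p (\<lambda>x. v n x - f x))"
      unfolding sobolev_grad_def using c by (rule someI[of "in_graph p (\<lambda>x. v n x - f x)"])
    note [measurable] = grad_closure_lp(4)[OF c] grad_closure_lp(4)[OF c']
    have "(\<integral>x. norm (sobolev_grad \<nu> R p (\<lambda>x. v n x - f x) x) powr p \<partial>\<nu>)
        = (\<integral>x. norm (R_grad (v n) x - F x) powr p \<partial>\<nu>)"
      by (rule integral_cong_AE) (use sobolev_grad_AE[OF c p] in auto)
    thus ?thesis by (simp add: lp_norm_def)
  qed
  hence eq: "sobolev_norm \<nu> R p (\<lambda>x. v n x - f x) = ?a n + ?b n" for n by (simp add: sobolev_norm_def)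
  have nn: "?a n \<ge> 0" "?b n \<ge> 0" for n by (auto simp: lp_norm_def)
  have "(\<lambda>n. ?a n + ?b n) \<longlonglongrightarrow> 0 \<longleftrightarrow> ?a \<longlonglongrightarrow> 0 \<and> ?b \<longlonglongrightarrow> 0"
  proof
    assume L: "(\<lambda>n. ?a n + ?b n) \<longlonglongrightarrow> 0"
    have "?a \<longlonglongrightarrow> 0" by (rule tendsto_sandwich[OF _ _ tendsto_const L]) (use nn in \<open>auto intro!: always_eventually\<close>)
    moreover have "?b \<longlonglongrightarrow> 0" by (rule tendsto_sandwich[OF _ _ tendsto_const L]) (use nn in \<open>auto intro!: always_eventually\<close>)
    ultimately show "?a \<longlonglongrightarrow> 0 \<and> ?b \<longlonglongrightarrow> 0" ..
  qed (use tendsto_add[of ?a 0 _ ?b 0] in simp)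
  also have "\<dots> \<longleftrightarrow> lp_conv \<nu> p v f \<and> lp_conv \<nu> p (\<lambda>n. R_grad (v n)) F"
    unfolding lp_norm_tendsto_iff[OF p0]
    using Cb1_lp(1)[OF v p0] Cb1_lp(2)[OF v p0] grad_closure_lp(1,2)[OF f] by (simp add: lp_conv_def)
  finally show ?thesis unfolding eq .
qed

end

context level_function
begin

text \<open>The smooth approximations for one exponent \<open>p\<close> are Cauchy in \<open>L\<^sup>1(\<sigma>)\<close>. A sequence that approximates
  \<open>f\<close> for another exponent \<open>q\<close> has the same limit because both sequences converge to \<open>f\<close> in
  \<open>W\<^bsup>1,m\<^esup>\<close>, \<open>m = min p q\<close>.\<close>

lemma trace_exists:
  assumes f: "f \<in> sobolev \<nu> R p" and p: "p > 1"
  shows "\<exists>u. is_trace \<nu> R \<sigma> f u"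
proof -
  have p0: "p > 0" using p by simp
  obtain F where F: "in_graph p f F" using f by (auto simp: sobolev_def)
  obtain v where v: "\<And>n. v n \<in> Cb1" "lp_conv \<nu> p v f" "lp_conv \<nu> p (\<lambda>n. R_grad (v n)) F"
    using grad_closureE[OF F p0] by blast
  obtain u where u: "integrable \<sigma> u" and lim: "(\<lambda>n. \<integral>x. \<bar>v n x - u x\<bar> \<partial>\<sigma>) \<longlonglongrightarrow> 0"
    using L1_complete[of \<sigma> v, OF surf_integrable[OF v(1)] surface_L1_Cauchy[OF p v]] by blast
  have "(\<lambda>n. \<integral>x. \<bar>w n x - u x\<bar> \<partial>\<sigma>) \<longlonglongrightarrow> 0"
    if q: "q > 1" and fq: "f \<in> sobolev \<nu> R q" and w: "\<And>n. w n \<in> Cb1"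
      and wl: "(\<lambda>n. sobolev_norm \<nu> R q (\<lambda>x. w n x - f x)) \<longlonglongrightarrow> 0" for q w
  proof -
    obtain F' where F': "in_graph q f F'" using fq by (auto simp: sobolev_def)
    have w': "lp_conv \<nu> q w f" "lp_conv \<nu> q (\<lambda>n. R_grad (w n)) F'"
      using wl sobolev_norm_tendsto_iff[OF F' q w] by auto
    define m where "m = min p q"
    have m: "m > 1" "m > 0" "m \<le> p" "m \<le> q" using p q by (auto simp: m_def)
    have "AE x in \<nu>. F x = F' x"
      by (rule grad_closure_unique[OF grad_closure_mono[OF F m(2,3)] grad_closure_mono[OF F' m(2,4)] m(1)])
    hence vF': "lp_conv \<nu> m (\<lambda>n. R_grad (v n)) F'"
      by (intro lp_conv_cong_AE[OF lp_conv_mono[OF v(3) finite_measure_axioms m(2,3)] grad_closure_lp(4)[OF F'] _ m(2)])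
         auto
    have "(\<lambda>n. \<integral>x. \<bar>w n x - v n x\<bar> \<partial>\<sigma>) \<longlonglongrightarrow> 0"
      by (rule surface_L1_diff_tendsto_0[OF m(1) w v(1) lp_conv_mono[OF w'(1) finite_measure_axioms m(2,4)]
            lp_conv_mono[OF v(2) finite_measure_axioms m(2,3)] lp_conv_mono[OF w'(2) finite_measure_axioms m(2,4)] vF'])
    from tendsto_add_zero[OF this lim]
    have L: "(\<lambda>n. (\<integral>x. \<bar>w n x - v n x\<bar> \<partial>\<sigma>) + (\<integral>x. \<bar>v n x - u x\<bar> \<partial>\<sigma>)) \<longlonglongrightarrow> 0" .
    show ?thesis
    proof (rule tendsto_sandwich[OF _ _ tendsto_const L])
      show "\<forall>\<^sub>F n in sequentially. (\<integral>x. \<bar>w n x - u x\<bar> \<partial>\<sigma>)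
          \<le> (\<integral>x. \<bar>w n x - v n x\<bar> \<partial>\<sigma>) + (\<integral>x. \<bar>v n x - u x\<bar> \<partial>\<sigma>)"
      proof (intro always_eventually allI)
        fix n
        note i = surf_integrable[OF w[of n]] surf_integrable[OF v(1)[of n]] u
        have "(\<integral>x. \<bar>w n x - u x\<bar> \<partial>\<sigma>) \<le> (\<integral>x. \<bar>w n x - v n x\<bar> + \<bar>v n x - u x\<bar> \<partial>\<sigma>)"
          using i by (intro integral_mono) auto
        thus "(\<integral>x. \<bar>w n x - u x\<bar> \<partial>\<sigma>) \<le> (\<integral>x. \<bar>w n x - v n x\<bar> \<partial>\<sigma>) + (\<integral>x. \<bar>v n x - u x\<bar> \<partial>\<sigma>)"
          using i by simp
      qed
    qed auto
  qed
  hence "is_trace \<nu> R \<sigma> f u" using u unfolding is_trace_def by blast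
  thus ?thesis by blast
qed

lemma sobolev_trace_is_trace:
  assumes "f \<in> sobolev \<nu> R p" "p > 1"
  shows "is_trace \<nu> R \<sigma> f (sobolev_trace \<nu> R \<sigma> f)"
  using someI_ex[OF trace_exists[OF assms]] by (simp add: sobolev_trace_def)

lemma is_trace_tendsto:
  assumes u: "is_trace \<nu> R \<sigma> f u" and F: "in_graph p f F" and p: "p > 1"
    and v: "\<And>n. v n \<in> Cb1" "lp_conv \<nu> p v f" "lp_conv \<nu> p (\<lambda>n. R_grad (v n)) F"
  shows "(\<lambda>n. \<integral>x. \<bar>v n x - u x\<bar> \<partial>\<sigma>) \<longlonglongrightarrow> 0"
proof -
  have "(\<lambda>n. sobolev_norm \<nu> R p (\<lambda>x. v n x - f x)) \<longlonglongrightarrow> 0"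
    using sobolev_norm_tendsto_iff[OF F p v(1)] v(2,3) by simp
  moreover have "f \<in> sobolev \<nu> R p" using F by (auto simp: sobolev_def)
  ultimately show ?thesis using u p v(1) unfolding is_trace_def by blast
qed

text \<open>With \<open>\<beta> t = (max 0 (- t))\<^sup>2 / 2\<close> and smooth \<open>v n\<close> approximating \<open>f\<close>, the functions \<open>\<beta> (v n)\<close> tend to
  \<open>0\<close> in \<open>W\<^bsup>1,p\<^esup>\<close>, since \<open>\<bar>min 0 (v n)\<bar> \<le> \<bar>v n - f\<bar>\<close>. Hence their surface integrals tend to \<open>0\<close>, while
  \<open>v n\<close> tends to the trace \<open>u\<close>; so \<open>\<beta> u = 0\<close>.\<close>

lemma trace_nonneg:
  assumes u: "is_trace \<nu> R \<sigma> f u" and F: "in_graph (2 * p) f F" and p: "p > 1"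
    and nonneg: "\<And>x. f x \<ge> 0"
  shows "AE x in \<sigma>. u x \<ge> 0"
proof -
  have p': "p > 0" "2 * p > 1" "2 * p > 0" using p by auto
  obtain v where v: "\<And>n. v n \<in> Cb1" "lp_conv \<nu> (2 * p) v f" "lp_conv \<nu> (2 * p) (\<lambda>n. R_grad (v n)) F"
    using grad_closureE[OF F p'(3)] by blast
  define \<beta> where "\<beta> = (\<lambda>t. half_square (- t))"
  define \<beta>' where "\<beta>' = (\<lambda>t::real. - max 0 (- t))"
  have der: "(\<beta> has_real_derivative \<beta>' t) (at t)" for t
  proof -
    have "((\<lambda>s. half_square (- s)) has_real_derivative max 0 (- t) * (- 1)) (at t)"
      by (rule DERIV_chain2[where f = half_square and g = uminus]) (auto intro: half_square_deriv derivative_eq_intros)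
    thus ?thesis by (simp add: \<beta>_def \<beta>'_def)
  qed
  have cont: "continuous_on UNIV \<beta>'" unfolding \<beta>'_def by (intro continuous_intros)
  note C = Cb1_compose_C1[OF v(1) der cont]
  have vm[measurable]: "v n \<in> borel_measurable \<nu>" for n by (rule lp_convD(3)[OF v(2) p'(3)])
  note [measurable] = lp_convD(4)[OF v(2) p'(3)]
  have neg: "max 0 (- v n x) \<le> \<bar>v n x - f x\<bar>" for n x using nonneg[of x] by auto
  note D = lp_conv_norm_diff[OF v(2) p'(3)]
  have 1: "lp_conv \<nu> (2 * p) (\<lambda>n x. - max 0 (- v n x)) (\<lambda>_. 0)"
  proof (rule lp_conv_squeeze[OF _ _ p'(3) D])
    show "AE x in \<nu>. norm (- max 0 (- v n x) - 0) \<le> norm (v n x - f x)" for n using neg by simp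
    show "(\<lambda>x. - max 0 (- v n x)) \<in> lp_space \<nu> (2 * p)" for n
      by (rule lp_space_bound[OF lp_convD(5)[OF v(2) p'(3)] _ p'(3)]) (use neg in auto)
    show "(\<lambda>_. 0) \<in> lp_space \<nu> (2 * p)" using p'(3) by (simp add: lp_space_def)
  qed
  have "lp_conv \<nu> p (\<lambda>n x. (- max 0 (- v n x)) *\<^sub>R (- max 0 (- v n x))) (\<lambda>x. 0 *\<^sub>R 0)"
    by (rule lp_conv_mult[OF 1 1 p'(1)])
  from lp_conv_scaleR[OF this p'(1), of "1/2"]
  have \<beta>0: "lp_conv \<nu> p (\<lambda>n x. \<beta> (v n x)) (\<lambda>_. 0)"
    by (simp add: \<beta>_def half_square_def power2_eq_square)
  have "lp_conv \<nu> p (\<lambda>n x. (- max 0 (- v n x)) *\<^sub>R R_grad (v n) x) (\<lambda>x. 0 *\<^sub>R F x)"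
    by (rule lp_conv_mult[OF 1 v(3) p'(1)])
  hence \<beta>1: "lp_conv \<nu> p (\<lambda>n x. R (gradient (\<lambda>x. \<beta> (v n x)) x)) (\<lambda>_. 0)"
    unfolding C(2) by (simp only: \<beta>'_def R_scale scaleR_zero_left)
  obtain h where d: "dual_field p \<Psi> h" using dual[OF p] by blast
  have "(\<lambda>n. \<integral>x. \<beta> (v n x) \<partial>\<sigma>) \<longlonglongrightarrow> 0"
    using surface_integral_tendsto[OF d C(1) \<beta>0 \<beta>1] by simp
  moreover have "norm (\<beta> t) = \<beta> t" for t by (simp add: \<beta>_def half_square_def)
  ultimately have L1: "(\<lambda>n. \<integral>x. norm (\<beta> (v n x)) \<partial>\<sigma>) \<longlonglongrightarrow> 0" by simp
  have L2: "(\<lambda>n. \<integral>x. norm (v n x - u x) \<partial>\<sigma>) \<longlonglongrightarrow> 0"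
    using is_trace_tendsto[OF u F p'(2) v] by simp
  have ui: "integrable \<sigma> u" using u by (simp add: is_trace_def)
  obtain s where s: "strict_mono s" "AE x in \<sigma>. (\<lambda>n. v (s n) x - u x) \<longlonglongrightarrow> 0"
    using tendsto_L1_AE_subseq[of \<sigma> "\<lambda>n x. v n x - u x", OF _ L2] surf_integrable[OF v(1)] ui by auto
  have "(\<lambda>n. \<integral>x. norm (\<beta> (v (s n) x)) \<partial>\<sigma>) \<longlonglongrightarrow> 0"
    using LIMSEQ_subseq_LIMSEQ[OF L1 s(1)] by (simp add: o_def)
  then obtain s' where s': "strict_mono s'" "AE x in \<sigma>. (\<lambda>n. \<beta> (v (s (s' n)) x)) \<longlonglongrightarrow> 0"
    using tendsto_L1_AE_subseq[of \<sigma> "\<lambda>n x. \<beta> (v (s n) x)"] surf_integrable[OF C(1)] by auto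
  show ?thesis
    using s(2) s'(2)
  proof eventually_elim
    fix x assume a: "(\<lambda>n. v (s n) x - u x) \<longlonglongrightarrow> 0" and b: "(\<lambda>n. \<beta> (v (s (s' n)) x)) \<longlonglongrightarrow> 0"
    have "(\<lambda>n. v (s n) x) \<longlonglongrightarrow> u x" using a by (rule LIM_zero_cancel)
    hence "(\<lambda>n. v (s (s' n)) x) \<longlonglongrightarrow> u x" using LIMSEQ_subseq_LIMSEQ[OF _ s'(1)] by (fastforce simp: o_def)
    hence "(\<lambda>n. \<beta> (v (s (s' n)) x)) \<longlonglongrightarrow> \<beta> (u x)"
      by (rule isCont_tendsto_compose[OF DERIV_isCont[OF der]])
    with b have "\<beta> (u x) = 0" using LIMSEQ_unique by blast
    thus "u x \<ge> 0" by (auto simp: \<beta>_def half_square_def max_def split: if_splits)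
  qed
qed

lemma lp_conv_Cb1_mult:
  assumes \<phi>: "\<phi> \<in> Cb1" and q: "q > 0"
    and v: "\<And>n. v n \<in> Cb1" "lp_conv \<nu> q v f" "lp_conv \<nu> q (\<lambda>n. R_grad (v n)) F"
  shows "lp_conv \<nu> q (\<lambda>n x. \<phi> x * v n x) (\<lambda>x. \<phi> x * f x)"
    and "lp_conv \<nu> q (\<lambda>n x. R_grad (\<lambda>x. \<phi> x * v n x) x) (\<lambda>x. \<phi> x *\<^sub>R F x + f x *\<^sub>R R_grad \<phi> x)"
proof -
  obtain B C where B: "\<And>x. \<bar>\<phi> x\<bar> \<le> B" "\<And>x. norm (gradient \<phi> x) \<le> C" "B \<ge> 0" "C \<ge> 0"
    by (rule Cb1_bounds[OF \<phi>]) (rule that)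
  obtain K where K: "\<And>x. norm (R x) \<le> norm x * K" "K \<ge> 0"
    using bounded_linear.nonneg_bounded[OF R] by blast
  have Rb: "norm (R_grad \<phi> x) \<le> C * K" for x
    using K(1)[of "gradient \<phi> x"] mult_right_mono[OF B(2)[of x] K(2)] by linarith
  note [measurable] = continuous_measurable[OF Cb1D(3)[OF \<phi>]] lp_space_measurable[OF Cb1_lp(2)[OF \<phi> q]]
    lp_convD(3)[OF v(2) q] lp_convD(4)[OF v(2) q]
  have m: "lp_conv \<nu> q (\<lambda>n x. \<phi> x *\<^sub>R H n x) (\<lambda>x. \<phi> x *\<^sub>R H' x)" if "lp_conv \<nu> q H H'"
    for H and H' :: "'a \<Rightarrow> 'b::{real_normed_vector, second_countable_topology}"
    by (rule lp_conv_coeff[OF that q, where L = B]) (use B in auto)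
  show "lp_conv \<nu> q (\<lambda>n x. \<phi> x * v n x) (\<lambda>x. \<phi> x * f x)" using m[OF v(2)] by simp
  have b: "(\<lambda>x. k x *\<^sub>R R_grad \<phi> x) \<in> lp_space \<nu> q" if k: "k \<in> lp_space \<nu> q" for k :: "'a \<Rightarrow> real"
  proof (rule lp_space_bound[OF lp_space_scaleR[OF k, of "C * K"] _ q])
    note [measurable] = lp_space_measurable[OF k]
    show "(\<lambda>x. k x *\<^sub>R R_grad \<phi> x) \<in> borel_measurable \<nu>" by measurable
    show "AE x in \<nu>. norm (k x *\<^sub>R R_grad \<phi> x) \<le> norm ((C * K) *\<^sub>R k x)"
    proof (rule AE_I2)
      fix x
      have "\<bar>k x\<bar> * norm (R_grad \<phi> x) \<le> \<bar>k x\<bar> * (C * K)" by (intro mult_left_mono Rb) simp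
      thus "norm (k x *\<^sub>R R_grad \<phi> x) \<le> norm ((C * K) *\<^sub>R k x)"
        using B(4) K(2) by (simp add: abs_mult mult.commute)
    qed
  qed
  have 2: "lp_conv \<nu> q (\<lambda>n x. v n x *\<^sub>R R_grad \<phi> x) (\<lambda>x. f x *\<^sub>R R_grad \<phi> x)"
  proof (rule lp_conv_squeeze[where K = "\<lambda>n x. (C * K) *\<^sub>R norm (v n x - f x)", OF b[OF lp_convD(1)[OF v(2) q]] b[OF lp_convD(2)[OF v(2) q]] q])
    show "lp_conv \<nu> q (\<lambda>n x. (C * K) *\<^sub>R norm (v n x - f x)) (\<lambda>_. 0)"
      using lp_conv_scaleR[OF lp_conv_norm_diff[OF v(2) q] q, of "C * K"] by simp
    show "AE x in \<nu>. norm (v n x *\<^sub>R R_grad \<phi> x - f x *\<^sub>R R_grad \<phi> x) \<le> (C * K) *\<^sub>R norm (v n x - f x)" for n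
    proof (rule AE_I2)
      fix x
      have "\<bar>v n x - f x\<bar> * norm (R_grad \<phi> x) \<le> \<bar>v n x - f x\<bar> * (C * K)" by (intro mult_left_mono Rb) simp
      thus "norm (v n x *\<^sub>R R_grad \<phi> x - f x *\<^sub>R R_grad \<phi> x) \<le> (C * K) *\<^sub>R norm (v n x - f x)"
        by (simp add: mult.commute flip: scaleR_diff_left)
    qed
  qed
  show "lp_conv \<nu> q (\<lambda>n x. R_grad (\<lambda>x. \<phi> x * v n x) x) (\<lambda>x. \<phi> x *\<^sub>R F x + f x *\<^sub>R R_grad \<phi> x)"
    using lp_conv_add[OF m[OF v(3)] 2 q]
    by (simp add: Cb1_mult[OF \<phi> v(1)] R_add R_scale)
qed

lemma grad_closure_Cb1_mult:
  assumes \<phi>: "\<phi> \<in> Cb1" and q: "q > 0" and f: "in_graph q f F"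
  shows "in_graph q (\<lambda>x. \<phi> x * f x) (\<lambda>x. \<phi> x *\<^sub>R F x + f x *\<^sub>R R_grad \<phi> x)"
proof -
  obtain v where v: "\<And>n. v n \<in> Cb1" "lp_conv \<nu> q v f" "lp_conv \<nu> q (\<lambda>n. R_grad (v n)) F"
    using grad_closureE[OF f q] by blast
  show ?thesis by (rule grad_closureI[OF Cb1_mult(1)[OF \<phi> v(1)] lp_conv_Cb1_mult[OF \<phi> q v] q])
qed

lemma trace_integral:
  assumes u: "is_trace \<nu> R \<sigma> f u" and F: "in_graph (2 * p) f F"
    and d: "dual_field p \<Psi> h" and \<phi>: "\<phi> \<in> Cb1"
  shows "(\<integral>x. \<phi> x * u x \<partial>\<sigma>) =
    - (\<integral>x. indicator {x. g x < r} x * (\<phi> x * f x * h x - (\<phi> x *\<^sub>R F x + f x *\<^sub>R R_grad \<phi> x) \<bullet> \<Psi> x) \<partial>\<nu>)"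
proof -
  have p: "p > 1" "p > 0" "2 * p > 0" "2 * p > 1" "p \<le> 2 * p" using dual_field_integrable(5)[OF d] by auto
  obtain v where v: "\<And>n. v n \<in> Cb1" "lp_conv \<nu> (2 * p) v f" "lp_conv \<nu> (2 * p) (\<lambda>n. R_grad (v n)) F"
    using grad_closureE[OF F p(3)] by blast
  note vp = lp_conv_mono[OF v(2) finite_measure_axioms p(2,5)] lp_conv_mono[OF v(3) finite_measure_axioms p(2,5)]
  have A: "(\<lambda>n. \<integral>x. \<phi> x * v n x \<partial>\<sigma>) \<longlonglongrightarrow>
     - (\<integral>x. indicator {x. g x < r} x * (\<phi> x * f x * h x - (\<phi> x *\<^sub>R F x + f x *\<^sub>R R_grad \<phi> x) \<bullet> \<Psi> x) \<partial>\<nu>)"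
    by (rule surface_integral_tendsto[OF d Cb1_mult(1)[OF \<phi> v(1)] lp_conv_Cb1_mult[OF \<phi> p(2) v(1) vp]])
  obtain B C where B: "\<And>x. \<bar>\<phi> x\<bar> \<le> B" "\<And>x. norm (gradient \<phi> x) \<le> C" "B \<ge> 0" "C \<ge> 0"
    by (rule Cb1_bounds[OF \<phi>]) (rule that)
  have L: "(\<lambda>n. B * (\<integral>x. \<bar>v n x - u x\<bar> \<partial>\<sigma>)) \<longlonglongrightarrow> 0"
    using tendsto_mult_right_zero[OF is_trace_tendsto[OF u F p(4) v]] .
  have ui: "integrable \<sigma> u" using u by (simp add: is_trace_def)
  have \<phi>u: "integrable \<sigma> (\<lambda>x. \<phi> x * k x)" if k: "integrable \<sigma> k" for k
  proof (rule Bochner_Integration.integrable_bound[OF integrable_mult_right[OF k, of B]])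
    note [measurable] = borel_measurable_integrable[OF k] surf_measurable[OF Cb1D(3)[OF \<phi>]]
    show "(\<lambda>x. \<phi> x * k x) \<in> borel_measurable \<sigma>" by measurable
    show "AE x in \<sigma>. norm (\<phi> x * k x) \<le> norm (B * k x)"
      using B by (auto simp: abs_mult intro!: mult_right_mono)
  qed
  have "(\<lambda>n. (\<integral>x. \<phi> x * v n x \<partial>\<sigma>) - (\<integral>x. \<phi> x * u x \<partial>\<sigma>)) \<longlonglongrightarrow> 0"
  proof (rule Lim_null_comparison[OF _ L], intro always_eventually allI)
    fix n
    note i = \<phi>u[OF surf_integrable[OF v(1)[of n]]] \<phi>u[OF ui]
    have "norm (\<integral>x. \<phi> x * v n x - \<phi> x * u x \<partial>\<sigma>) \<le> (\<integral>x. B * \<bar>v n x - u x\<bar> \<partial>\<sigma>)"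
    proof (rule norm_integral_le[OF Bochner_Integration.integrable_diff[OF i]])
      show "integrable \<sigma> (\<lambda>x. B * \<bar>v n x - u x\<bar>)" using surf_integrable[OF v(1)[of n]] ui by auto
      show "norm (\<phi> x * v n x - \<phi> x * u x) \<le> B * \<bar>v n x - u x\<bar>" for x
        using B(1)[of x] by (simp add: abs_mult mult_right_mono flip: right_diff_distrib)
    qed
    thus "norm ((\<integral>x. \<phi> x * v n x \<partial>\<sigma>) - (\<integral>x. \<phi> x * u x \<partial>\<sigma>)) \<le> B * (\<integral>x. \<bar>v n x - u x\<bar> \<partial>\<sigma>)"
      unfolding Bochner_Integration.integral_diff[OF i] by simp
  qed
  hence "(\<lambda>n. \<integral>x. \<phi> x * v n x \<partial>\<sigma>) \<longlonglongrightarrow> (\<integral>x. \<phi> x * u x \<partial>\<sigma>)" by (rule LIM_zero_cancel)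
  thus ?thesis using A by (rule LIMSEQ_unique)
qed

end

section \<open>Separation of measures\<close>

lemma Cb1_ball:
  fixes a :: "'a::real_inner"
  shows "\<exists>\<phi>\<in>Cb1. (\<forall>x. \<phi> x \<ge> 0) \<and> {x. \<phi> x > 0} = ball a s"
proof (cases "s > 0")
  case False
  have "(\<lambda>_::'a. 0::real) \<in> Cb1" by (rule Cb1_const)
  thus ?thesis using False by (intro bexI[of _ "\<lambda>_. 0"] conjI) (simp_all add: ball_empty not_less)
next
  case s: True
  define q where "q = (\<lambda>x. s\<^sup>2 - (x - a) \<bullet> (x - a))"
  define D where "D = (\<lambda>x. max 0 (q x) *\<^sub>R ((- 2) *\<^sub>R (x - a)))"
  have q: "q x > 0 \<longleftrightarrow> x \<in> ball a s" for x
  proof -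
    have "q x > 0 \<longleftrightarrow> (norm (x - a))\<^sup>2 < s\<^sup>2" by (simp add: q_def power2_norm_eq_inner)
    also have "\<dots> \<longleftrightarrow> norm (x - a) < s" 
    proof
      assume "(norm (x - a))\<^sup>2 < s\<^sup>2" thus "norm (x - a) < s" by (rule power2_less_imp_less) (use s in simp)
    next
      assume "norm (x - a) < s" thus "(norm (x - a))\<^sup>2 < s\<^sup>2" by (intro power_strict_mono) auto
    qed
    finally show ?thesis by (simp add: dist_norm norm_minus_commute)
  qed
  have qs: "q x \<le> s\<^sup>2" for x by (simp add: q_def)
  have gq: "GDERIV q x :> (- 2) *\<^sub>R (x - a)" for x
    unfolding gderiv_def q_def
    by (auto intro!: derivative_eq_intros simp: fun_eq_iff inner_commute algebra_simps inner_diff_left inner_diff_right)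
  have g: "GDERIV (\<lambda>x. half_square (q x)) x :> D x" for x
    unfolding D_def by (rule GDERIV_DERIV_compose[OF gq half_square_deriv])
  have c: "continuous_on UNIV D" unfolding D_def q_def by (intro continuous_intros)
  have b1: "\<bar>half_square (q x)\<bar> \<le> (s\<^sup>2)\<^sup>2" for x
  proof -
    have "(max 0 (q x))\<^sup>2 \<le> (s\<^sup>2)\<^sup>2" using qs[of x] by (intro power_mono) auto
    moreover have "0 \<le> (max 0 (q x))\<^sup>2" by simp
    ultimately show ?thesis unfolding half_square_def by linarith
  qed
  have b2: "norm (D x) \<le> s\<^sup>2 * (2 * s)" for x
  proof (cases "q x > 0")
    case True
    hence "norm (x - a) \<le> s" using q[of x] by (simp add: dist_norm norm_minus_commute)
    thus ?thesis using qs[of x] True s by (auto simp: D_def intro!: mult_mono)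
  qed (use s in \<open>simp add: D_def max_def\<close>)
  show ?thesis
  proof (intro bexI conjI allI)
    show "(\<lambda>x. half_square (q x)) \<in> Cb1" by (rule Cb1I(1)[OF g c b1 b2])
    show "half_square (q x) \<ge> 0" for x by (simp add: half_square_def)
    have "half_square t > 0 \<longleftrightarrow> t > 0" for t by (auto simp: half_square_def max_def)
    thus "{x. half_square (q x) > 0} = ball a s" by (simp only: q Collect_mem_eq)
  qed
qed

text \<open>The open sets \<open>{\<phi> > 0}\<close> with \<open>\<phi> \<ge> 0\<close> in \<open>Cb1\<close> are closed under intersection, by multiplying the
  functions, and contain all balls, hence generate the Borel sets. The indicator of such a set is the
  limit of \<open>k\<phi> / (1 + k\<phi>)\<close>.\<close>

lemma measure_eqI_Cb1:
  fixes M N :: "'a::{real_inner, second_countable_topology} measure"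
  assumes M: "finite_measure M" "sets M = sets borel" and N: "finite_measure N" "sets N = sets borel"
    and eq: "\<And>\<phi>. \<phi> \<in> Cb1 \<Longrightarrow> (\<And>x. \<phi> x \<ge> 0) \<Longrightarrow> (\<integral>x. \<phi> x \<partial>M) = (\<integral>x. \<phi> x \<partial>N)"
  shows "M = N"
proof -
  define E where "E = {{x::'a. \<phi> x > 0} | \<phi>. \<phi> \<in> Cb1 \<and> (\<forall>x. \<phi> x \<ge> 0)}"
  have lim: "(\<lambda>n. \<integral>x. (real n * \<phi> x) / (1 + real n * \<phi> x) \<partial>L) \<longlonglongrightarrow> measure L {x. \<phi> x > 0}"
    if \<phi>: "\<phi> \<in> Cb1" "\<forall>x. \<phi> x \<ge> 0" and L: "finite_measure L" "sets L = sets borel" for \<phi> and L :: "'a measure"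
  proof -
    interpret finite_measure L by fact
    have [measurable]: "\<phi> \<in> borel_measurable L"
      using borel_measurable_continuous_onI[OF Cb1D(3)[OF \<phi>(1)]] measurable_cong_sets[OF L(2) refl] by blast
    have [simp]: "space L = UNIV" using sets_eq_imp_space_eq[OF L(2)] by simp
    have "{x \<in> space L. \<phi> x > 0} \<in> sets L" by measurable
    hence [measurable]: "{x. \<phi> x > 0} \<in> sets L" by simp
    have "(\<lambda>n. \<integral>x. (real n * \<phi> x) / (1 + real n * \<phi> x) \<partial>L) \<longlonglongrightarrow> (\<integral>x. indicator {x. \<phi> x > 0} x \<partial>L)"
    proof (rule integral_dominated_convergence[where w = "\<lambda>_. 1"])
      show "AE x in L. (\<lambda>n. (real n * \<phi> x) / (1 + real n * \<phi> x)) \<longlonglongrightarrow> indicator {x. \<phi> x > 0} x"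
      proof (rule AE_I2)
        fix x
        show "(\<lambda>n. (real n * \<phi> x) / (1 + real n * \<phi> x)) \<longlonglongrightarrow> indicator {x. \<phi> x > 0} x"
        proof (cases "\<phi> x > 0")
          case True
          have "filterlim (\<lambda>n. 1 + \<phi> x * real n) at_top sequentially"
            by (intro filterlim_tendsto_add_at_top[OF tendsto_const]
                filterlim_tendsto_pos_mult_at_top[OF tendsto_const True] filterlim_real_sequentially)
          hence "(\<lambda>n. 1 - inverse (1 + \<phi> x * real n)) \<longlonglongrightarrow> 1 - 0"
            by (intro tendsto_diff tendsto_const tendsto_inverse_0_at_top)
          moreover have "1 - inverse (1 + \<phi> x * real n) = (real n * \<phi> x) / (1 + real n * \<phi> x)" for n
          proof -
            have "1 + \<phi> x * real n > 0" using True by (simp add: add_pos_nonneg)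
            thus ?thesis by (simp add: field_simps)
          qed
          ultimately show ?thesis using True by simp
        next
          case False
          hence "\<phi> x = 0" using \<phi>(2) by (metis order_le_less)
          thus ?thesis by simp
        qed
      qed
      show "AE x in L. norm ((real n * \<phi> x) / (1 + real n * \<phi> x)) \<le> 1" for n
      proof (rule AE_I2)
        fix x
        have "real n * \<phi> x \<ge> 0" using \<phi>(2) by simp
        thus "norm ((real n * \<phi> x) / (1 + real n * \<phi> x)) \<le> 1" by (simp add: divide_le_eq_1)
      qed
    qed auto
    thus ?thesis by simp
  qed
  have cb: "(\<lambda>x. (real n * \<phi> x) / (1 + real n * \<phi> x)) \<in> Cb1" if \<phi>: "\<phi> \<in> Cb1" "\<forall>x. \<phi> x \<ge> 0" for n and \<phi> :: "'a \<Rightarrow> real"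
  proof -
    have pos: "1 + real n * \<phi> x > 0" for x using \<phi>(2) by (simp add: add_pos_nonneg)
    have der: "((\<lambda>t. (real n * t) / (1 + real n * t)) has_real_derivative real n / (1 + real n * \<phi> x)\<^sup>2) (at (\<phi> x))" for x
      using pos[of x] by (auto intro!: derivative_eq_intros simp: field_simps power2_eq_square)
    have cont: "continuous_on UNIV (\<lambda>x. real n / (1 + real n * \<phi> x)\<^sup>2)"
    proof -
      have "(1 + real n * \<phi> x)\<^sup>2 \<noteq> 0" for x using pos[of x] by (metis less_irrefl power2_eq_square mult_pos_pos)
      thus ?thesis
        by (intro continuous_on_divide continuous_on_power continuous_on_add continuous_on_mult
            continuous_on_const Cb1D(3)[OF \<phi>(1)]) auto
    qed
    have b1: "\<bar>(real n * \<phi> x) / (1 + real n * \<phi> x)\<bar> \<le> 1" for x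
    proof -
      have "real n * \<phi> x \<ge> 0" using \<phi>(2) by simp
      thus ?thesis by (simp add: divide_le_eq_1)
    qed
    have b2: "\<bar>real n / (1 + real n * \<phi> x)\<^sup>2\<bar> \<le> real n" for x
    proof -
      have "1 \<le> (1 + real n * \<phi> x)\<^sup>2" using \<phi>(2) by (intro one_le_power) simp
      hence "real n / (1 + real n * \<phi> x)\<^sup>2 \<le> real n / 1" by (intro divide_left_mono) auto
      thus ?thesis by simp
    qed
    show ?thesis by (rule Cb1_compose(1)[OF \<phi>(1) der cont b1 b2])
  qed
  have "emeasure M X = emeasure N X" if X: "X \<in> E" for X
  proof -
    obtain \<phi> where \<phi>: "X = {x. \<phi> x > 0}" "\<phi> \<in> Cb1" "\<forall>x. \<phi> x \<ge> 0" using X unfolding E_def by blast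
    have e: "(\<integral>x. (real n * \<phi> x) / (1 + real n * \<phi> x) \<partial>M) = (\<integral>x. (real n * \<phi> x) / (1 + real n * \<phi> x) \<partial>N)" for n
      by (rule eq[OF cb[OF \<phi>(2,3)]]) (use \<phi>(3) in \<open>simp add: divide_nonneg_nonneg\<close>)
    have "measure M X = measure N X"
      using LIMSEQ_unique[OF lim[OF \<phi>(2,3) M] lim[OF \<phi>(2,3) N, folded e]] \<phi>(1) by simp
    thus ?thesis using M(1) N(1) by (simp add: finite_measure.emeasure_eq_measure)
  qed
  note emeas = this
  have ball_E: "ball a s \<in> E" for a :: 'a and s
  proof -
    obtain \<phi> where "\<phi> \<in> Cb1" "\<forall>x. \<phi> x \<ge> 0" "{x. \<phi> x > 0} = ball a s" using Cb1_ball[of a s] by blast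
    thus ?thesis unfolding E_def by (intro CollectI exI[of _ \<phi>]) auto
  qed
  have E_open: "open X" if X: "X \<in> E" for X
  proof -
    obtain \<phi> where \<phi>: "X = {x. \<phi> x > 0}" "\<phi> \<in> Cb1" using X unfolding E_def by blast
    show ?thesis unfolding \<phi>(1) by (intro open_Collect_less continuous_on_const Cb1D(3)[OF \<phi>(2)])
  qed
  have gen: "sets (borel :: 'a measure) = sigma_sets UNIV E"
  proof -
    have "(borel :: 'a measure) = sigma UNIV ((\<lambda>X. X) ` E)"
    proof (rule borel_eq_sigmaI1[OF borel_def, where F = "\<lambda>X. X" and A = E])
      show "X \<in> sets (sigma UNIV ((\<lambda>X. X) ` E))" if X: "X \<in> {S. open S}" for X :: "'a set"
      proof -
        let ?F = "{ball a s | a s. ball a s \<subseteq> X}"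
        obtain F' where F': "F' \<subseteq> ?F" "countable F'" "\<Union>F' = \<Union>?F" by (rule Lindelof[of ?F]) auto
        have "\<Union>?F = X"
        proof
          show "X \<subseteq> \<Union>?F"
          proof
            fix x assume "x \<in> X"
            then obtain e where "e > 0" "ball x e \<subseteq> X" using X by (auto elim: openE)
            thus "x \<in> \<Union>?F" using centre_in_ball[of x e] by blast
          qed
        qed auto
        moreover have "\<Union>F' \<in> sets (sigma UNIV E)"
          using F'(1,2) ball_E by (intro sets.countable_Union) (auto intro!: sigma_sets.Basic simp: sets_measure_of)
        ultimately show ?thesis using F'(3) by simp
      qed
    qed (use E_open in auto)
    hence eq: "(borel :: 'a measure) = sigma UNIV E" by simp
    show ?thesis unfolding eq by (rule sets_measure_of) simp
  qed
  have UNIV_E: "UNIV \<in> E"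
    unfolding E_def using Cb1_const(1)[where 'a = 'a, of 1] by (intro CollectI exI[of _ "\<lambda>_. 1"]) auto
  show ?thesis
  proof (rule measure_eqI_generator_eq[where E = E and \<Omega> = UNIV and A = "\<lambda>_. UNIV"])
    show "Int_stable E"
    proof (rule Int_stableI)
      fix X Y assume "X \<in> E" "Y \<in> E"
      then obtain \<phi> \<psi> where *: "X = {x. \<phi> x > 0}" "\<phi> \<in> Cb1" "\<forall>x. \<phi> x \<ge> 0" "Y = {x. \<psi> x > 0}" "\<psi> \<in> Cb1" "\<forall>x. \<psi> x \<ge> 0"
        unfolding E_def by blast
      have "\<phi> x * \<psi> x > 0 \<longleftrightarrow> \<phi> x > 0 \<and> \<psi> x > 0" for x
        using *(3,6) by (auto simp: zero_less_mult_iff not_less[symmetric])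
      hence "X \<inter> Y = {x. \<phi> x * \<psi> x > 0}" unfolding *(1,4) by auto
      thus "X \<inter> Y \<in> E" unfolding E_def using Cb1_mult(1)[OF *(2,5)] *(3,6) by auto
    qed
    show "emeasure M UNIV \<noteq> \<infinity>" using M(1) by (simp add: finite_measure.emeasure_eq_measure)
  qed (use emeas gen M(2) N(2) UNIV_E in auto)
qed

section \<open>Comparison of two defining functions\<close>

text \<open>Both sides are limits of averages over thin slabs of \<open>g2\<close>. For the left-hand side this holds because
  \<open>trace_integral\<close> expresses it by an integral over the sublevel set of \<open>g1\<close>, which is that of \<open>g2\<close>, and
  \<open>slab_limit\<close> admits the field \<open>\<Psi>1\<close> in combination with the function \<open>g2\<close>.\<close>

lemma weighted_trace_le:
  assumes 1: "level_function \<nu> R g1 G1 \<Psi>1 r \<sigma>1" and 2: "level_function \<nu> R g2 G2 \<Psi>2 r \<sigma>2"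
    and same: "{x. g1 x < r} = {x. g2 x < r}"
    and p: "p > 1"
    and f1: "grad_closure \<nu> R (2 * p) f1 F1" "is_trace \<nu> R \<sigma>1 f1 u1"
    and f2: "grad_closure \<nu> R (2 * p) f2 F2" "is_trace \<nu> R \<sigma>2 f2 u2"
    and le: "AE x in \<nu>. f1 x * (G2 x \<bullet> \<Psi>1 x) \<le> f2 x"
    and \<phi>: "\<phi> \<in> Cb1" "\<And>x. \<phi> x \<ge> 0"
  shows "(\<integral>x. \<phi> x * u1 x \<partial>\<sigma>1) \<le> (\<integral>x. \<phi> x * u2 x \<partial>\<sigma>2)"
proof -
  interpret L1: level_function \<nu> R g1 G1 \<Psi>1 r \<sigma>1 by (rule 1)
  interpret L2: level_function \<nu> R g2 G2 \<Psi>2 r \<sigma>2 by (rule 2)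
  have p2: "2 * p > 0" using p by simp
  obtain h1 where d1: "L1.dual_field p \<Psi>1 h1" using L1.dual[OF p] by blast
  obtain h2 where d2: "L1.dual_field p \<Psi>2 h2" using L2.dual[OF p] by blast
  note g2 = L2.two_gG[OF d2]
  note c1 = L1.grad_closure_Cb1_mult[OF \<phi>(1) p2 f1(1)] and c2 = L1.grad_closure_Cb1_mult[OF \<phi>(1) p2 f2(1)]
  let ?S = "L1.slab g2 r"
  have lim1: "(\<lambda>n. real (Suc n) * (\<integral>x. indicator (?S n) x * (\<phi> x * f1 x * (G2 x \<bullet> \<Psi>1 x)) \<partial>\<nu>))
      \<longlonglongrightarrow> (\<integral>x. \<phi> x * u1 x \<partial>\<sigma>1)"
    using L1.slab_limit[OF d1 c1 g2, of r] L1.trace_integral[OF f1(2,1) d1 \<phi>(1)] same by simp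
  have lim2: "(\<lambda>n. real (Suc n) * (\<integral>x. indicator (?S n) x * (\<phi> x * f2 x * (G2 x \<bullet> \<Psi>2 x)) \<partial>\<nu>))
      \<longlonglongrightarrow> (\<integral>x. \<phi> x * u2 x \<partial>\<sigma>2)"
    using L1.slab_limit[OF d2 c2 g2, of r] L2.trace_integral[OF f2(2,1) d2 \<phi>(1)] by simp
  have [simp]: "space \<nu> = UNIV" using sets_eq_imp_space_eq[OF L1.sets_nu] by simp
  have S: "?S n \<in> sets \<nu>" for n
  proof -
    note [measurable] = L1.grad_closure_lp(3)[OF g2]
    have "{x \<in> space \<nu>. r - inverse (real (Suc n)) < g2 x \<and> g2 x \<le> r} \<in> sets \<nu>" by measurable
    thus ?thesis by (simp add: L1.slab_def)
  qed
  show ?thesis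
  proof (rule LIMSEQ_le[OF lim1 lim2], intro exI allI impI mult_left_mono integral_mono_AE)
    fix n
    show "integrable \<nu> (\<lambda>x. indicator (?S n) x * (\<phi> x * f1 x * (G2 x \<bullet> \<Psi>1 x)))"
      using integrable_mult_indicator[OF S L1.slab_integrable(1)[OF d1 c1 g2]] by simp
    show "integrable \<nu> (\<lambda>x. indicator (?S n) x * (\<phi> x * f2 x * (G2 x \<bullet> \<Psi>2 x)))"
      using integrable_mult_indicator[OF S L1.slab_integrable(1)[OF d2 c2 g2]] by simp
    show "AE x in \<nu>. indicator (?S n) x * (\<phi> x * f1 x * (G2 x \<bullet> \<Psi>1 x))
        \<le> indicator (?S n) x * (\<phi> x * f2 x * (G2 x \<bullet> \<Psi>2 x))"
      using le L2.transversal
    proof eventually_elim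
      case (elim x)
      have "\<phi> x * (f1 x * (G2 x \<bullet> \<Psi>1 x)) \<le> \<phi> x * f2 x" using elim(1) \<phi>(2) by (rule mult_left_mono)
      thus ?case using elim(2) by (intro mult_left_mono) (auto simp: mult.assoc)
    qed
  qed simp
qed

lemma admissible_level_function:
  assumes "closable_gradient \<nu> R" and g: "admissible \<nu> R g" and \<sigma>: "is_surface_measure \<nu> g r \<sigma>"
  defines "G \<equiv> sobolev_grad_all \<nu> R g"
  shows "level_function \<nu> R g G (\<lambda>x. (1 / (norm (G x))\<^sup>2) *\<^sub>R G x) r \<sigma>"
proof -
  interpret closable_gradient \<nu> R by fact
  show ?thesis
  proof unfold_locales
    show "grad_closure \<nu> R p g G" if "p > 1" for p
      unfolding G_def using g that by (intro sobolev_grad_all) (auto simp: admissible_def)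
    show "\<exists>h. dual_field p (\<lambda>x. (1 / (norm (G x))\<^sup>2) *\<^sub>R G x) h" if p: "p > 1" for p
    proof -
      have "(\<lambda>x. (1 / (norm (G x))\<^sup>2) *\<^sub>R G x) \<in> adjoint_domain \<nu> R p"
        using g p by (auto simp: admissible_def G_def)
      from adjoint_domain_dual_field[OF this p] show ?thesis by blast
    qed
    have "AE x in \<nu>. G x \<noteq> 0" using g by (simp add: admissible_def G_def)
    thus "AE x in \<nu>. G x \<bullet> ((1 / (norm (G x))\<^sup>2) *\<^sub>R G x) = 1"
      by eventually_elim (simp add: power2_norm_eq_inner)
  qed (rule \<sigma>)
qed

lemma norm_mult_inner_normalized_le:
  fixes a b :: "'a::real_inner"
  assumes "a \<noteq> 0" shows "norm a * (b \<bullet> ((1 / (norm a)\<^sup>2) *\<^sub>R a)) \<le> norm b"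
proof -
  have "norm a * (b \<bullet> ((1 / (norm a)\<^sup>2) *\<^sub>R a)) = (b \<bullet> a) / norm a"
    using assms by (simp add: power2_eq_square)
  also have "\<dots> \<le> (norm b * norm a) / norm a" by (intro divide_right_mono norm_cauchy_schwarz) simp
  finally show ?thesis using assms by simp
qed

theorem mainTheorem7:
  fixes \<nu> \<sigma>1 \<sigma>2 :: "'a::{real_inner, complete_space, second_countable_topology} measure"
    and R :: "'a \<Rightarrow> 'a"
    and e :: "nat \<Rightarrow> 'a"
    and g1 g2 :: "'a \<Rightarrow> real"
    and r :: real
  assumes infinite_dim: "\<not> (\<exists>B::'a set. finite B \<and> span B = UNIV)"
    and e: "orthonormal_basis e"
    and \<nu>_borel: "sets \<nu> = sets borel"
    and \<nu>_prob: "prob_space \<nu>"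
    and \<nu>_nondeg: "nondegenerate \<nu>"
    and R: "bounded_linear R"
    and closable: "\<forall>p>1. closable_grad \<nu> R p"
    and g1: "admissible \<nu> R g1"
    and g2: "admissible \<nu> R g2"
    and Mg1: "\<exists>q>2. sobolev_grad_all \<nu> R g1 \<in> sobolev_field e \<nu> R q"
    and Mg2: "\<exists>q>2. sobolev_grad_all \<nu> R g2 \<in> sobolev_field e \<nu> R q"
    and \<sigma>1: "is_surface_measure \<nu> g1 r \<sigma>1"
    and \<sigma>2: "is_surface_measure \<nu> g2 r \<sigma>2"
    and same_sublevel: "{x. g1 x < r} = {x. g2 x < r}"
  shows "density \<sigma>1 (\<lambda>x. ennreal (sobolev_trace \<nu> R \<sigma>1 (\<lambda>y. norm (sobolev_grad_all \<nu> R g1 y)) x)) =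
         density \<sigma>2 (\<lambda>x. ennreal (sobolev_trace \<nu> R \<sigma>2 (\<lambda>y. norm (sobolev_grad_all \<nu> R g2 y)) x))"
proof -
  have CG: "closable_gradient \<nu> R"
    by (rule closable_gradient.intro[OF \<nu>_borel \<nu>_prob R closable])
  interpret closable_gradient \<nu> R by (rule CG)
  let ?G1 = "sobolev_grad_all \<nu> R g1" and ?G2 = "sobolev_grad_all \<nu> R g2"
  let ?w1 = "\<lambda>y. norm (?G1 y)" and ?w2 = "\<lambda>y. norm (?G2 y)"
  let ?u1 = "sobolev_trace \<nu> R \<sigma>1 ?w1" and ?u2 = "sobolev_trace \<nu> R \<sigma>2 ?w2"
  interpret L1: level_function \<nu> R g1 ?G1 "\<lambda>x. (1 / (norm (?G1 x))\<^sup>2) *\<^sub>R ?G1 x" r \<sigma>1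
    by (rule admissible_level_function[OF CG g1 \<sigma>1])
  interpret L2: level_function \<nu> R g2 ?G2 "\<lambda>x. (1 / (norm (?G2 x))\<^sup>2) *\<^sub>R ?G2 x" r \<sigma>2
    by (rule admissible_level_function[OF CG g2 \<sigma>2])
  have nz1: "AE x in \<nu>. ?G1 x \<noteq> 0" and nz2: "AE x in \<nu>. ?G2 x \<noteq> 0"
    using g1 g2 by (auto simp: admissible_def)
  obtain q1 where q1: "q1 > 2" "?G1 \<in> sobolev_field e \<nu> R q1" using Mg1 by blast
  obtain q2 where q2: "q2 > 2" "?G2 \<in> sobolev_field e \<nu> R q2" using Mg2 by blast
  have q1': "q1 > 1" and q2': "q2 > 1" using q1(1) q2(1) by auto
  obtain W1 where W1: "grad_closure \<nu> R q1 ?w1 W1"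
    using norm_field_sobolev[OF e q1(2) q1' grad_closure_lp(2)[OF L1.gG[OF q1']] nz1] by blast
  obtain W2 where W2: "grad_closure \<nu> R q2 ?w2 W2"
    using norm_field_sobolev[OF e q2(2) q2' grad_closure_lp(2)[OF L2.gG[OF q2']] nz2] by blast
  \<comment> \<open>\<open>q > 2\<close> is what allows an exponent \<open>p > 1\<close> with \<open>2 * p \<le> q\<close>, as the product rule halves the exponent.\<close>
  define p where "p = min q1 q2 / 2"
  have p: "p > 1" "2 * p > 0" "2 * p > 1" "2 * p \<le> q1" "2 * p \<le> q2"
    using q1(1) q2(1) by (auto simp: p_def min_def)
  have c1: "grad_closure \<nu> R (2 * p) ?w1 W1" by (rule grad_closure_mono[OF W1 p(2,4)])
  have c2: "grad_closure \<nu> R (2 * p) ?w2 W2" by (rule grad_closure_mono[OF W2 p(2,5)])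
  have t1: "is_trace \<nu> R \<sigma>1 ?w1 ?u1"
    by (rule L1.sobolev_trace_is_trace[OF _ p(3)]) (use c1 in \<open>auto simp: sobolev_def\<close>)
  have t2: "is_trace \<nu> R \<sigma>2 ?w2 ?u2"
    by (rule L2.sobolev_trace_is_trace[OF _ p(3)]) (use c2 in \<open>auto simp: sobolev_def\<close>)
  have i1: "integrable \<sigma>1 ?u1" and i2: "integrable \<sigma>2 ?u2" using t1 t2 by (auto simp: is_trace_def)
  have n1: "AE x in \<sigma>1. ?u1 x \<ge> 0" by (rule L1.trace_nonneg[OF t1 c1 p(1)]) simp
  have n2: "AE x in \<sigma>2. ?u2 x \<ge> 0" by (rule L2.trace_nonneg[OF t2 c2 p(1)]) simp
  have le12: "AE x in \<nu>. ?w1 x * (?G2 x \<bullet> ((1 / (norm (?G1 x))\<^sup>2) *\<^sub>R ?G1 x)) \<le> ?w2 x"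
    using nz1 by eventually_elim (rule norm_mult_inner_normalized_le)
  have le21: "AE x in \<nu>. ?w2 x * (?G1 x \<bullet> ((1 / (norm (?G2 x))\<^sup>2) *\<^sub>R ?G2 x)) \<le> ?w1 x"
    using nz2 by eventually_elim (rule norm_mult_inner_normalized_le)
  have fin: "finite_measure (density M (\<lambda>x. ennreal (u x)))" if u: "integrable M u"
    for M :: "'a measure" and u :: "'a \<Rightarrow> real"
  proof (rule finite_measureI)
    note [measurable] = borel_measurable_integrable[OF u]
    have "(\<integral>\<^sup>+x. ennreal (u x) \<partial>M) \<le> (\<integral>\<^sup>+x. ennreal (norm (u x)) \<partial>M)"
      by (intro nn_integral_mono ennreal_leI) simp
    also have "\<dots> < \<infinity>" using u by (simp add: integrable_iff_bounded)
    finally show "emeasure (density M (\<lambda>x. ennreal (u x))) (space (density M (\<lambda>x. ennreal (u x)))) \<noteq> \<infinity>"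
      by (simp add: emeasure_density cong: nn_integral_cong)
  qed
  show ?thesis
  proof (rule measure_eqI_Cb1[OF fin[OF i1] _ fin[OF i2]])
    fix \<phi> :: "'a \<Rightarrow> real" assume \<phi>: "\<phi> \<in> Cb1" "\<And>x. \<phi> x \<ge> 0"
    have "(\<integral>x. \<phi> x * ?u1 x \<partial>\<sigma>1) = (\<integral>x. \<phi> x * ?u2 x \<partial>\<sigma>2)"
    proof (rule antisym)
      show "(\<integral>x. \<phi> x * ?u1 x \<partial>\<sigma>1) \<le> (\<integral>x. \<phi> x * ?u2 x \<partial>\<sigma>2)"
        by (rule weighted_trace_le[OF L1.level_function_axioms L2.level_function_axioms same_sublevel p(1) c1 t1 c2 t2 le12 \<phi>])
      show "(\<integral>x. \<phi> x * ?u2 x \<partial>\<sigma>2) \<le> (\<integral>x. \<phi> x * ?u1 x \<partial>\<sigma>1)"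
        by (rule weighted_trace_le[OF L2.level_function_axioms L1.level_function_axioms same_sublevel[symmetric] p(1) c2 t2 c1 t1 le21 \<phi>])
    qed
    thus "(\<integral>x. \<phi> x \<partial>density \<sigma>1 (\<lambda>x. ennreal (?u1 x))) = (\<integral>x. \<phi> x \<partial>density \<sigma>2 (\<lambda>x. ennreal (?u2 x)))"
      using integral_density[OF L1.surf_measurable[OF Cb1D(3)[OF \<phi>(1)]] borel_measurable_integrable[OF i1] n1]
        integral_density[OF L2.surf_measurable[OF Cb1D(3)[OF \<phi>(1)]] borel_measurable_integrable[OF i2] n2]
      by (simp add: mult.commute)
  qed (simp_all add: L1.sets_surf L2.sets_surf)
qed

end
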